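(* Let $G$ be the Grigorchuk group. Then the group $\mathbb{Z}^m \wr G$ is $2$-hereditarily conjugacy separable for every $m \in \mathbb{N}$.
   Context: View $\{0,1\}^*$ as the vertices of the infinite rooted binary tree $T$. The Grigorchuk group is $G = \langle a,b,c,d\rangle \leq \mathrm{Aut}(T)$, where, for all $\sigma\in\{0,1\}^*$, $a(0\sigma)=1\sigma$, $a(1\sigma)=0\sigma$; $b(0\sigma)=0a(\sigma)$, $b(1\sigma)=1c(\sigma)$; $c(0\sigma)=0a(\sigma)$, $c(1\sigma)=1d(\sigma)$; $d(0\sigma)=0\sigma$, $d(1\sigma)=1b(\sigma)$. $A \wr G$ denotes the restricted wreath product $A^G\rtimes G$, where $A^G$ is the group of finitely supported functions $G\to A$, on which $G$ acts by left translation of coordinates. A group $H$ is $2$-conjugacy separable if for every pair of non-conjugate elements $f,g\in H$ there is a surjective homomorphism $\pi$ from $H$ onto a finite $2$-group such that $\pi(f)$ and $\pi(g)$ are not conjugate in the image. $H$ is $2$-hereditarily conjugacy separable if it is $2$-conjugacy separable and so is every subgroup of $H$ containing some $N \unlhd H$ with $H/N$ a finite $2$-group. *)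

theory Defs
  imports
    "HOL-Algebra.Coset"
    "HOL-Algebra.Elementary_Groups"
    "HOL-Algebra.Generated_Groups"
    "HOL-Algebra.Product_Groups"
begin

section \<open>The Grigorchuk group\<close>

text \<open>
  Vertices of the infinite rooted binary tree are finite words, represented as \<^typ>\<open>bool list\<close>
  with \<^const>\<open>False\<close> for the letter 0 and \<^const>\<open>True\<close> for the letter 1; the head of the list is
  the letter nearest to the root.
\<close>

definition tree_edge :: "bool list \<Rightarrow> bool list \<Rightarrow> bool" where
  "tree_edge u v \<longleftrightarrow> (\<exists>x. v = u @ [x])"

text \<open>
  Edges point away from the root, and the root is the only vertex without an incoming edge.
  So every automorphism fixes the root.
\<close>

definition tree_aut_group :: "(bool list \<Rightarrow> bool list) monoid" where
  "tree_aut_group =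
     \<lparr>carrier = {f. bij f \<and> (\<forall>u v. tree_edge (f u) (f v) \<longleftrightarrow> tree_edge u v)},
      monoid.mult = (\<circ>),
      one = id\<rparr>"

fun grig_a :: "bool list \<Rightarrow> bool list" where
  "grig_a [] = []"
| "grig_a (False # s) = True # s"
| "grig_a (True # s) = False # s"

fun grig_b :: "bool list \<Rightarrow> bool list"
  and grig_c :: "bool list \<Rightarrow> bool list"
  and grig_d :: "bool list \<Rightarrow> bool list" where
  "grig_b [] = []"
| "grig_b (False # s) = False # grig_a s"
| "grig_b (True # s) = True # grig_c s"
| "grig_c [] = []"
| "grig_c (False # s) = False # grig_a s"
| "grig_c (True # s) = True # grig_d s"
| "grig_d [] = []"
| "grig_d (False # s) = False # s"
| "grig_d (True # s) = True # grig_b s"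

definition grigorchuk_group :: "(bool list \<Rightarrow> bool list) monoid" where
  "grigorchuk_group = subgroup_generated tree_aut_group {grig_a, grig_b, grig_c, grig_d}"

lemma group_tree_aut_group: "group tree_aut_group"
proof (rule groupI)
  fix f assume f: "f \<in> carrier tree_aut_group"
  then have bij: "bij f" and edge: "\<And>u v. tree_edge (f u) (f v) \<longleftrightarrow> tree_edge u v"
    by (auto simp: tree_aut_group_def)
  have "tree_edge (inv_into UNIV f u) (inv_into UNIV f v) \<longleftrightarrow> tree_edge u v" for u v
    using edge[of "inv_into UNIV f u" "inv_into UNIV f v"] bij
    by (simp add: bij_is_surj surj_f_inv_f)
  moreover have "inv_into UNIV f \<circ> f = id"
    using bij by (simp add: bij_is_inj)
  ultimately show "\<exists>g\<in>carrier tree_aut_group. g \<otimes>\<^bsub>tree_aut_group\<^esub> f = \<one>\<^bsub>tree_aut_group\<^esub>"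
    using bij bij_imp_bij_inv[OF bij] by (intro bexI[of _ "inv_into UNIV f"]) (simp_all add: tree_aut_group_def)
qed (auto simp: tree_aut_group_def intro: bij_comp)

lemma involution_in_tree_aut_group:
  assumes invol: "\<And>s. f (f s) = s" and edge: "\<And>s x. \<exists>y. f (s @ [x]) = f s @ [y]"
  shows "f \<in> carrier tree_aut_group"
proof -
  have imp: "tree_edge (f u) (f v)" if "tree_edge u v" for u v
    using that edge unfolding tree_edge_def by metis
  have "tree_edge u v" if "tree_edge (f u) (f v)" for u v
    using imp[OF that] by (simp add: invol)
  moreover have "bij f"
    by (rule o_bij[of f]) (auto simp: invol)
  ultimately have "bij f \<and> (\<forall>u v. tree_edge (f u) (f v) \<longleftrightarrow> tree_edge u v)"
    using imp by blast
  then show ?thesis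
    by (simp add: tree_aut_group_def)
qed

lemma grig_generators_in_tree_aut_group:
  "grig_a \<in> carrier tree_aut_group" "grig_b \<in> carrier tree_aut_group"
  "grig_c \<in> carrier tree_aut_group" "grig_d \<in> carrier tree_aut_group"
proof -
  have a: "grig_a (grig_a s) = s" for s
    by (cases s rule: grig_a.cases) auto
  have bcd: "grig_b (grig_b s) = s \<and> grig_c (grig_c s) = s \<and> grig_d (grig_d s) = s" for s
  proof (induction s)
    case (Cons x s) then show ?case by (cases x) (auto simp: a)
  qed simp
  have ea: "\<exists>y. grig_a (s @ [x]) = grig_a s @ [y]" for s x
    by (cases s rule: grig_a.cases; cases x) auto
  have ebcd: "(\<exists>y. grig_b (s @ [x]) = grig_b s @ [y]) \<and> (\<exists>y. grig_c (s @ [x]) = grig_c s @ [y])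
      \<and> (\<exists>y. grig_d (s @ [x]) = grig_d s @ [y])" for s x
  proof (induction s)
    case Nil then show ?case by (cases x) auto
  next
    case (Cons z s) then show ?case using ea[of s x] by (cases z) auto
  qed
  show "grig_a \<in> carrier tree_aut_group" "grig_b \<in> carrier tree_aut_group"
    "grig_c \<in> carrier tree_aut_group" "grig_d \<in> carrier tree_aut_group"
    by (rule involution_in_tree_aut_group; use a bcd ea ebcd in blast)+
qed

lemma group_grigorchuk_group: "group grigorchuk_group"
  unfolding grigorchuk_group_def
  by (rule group.group_subgroup_generated[OF group_tree_aut_group])

section \<open>Restricted wreath products\<close>

text \<open>
  The base group is the direct sum of copies of \<open>A\<close> indexed by \<open>G\<close>: functions in
  \<open>carrier G \<rightarrow>\<^sub>E carrier A\<close> of finite support, multiplied pointwise. An element \<open>g\<close> acts on it by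
  \<open>(g \<cdot> f) x = f (g\<inverse> x)\<close>.
\<close>

definition left_shift :: "('g, 'c) monoid_scheme \<Rightarrow> 'g \<Rightarrow> ('g \<Rightarrow> 'a) \<Rightarrow> 'g \<Rightarrow> 'a" where
  "left_shift G g f = (\<lambda>x\<in>carrier G. f (inv\<^bsub>G\<^esub> g \<otimes>\<^bsub>G\<^esub> x))"

definition restricted_wreath ::
    "('a, 'b) monoid_scheme \<Rightarrow> ('g, 'c) monoid_scheme \<Rightarrow> (('g \<Rightarrow> 'a) \<times> 'g) monoid" where
  "restricted_wreath A G =
     (let B = sum_group (carrier G) (\<lambda>_. A) in
      \<lparr>carrier = carrier B \<times> carrier G,
       monoid.mult = (\<lambda>(f, g) (f', g'). (f \<otimes>\<^bsub>B\<^esub> left_shift G g f', g \<otimes>\<^bsub>G\<^esub> g')),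
       one = (\<one>\<^bsub>B\<^esub>, \<one>\<^bsub>G\<^esub>)\<rparr>)"

lemma left_shift_closed:
  assumes "group A" "group G" "g \<in> carrier G" "f \<in> carrier (sum_group (carrier G) (\<lambda>_. A))"
  shows "left_shift G g f \<in> carrier (sum_group (carrier G) (\<lambda>_. A))"
proof -
  interpret G: group G by fact
  have f: "f \<in> carrier G \<rightarrow>\<^sub>E carrier A" "finite {x \<in> carrier G. f x \<noteq> \<one>\<^bsub>A\<^esub>}"
    using assms by (auto simp: carrier_sum_group)
  have "{x \<in> carrier G. f (inv\<^bsub>G\<^esub> g \<otimes>\<^bsub>G\<^esub> x) \<noteq> \<one>\<^bsub>A\<^esub>}
        \<subseteq> (\<lambda>y. g \<otimes>\<^bsub>G\<^esub> y) ` {x \<in> carrier G. f x \<noteq> \<one>\<^bsub>A\<^esub>}"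
  proof
    fix x assume x: "x \<in> {x \<in> carrier G. f (inv\<^bsub>G\<^esub> g \<otimes>\<^bsub>G\<^esub> x) \<noteq> \<one>\<^bsub>A\<^esub>}"
    then have "x = g \<otimes>\<^bsub>G\<^esub> (inv\<^bsub>G\<^esub> g \<otimes>\<^bsub>G\<^esub> x)"
      using assms(3) by (simp flip: G.m_assoc)
    then show "x \<in> (\<lambda>y. g \<otimes>\<^bsub>G\<^esub> y) ` {x \<in> carrier G. f x \<noteq> \<one>\<^bsub>A\<^esub>}"
      using x assms(3) by blast
  qed
  then have "finite {x \<in> carrier G. f (inv\<^bsub>G\<^esub> g \<otimes>\<^bsub>G\<^esub> x) \<noteq> \<one>\<^bsub>A\<^esub>}"
    using f(2) finite_surj by blast
  moreover have "{x \<in> carrier G. left_shift G g f x \<noteq> \<one>\<^bsub>A\<^esub>}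
      = {x \<in> carrier G. f (inv\<^bsub>G\<^esub> g \<otimes>\<^bsub>G\<^esub> x) \<noteq> \<one>\<^bsub>A\<^esub>}"
    by (auto simp: left_shift_def)
  moreover have "left_shift G g f \<in> carrier G \<rightarrow>\<^sub>E carrier A"
    using f(1) assms(3) by (auto simp: left_shift_def)
  ultimately show ?thesis
    using assms(1) by (simp add: carrier_sum_group)
qed

lemma group_restricted_wreath:
  assumes "group A" "group G"
  shows "group (restricted_wreath A G)"
proof -
  define B where "B = sum_group (carrier G) (\<lambda>_. A)"
  interpret A: group A by fact
  interpret G: group G by fact
  interpret B: group B
    unfolding B_def by (simp add: assms)
  have W: "restricted_wreath A G = \<lparr>carrier = carrier B \<times> carrier G,
       monoid.mult = (\<lambda>(f, g) (f', g'). (f \<otimes>\<^bsub>B\<^esub> left_shift G g f', g \<otimes>\<^bsub>G\<^esub> g')),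
       one = (\<one>\<^bsub>B\<^esub>, \<one>\<^bsub>G\<^esub>)\<rparr>"
    by (simp add: restricted_wreath_def B_def)
  have cl: "left_shift G g f \<in> carrier B" if "g \<in> carrier G" "f \<in> carrier B" for g f
    using left_shift_closed[OF assms] that by (simp add: B_def)
  have ext: "f \<in> carrier G \<rightarrow>\<^sub>E carrier A" if "f \<in> carrier B" for f
    using that by (simp add: B_def carrier_sum_group assms)
  have mult: "f \<otimes>\<^bsub>B\<^esub> f' = (\<lambda>x\<in>carrier G. f x \<otimes>\<^bsub>A\<^esub> f' x)" for f f'
    by (simp add: B_def)
  have one: "\<one>\<^bsub>B\<^esub> = (\<lambda>x\<in>carrier G. \<one>\<^bsub>A\<^esub>)"
    by (simp add: B_def)
  have s_mult: "left_shift G g (f \<otimes>\<^bsub>B\<^esub> f') = left_shift G g f \<otimes>\<^bsub>B\<^esub> left_shift G g f'"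
    if "g \<in> carrier G" for g f f'
    using that by (auto simp: mult left_shift_def)
  have s_one: "left_shift G \<one>\<^bsub>G\<^esub> f = f" if "f \<in> carrier B" for f
    using ext[OF that] by (auto simp: left_shift_def PiE_def extensional_def)
  have s_s: "left_shift G g (left_shift G h f) = left_shift G (g \<otimes>\<^bsub>G\<^esub> h) f"
    if "g \<in> carrier G" "h \<in> carrier G" for g h f
    using that by (auto simp: left_shift_def G.inv_mult_group G.m_assoc)
  have s_1: "left_shift G g \<one>\<^bsub>B\<^esub> = \<one>\<^bsub>B\<^esub>" if "g \<in> carrier G" for g
    using that by (auto simp: left_shift_def one)
  show ?thesis
    unfolding W
  proof (rule groupI; clarsimp simp: cl s_one s_mult s_s B.m_assoc G.m_assoc)
    fix f g assume fg: "f \<in> carrier B" "g \<in> carrier G"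
    show "\<exists>f'\<in>carrier B. \<exists>g'\<in>carrier G.
        f' \<otimes>\<^bsub>B\<^esub> left_shift G g' f = \<one>\<^bsub>B\<^esub> \<and> g' \<otimes>\<^bsub>G\<^esub> g = \<one>\<^bsub>G\<^esub>"
      by (intro bexI[of _ "left_shift G (inv\<^bsub>G\<^esub> g) (inv\<^bsub>B\<^esub> f)"] bexI[of _ "inv\<^bsub>G\<^esub> g"])
        (use fg in \<open>simp_all add: cl s_1 flip: s_mult\<close>)
  qed
qed

section \<open>Conjugacy separability\<close>

definition conjugate_in :: "('a, 'b) monoid_scheme \<Rightarrow> 'a \<Rightarrow> 'a \<Rightarrow> bool" where
  "conjugate_in H x y \<longleftrightarrow> (\<exists>h\<in>carrier H. y = h \<otimes>\<^bsub>H\<^esub> x \<otimes>\<^bsub>H\<^esub> inv\<^bsub>H\<^esub> h)"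

definition finite_p_group :: "nat \<Rightarrow> ('a, 'b) monoid_scheme \<Rightarrow> bool" where
  "finite_p_group p Q \<longleftrightarrow> group Q \<and> finite (carrier Q) \<and> (\<exists>k. order Q = p ^ k)"

text \<open>
  One cannot quantify over types inside a formula, so the finite quotients below have their carrier
  in \<^typ>\<open>nat\<close>. Every finite group is isomorphic to such a group; the lemma
  \<open>p_separated_by_any_type\<close> confirms that nothing is lost.
\<close>

definition p_conj_separable :: "nat \<Rightarrow> ('a, 'b) monoid_scheme \<Rightarrow> bool" where
  "p_conj_separable p H \<longleftrightarrow>
     (\<forall>f\<in>carrier H. \<forall>g\<in>carrier H. \<not> conjugate_in H f g \<longrightarrow>
        (\<exists>(Q :: nat monoid) \<pi>. finite_p_group p Q \<and> \<pi> \<in> epi H Q \<and> \<not> conjugate_in Q (\<pi> f) (\<pi> g)))"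

definition p_hereditarily_conj_separable :: "nat \<Rightarrow> ('a, 'b) monoid_scheme \<Rightarrow> bool" where
  "p_hereditarily_conj_separable p H \<longleftrightarrow>
     p_conj_separable p H \<and>
     (\<forall>K. subgroup K H \<and> (\<exists>N. N \<lhd> H \<and> finite_p_group p (H Mod N) \<and> N \<subseteq> K) \<longrightarrow>
        p_conj_separable p (H\<lparr>carrier := K\<rparr>))"

lemma p_separated_by_any_type:
  fixes R :: "('c, 'd) monoid_scheme"
  assumes R: "finite_p_group p R" and \<rho>: "\<rho> \<in> epi H R"
    and fg: "f \<in> carrier H" "g \<in> carrier H" and nc: "\<not> conjugate_in R (\<rho> f) (\<rho> g)"
  shows "\<exists>(Q :: nat monoid) \<pi>. finite_p_group p Q \<and> \<pi> \<in> epi H Q \<and> \<not> conjugate_in Q (\<pi> f) (\<pi> g)"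
proof -
  interpret R: group R using R by (simp add: finite_p_group_def)
  obtain \<phi> :: "'c \<Rightarrow> nat" where \<phi>: "inj_on \<phi> (carrier R)"
    using R finite_imp_inj_to_nat_seg[of "carrier R"] by (auto simp: finite_p_group_def)
  define \<psi> where "\<psi> = inv_into (carrier R) \<phi>"
  have \<psi>\<phi> [simp]: "\<psi> (\<phi> x) = x" if "x \<in> carrier R" for x
    using \<phi> that by (simp add: \<psi>_def)
  define Q :: "nat monoid" where
    "Q = \<lparr>carrier = \<phi> ` carrier R, monoid.mult = (\<lambda>x y. \<phi> (\<psi> x \<otimes>\<^bsub>R\<^esub> \<psi> y)), one = \<phi> \<one>\<^bsub>R\<^esub>\<rparr>"
  have carrier_Q: "carrier Q = \<phi> ` carrier R"
    by (simp add: Q_def)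
  have Q: "group Q"
  proof (rule groupI)
    fix x assume "x \<in> carrier Q"
    then obtain r where "r \<in> carrier R" "x = \<phi> r" by (auto simp: Q_def)
    then show "\<exists>y\<in>carrier Q. y \<otimes>\<^bsub>Q\<^esub> x = \<one>\<^bsub>Q\<^esub>"
      by (intro bexI[of _ "\<phi> (inv\<^bsub>R\<^esub> r)"]) (simp_all add: Q_def)
  qed (auto simp: Q_def R.m_assoc)
  have hom: "\<phi> \<in> hom R Q"
    by (auto simp: hom_def Q_def)
  have "order Q = order R"
    using \<phi> by (simp add: order_def Q_def card_image)
  then have "finite_p_group p Q"
    using Q R by (simp add: finite_p_group_def Q_def)
  moreover have "\<phi> \<circ> \<rho> \<in> epi H Q"
    using \<rho> hom by (intro epi_compose[OF \<rho>]) (simp add: epi_def Q_def)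
  moreover have "\<not> conjugate_in Q ((\<phi> \<circ> \<rho>) f) ((\<phi> \<circ> \<rho>) g)"
  proof
    have \<rho>R: "\<rho> f \<in> carrier R" "\<rho> g \<in> carrier R"
      using \<rho> fg by (auto simp: epi_def hom_def)
    interpret \<phi>: group_hom R Q \<phi>
      using Q hom R.is_group by (simp add: group_hom_def group_hom_axioms_def)
    assume "conjugate_in Q ((\<phi> \<circ> \<rho>) f) ((\<phi> \<circ> \<rho>) g)"
    then obtain r where r: "r \<in> carrier R"
        "\<phi> (\<rho> g) = \<phi> r \<otimes>\<^bsub>Q\<^esub> \<phi> (\<rho> f) \<otimes>\<^bsub>Q\<^esub> inv\<^bsub>Q\<^esub> (\<phi> r)"
      unfolding conjugate_in_def carrier_Q comp_def by blast
    then have "\<phi> (\<rho> g) = \<phi> (r \<otimes>\<^bsub>R\<^esub> \<rho> f \<otimes>\<^bsub>R\<^esub> inv\<^bsub>R\<^esub> r)"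
      using \<rho>R by simp
    then have "\<rho> g = r \<otimes>\<^bsub>R\<^esub> \<rho> f \<otimes>\<^bsub>R\<^esub> inv\<^bsub>R\<^esub> r"
      by (rule inj_onD[OF \<phi>]) (use r(1) \<rho>R in simp_all)
    then show False
      using nc r(1) by (auto simp: conjugate_in_def)
  qed
  ultimately show ?thesis
    by blast
qed

end

theory Submission
  imports Defs "HOL-Algebra.Sylow" "HOL-Algebra.Multiplicative_Group" "HOL-Library.Function_Algebras"
begin

text \<open>
  Write \<open>\<int>\<^sup>m \<wr> G\<close> as pairs \<open>(\<phi>, x)\<close>. It suffices that for cofinally many open normal
  subgroups \<open>N\<close> the \<open>N\<close>-conjugacy classes are closed in the pro-2 topology.

  For \<open>G\<close> itself this rests on two facts. The conjugacy problem for \<open>x\<close> reduces to that for the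
  sections of \<open>x\<close> or, if \<open>x\<close> moves the first level, for the product of its sections, and these
  are shorter than \<open>x\<close> after a suitable conjugation. The recursion ends in \<open>{1, b, c, d}\<close>, where the
  centralisers modulo deep levels are computed by hand up to the branching subgroup \<open>K\<close>. Every
  normal subgroup of finite index contains a product of copies of \<open>K\<close> on a deep level, and the
  property passes from \<open>K\<close> to these products and then upwards.

  For the wreath product, let \<open>(\<phi>, x)\<close> and \<open>(\<psi>, x)\<close> be conjugate modulo a deep open
  subgroup by \<open>(\<eta>, z)\<close>. Since \<open>x\<close> has finite order, its orbits on \<open>G\<close> are finite. If some orbit
  sum of \<open>\<phi>\<close> does not vanish, then \<open>z\<close> agrees modulo the deep subgroup with one of finitely many
  elements that move the support of \<open>\<phi>\<close> to that of \<open>\<psi>\<close>, and this element centralises \<open>x\<close>;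
  otherwise \<open>z = 1\<close> will do. A function on \<open>G\<close> is of the form \<open>\<eta> - x \<eta>\<close> iff its orbit sums
  vanish, which is visible modulo a deep subgroup.
\<close>

section \<open>The Grigorchuk group as a type\<close>

text \<open>Two obstacles shape the proof. Conjugators found separately for the two sections of an
  element must be the sections of a single element of \<open>G\<close>, and not every pair is of
  this kind. Pairs from \<open>K\<close> are, because \<open>K\<close> contains a copy of
  \<open>K \<times> K\<close> one level down; so conjugators are kept inside \<open>K\<close>
  throughout, and conjugacy in \<open>G\<close> alone would not support the recursion. The price is
  paid at its end: there a conjugator is known only modulo \<open>K\<close>, and its coset must be
  shown to contain an element that centralises exactly. In the wreath product the conjugator must
  lie in the given open subgroup. A solution of \<open>\<eta> - x \<eta> = \<theta>\<close> is
  unique only up to \<open>x\<close>-invariant functions, and the one read off from orbit sums may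
  lie outside. It is corrected by an invariant function, which exists because the powers of
  \<open>x\<close> act freely on the cosets of a deep subgroup. All orders in \<open>G\<close> are
  powers of 2, so every finite quotient of \<open>G\<close> is a 2-group. This is why subgroups of
  \<open>G\<close> are only required to have finite index.\<close>

lemma grigorchuk_group_simps [simp]:
  "f \<otimes>\<^bsub>grigorchuk_group\<^esub> g = f \<circ> g" "\<one>\<^bsub>grigorchuk_group\<^esub> = id"
  by (simp_all add: grigorchuk_group_def tree_aut_group_def)

lemma carrier_grigorchuk_group:
  "carrier grigorchuk_group = generate tree_aut_group {grig_a, grig_b, grig_c, grig_d}"
proof -
  have "carrier tree_aut_group \<inter> {grig_a, grig_b, grig_c, grig_d} = {grig_a, grig_b, grig_c, grig_d}"
    using grig_generators_in_tree_aut_group by auto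
  then show ?thesis
    by (simp add: grigorchuk_group_def carrier_subgroup_generated)
qed

text \<open>On a type the group laws hold without carrier conditions. The class
  \<open>group_add\<close> is not commutative: \<open>+\<close> is composition with the right
  summand acting first, and \<open>g + x - g\<close> is a conjugate of \<open>x\<close>.\<close>

typedef grig = "carrier grigorchuk_group"
  using group.is_monoid[OF group_grigorchuk_group] monoid.one_closed by blast

instantiation grig :: group_add
begin

definition "0 = Abs_grig id"
definition "g + h = Abs_grig (Rep_grig g \<circ> Rep_grig h)"
definition "- g = Abs_grig (inv\<^bsub>grigorchuk_group\<^esub> Rep_grig g)"
definition "g - h = g + - (h :: grig)"

instance
proof -
  interpret G: group grigorchuk_group
    by (rule group_grigorchuk_group)
  have id: "id \<in> carrier grigorchuk_group"
    using G.one_closed by simp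
  have comp: "Rep_grig g \<circ> Rep_grig h \<in> carrier grigorchuk_group" for g h
    using G.m_closed[OF Rep_grig Rep_grig, of g h] by simp
  have inv: "inv\<^bsub>grigorchuk_group\<^esub> Rep_grig g \<in> carrier grigorchuk_group" for g
    using Rep_grig by simp
  show "OFCLASS(grig, group_add_class)"
  proof
    fix g h k :: grig
    show "g + h + k = g + (h + k)"
      by (simp add: plus_grig_def Abs_grig_inverse comp comp_assoc)
    show "0 + g = g" "g + 0 = g"
      by (simp_all add: plus_grig_def zero_grig_def Abs_grig_inverse id Rep_grig_inverse)
    show "- g + g = 0"
      using G.l_inv[OF Rep_grig, of g]
      by (simp add: plus_grig_def uminus_grig_def zero_grig_def Abs_grig_inverse inv)
    show "g + - h = g - h"
      by (simp add: minus_grig_def)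
  qed
qed

end

lemma Rep_grig_zero [simp]: "Rep_grig 0 w = w"
  and Rep_grig_plus [simp]: "Rep_grig (g + h) w = Rep_grig g (Rep_grig h w)"
proof -
  interpret G: group grigorchuk_group
    by (rule group_grigorchuk_group)
  show "Rep_grig 0 w = w"
    using G.one_closed by (simp add: zero_grig_def Abs_grig_inverse)
  show "Rep_grig (g + h) w = Rep_grig g (Rep_grig h w)"
    using G.m_closed[OF Rep_grig Rep_grig, of g h] by (simp add: plus_grig_def Abs_grig_inverse)
qed

lemma grig_eqI: "(\<And>w. Rep_grig g w = Rep_grig h w) \<Longrightarrow> g = h"
  by (simp add: Rep_grig_inject[symmetric] fun_eq_iff)

definition ga :: grig where "ga = Abs_grig grig_a"
definition gb :: grig where "gb = Abs_grig grig_b"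
definition gc :: grig where "gc = Abs_grig grig_c"
definition gd :: grig where "gd = Abs_grig grig_d"

lemma Rep_grig_generators [simp]:
  "Rep_grig ga = grig_a" "Rep_grig gb = grig_b" "Rep_grig gc = grig_c" "Rep_grig gd = grig_d"
  unfolding ga_def gb_def gc_def gd_def
  by (intro Abs_grig_inverse; force simp: carrier_grigorchuk_group intro: generate.incl)+

lemma grig_generator_involution:
  "grig_a (grig_a s) = s" "grig_b (grig_b s) = s" "grig_c (grig_c s) = s" "grig_d (grig_d s) = s"
proof -
  have a: "grig_a (grig_a s) = s" for s
    by (cases s rule: grig_a.cases) auto
  have "grig_b (grig_b s) = s \<and> grig_c (grig_c s) = s \<and> grig_d (grig_d s) = s"
  proof (induction s)
    case (Cons x s) then show ?case by (cases x) (auto simp: a)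
  qed simp
  then show "grig_a (grig_a s) = s" "grig_b (grig_b s) = s" "grig_c (grig_c s) = s" "grig_d (grig_d s) = s"
    using a by auto
qed

lemma gen_double [simp]: "ga + ga = 0" "gb + gb = 0" "gc + gc = 0" "gd + gd = 0"
  by (rule grig_eqI; simp add: grig_generator_involution)+

lemma gen_double_left [simp]:
  "ga + (ga + x) = x" "gb + (gb + x) = x" "gc + (gc + x) = x" "gd + (gd + x) = x"
  by (simp_all flip: add.assoc)

lemma gen_uminus [simp]: "- ga = ga" "- gb = gb" "- gc = gc" "- gd = gd"
  by (simp_all add: minus_unique)

text \<open>The generators are involutions, so words without inverses reach every element.\<close>

lemma grig_gen_induct [case_names zero a b c d]:
  assumes "P 0" "\<And>g. P g \<Longrightarrow> P (ga + g)" "\<And>g. P g \<Longrightarrow> P (gb + g)"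
    "\<And>g. P g \<Longrightarrow> P (gc + g)" "\<And>g. P g \<Longrightarrow> P (gd + g)"
  shows "P g"
proof -
  have inv_eq: "inv\<^bsub>tree_aut_group\<^esub> f = f" if "f \<in> {grig_a, grig_b, grig_c, grig_d}" for f
  proof (rule group.inv_equality[OF group_tree_aut_group])
    show "f \<in> carrier tree_aut_group" "f \<in> carrier tree_aut_group"
      using that grig_generators_in_tree_aut_group by auto
    show "f \<otimes>\<^bsub>tree_aut_group\<^esub> f = \<one>\<^bsub>tree_aut_group\<^esub>"
      using that by (auto simp: tree_aut_group_def fun_eq_iff grig_generator_involution)
  qed
  have gens: "\<forall>g. P g \<longrightarrow> P (Abs_grig f + g)" if "f \<in> {grig_a, grig_b, grig_c, grig_d}" for f
    using that assms unfolding ga_def gb_def gc_def gd_def by blast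
  \<comment> \<open>Stated for left multiplication by an arbitrary element, so that the product case
    of \<open>generate\<close> is a composition of two implications.\<close>
  have "\<forall>g. P g \<longrightarrow> P (Abs_grig f + g)" if "f \<in> carrier grigorchuk_group" for f
    using that[unfolded carrier_grigorchuk_group]
  proof (induction rule: generate.induct)
    case one
    have "Abs_grig \<one>\<^bsub>tree_aut_group\<^esub> = 0" by (simp add: tree_aut_group_def zero_grig_def)
    then show ?case by simp
  next
    case (incl h) then show ?case using gens by blast
  next
    case (inv h) then show ?case using gens inv_eq by metis
  next
    case (eng h1 h2)
    then have "Abs_grig (h1 \<otimes>\<^bsub>tree_aut_group\<^esub> h2) = Abs_grig h1 + Abs_grig h2"
      unfolding carrier_grigorchuk_group[symmetric]
      by (simp add: plus_grig_def Abs_grig_inverse tree_aut_group_def)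
    then show ?case using eng by (simp add: add.assoc)
  qed
  from this[OF Rep_grig, of g] assms(1) have "P (g + 0)"
    by (metis Rep_grig_inverse)
  then show ?thesis by simp
qed

section \<open>Sections and the action on the first level\<close>

definition swp :: "grig \<Rightarrow> bool" where
  "swp g \<longleftrightarrow> Rep_grig g [False] = [True]"

text \<open>The usual section, or state, of \<open>g\<close> at the letter \<open>x\<close>. That
  the argument of \<open>Abs_grig\<close> belongs to the group follows from
  \<open>Rep_grig_decompose\<close>.\<close>

definition sec :: "grig \<Rightarrow> bool \<Rightarrow> grig" where
  "sec g x = Abs_grig (\<lambda>w. tl (Rep_grig g (x # w)))"

text \<open>Self-similarity: sections of elements of \<open>G\<close> are again in \<open>G\<close>.
  On letters, \<open>x \<noteq> p\<close> is exclusive or, so one formula covers elements that fix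
  and elements that swap the first level.\<close>

lemma Rep_grig_decompose:
  "Rep_grig g [] = [] \<and> (\<exists>p s. \<forall>x w. Rep_grig g (x # w) = (x \<noteq> p) # Rep_grig (s x) w)"
proof (induction g rule: grig_gen_induct)
  case zero
  show ?case by (auto intro!: exI[of _ False] exI[of _ "\<lambda>_. 0"])
next
  case (a g)
  then obtain p s where "\<And>x w. Rep_grig g (x # w) = (x \<noteq> p) # Rep_grig (s x) w" by blast
  moreover have "grig_a (x # w) = (\<not> x) # w" for x w by (cases x) auto
  ultimately show ?case using a by (auto intro!: exI[of _ "\<not> p"] exI[of _ s])
next
  case (b g)
  then obtain p s where ps: "\<And>x w. Rep_grig g (x # w) = (x \<noteq> p) # Rep_grig (s x) w" by blast
  have gen: "grig_b (x # w) = x # Rep_grig (if x then gc else ga) w" for x w by (cases x) auto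
  show ?case using b
    by (auto simp: ps gen intro!: exI[of _ p] exI[of _ "\<lambda>x. (if x \<noteq> p then gc else ga) + s x"])
next
  case (c g)
  then obtain p s where ps: "\<And>x w. Rep_grig g (x # w) = (x \<noteq> p) # Rep_grig (s x) w" by blast
  have gen: "grig_c (x # w) = x # Rep_grig (if x then gd else ga) w" for x w by (cases x) auto
  show ?case using c
    by (auto simp: ps gen intro!: exI[of _ p] exI[of _ "\<lambda>x. (if x \<noteq> p then gd else ga) + s x"])
next
  case (d g)
  then obtain p s where ps: "\<And>x w. Rep_grig g (x # w) = (x \<noteq> p) # Rep_grig (s x) w" by blast
  have gen: "grig_d (x # w) = x # Rep_grig (if x then gb else 0) w" for x w by (cases x) auto
  show ?case using d
    by (auto simp: ps gen intro!: exI[of _ p] exI[of _ "\<lambda>x. (if x \<noteq> p then gb else 0) + s x"])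
qed

lemma Rep_grig_Nil [simp]: "Rep_grig g [] = []"
  and Rep_grig_Cons: "Rep_grig g (x # w) = (x \<noteq> swp g) # Rep_grig (sec g x) w"
proof -
  show 1: "Rep_grig g [] = []" using Rep_grig_decompose by blast
  obtain p s where ps: "\<And>x w. Rep_grig g (x # w) = (x \<noteq> p) # Rep_grig (s x) w"
    using Rep_grig_decompose by blast
  have "swp g = p" using ps[of False "[]"] Rep_grig_decompose[of "s False"] by (simp add: swp_def)
  moreover have "sec g x = s x" by (simp add: sec_def ps Rep_grig_inverse)
  ultimately show "Rep_grig g (x # w) = (x \<noteq> swp g) # Rep_grig (sec g x) w" by (simp add: ps)
qed

lemma grig_sec_unique:
  assumes "\<And>x w. Rep_grig g (x # w) = (x \<noteq> p) # Rep_grig (s x) w"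
  shows "swp g = p" "sec g x = s x"
  using assms[of False "[]"] by (simp_all add: swp_def sec_def assms Rep_grig_inverse)

lemma grig_ext:
  assumes "swp g = swp h" "\<And>x. sec g x = sec h x"
  shows "g = h"
proof (rule grig_eqI)
  fix w show "Rep_grig g w = Rep_grig h w"
    by (cases w) (simp_all add: Rep_grig_Cons assms)
qed

lemma swp_zero [simp]: "\<not> swp 0" and sec_zero [simp]: "sec 0 x = 0"
  using grig_sec_unique[of 0 False "\<lambda>_. 0"] by simp_all

lemma swp_plus [simp]: "swp (g + h) \<longleftrightarrow> swp g \<noteq> swp h"
  and sec_plus [simp]: "sec (g + h) x = sec g (x \<noteq> swp h) + sec h x"
proof -
  have "Rep_grig (g + h) (x # w) = (x \<noteq> (swp g \<noteq> swp h)) # Rep_grig (sec g (x \<noteq> swp h) + sec h x) w" for x w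
    unfolding Rep_grig_plus Rep_grig_Cons[of g] Rep_grig_Cons[of h] by auto
  note u = grig_sec_unique[OF this]
  show "swp (g + h) \<longleftrightarrow> swp g \<noteq> swp h"
    by (rule u(1))
  show "sec (g + h) x = sec g (x \<noteq> swp h) + sec h x"
    by (rule u(2))
qed

lemma swp_uminus [simp]: "swp (- g) \<longleftrightarrow> swp g"
  using swp_plus[of "- g" g] by simp

lemma sec_uminus [simp]: "sec (- g) x = - sec g (x \<noteq> swp g)"
  using sec_plus[of "- g" g "x \<noteq> swp g"]
  by (cases "swp g"; cases x) (simp_all add: minus_unique eq_neg_iff_add_eq_0)

lemma swp_minus [simp]: "swp (g - h) \<longleftrightarrow> swp g \<noteq> swp h"
  using swp_plus[of g "- h"] by simp

lemma sec_generators [simp]: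
  "swp ga" "sec ga x = 0"
  "\<not> swp gb" "sec gb False = ga" "sec gb True = gc"
  "\<not> swp gc" "sec gc False = ga" "sec gc True = gd"
  "\<not> swp gd" "sec gd False = 0" "sec gd True = gb"
proof -
  have a: "Rep_grig ga (x # w) = (x \<noteq> True) # Rep_grig 0 w" for x w by (cases x) auto
  have b: "Rep_grig gb (x # w) = (x \<noteq> False) # Rep_grig (if x then gc else ga) w" for x w by (cases x) auto
  have c: "Rep_grig gc (x # w) = (x \<noteq> False) # Rep_grig (if x then gd else ga) w" for x w by (cases x) auto
  have d: "Rep_grig gd (x # w) = (x \<noteq> False) # Rep_grig (if x then gb else 0) w" for x w by (cases x) auto
  show "swp ga" "sec ga x = 0"
    "\<not> swp gb" "sec gb False = ga" "sec gb True = gc"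
    "\<not> swp gc" "sec gc False = ga" "sec gc True = gd"
    "\<not> swp gd" "sec gd False = 0" "sec gd True = gb"
    using grig_sec_unique[OF a] grig_sec_unique[OF b] grig_sec_unique[OF c] grig_sec_unique[OF d] by auto
qed

lemmas group_add_norm = diff_conv_add_uminus add.assoc minus_add

lemmas group_add_simps = group_add_norm minus_minus minus_zero add_0_left add_0_right
  left_minus right_minus minus_add_cancel add_minus_cancel

section \<open>Level stabilisers and contraction\<close>

text \<open>Congruence modulo the stabiliser of level \<open>n\<close>, that is, the same action on
  words of length \<open>n\<close>. The recursion over sections matches the way conjugacy is
  reduced.\<close>

primrec cong :: "nat \<Rightarrow> grig \<Rightarrow> grig \<Rightarrow> bool" where
  "cong 0 g h \<longleftrightarrow> True"
| "cong (Suc n) g h \<longleftrightarrow> swp g = swp h \<and> (\<forall>x. cong n (sec g x) (sec h x))"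

lemma cong_refl [simp]: "cong n g g"
  by (induction n arbitrary: g) auto

lemma cong_sym: "cong n g h \<Longrightarrow> cong n h g"
  by (induction n arbitrary: g h) auto

lemma cong_plus: "cong n g g' \<Longrightarrow> cong n h h' \<Longrightarrow> cong n (g + h) (g' + h')"
  by (induction n arbitrary: g h g' h') auto

lemma cong_uminus: "cong n g h \<Longrightarrow> cong n (- g) (- h)"
  by (induction n arbitrary: g h) auto

lemma cong_minus: "cong n g g' \<Longrightarrow> cong n h h' \<Longrightarrow> cong n (g - h) (g' - h')"
  using cong_plus[of n g g' "- h" "- h'"] cong_uminus[of n h h'] by simp

lemma cong_mono: "cong n g h \<Longrightarrow> m \<le> n \<Longrightarrow> cong m g h"
proof (induction n arbitrary: m g h)
  case (Suc n) then show ?case by (cases m) auto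
qed simp

lemma cong_all_eq:
  assumes "\<And>n. cong n g h" shows "g = h"
proof (rule grig_eqI)
  have "cong (length w) g h \<Longrightarrow> Rep_grig g w = Rep_grig h w" for w g h
    by (induction w arbitrary: g h) (auto simp: Rep_grig_Cons)
  then show "Rep_grig g w = Rep_grig h w" for w using assms by blast
qed

lemma cong_diff_zero: "cong n (g - h) 0 \<longleftrightarrow> cong n g h"
  using cong_plus[of n "g - h" 0 h h] cong_minus[of n g h h h] by auto

text \<open>The parity of the number of vertices of level \<open>n\<close> at which \<open>g\<close>
  swaps the two children. It is a homomorphism to the group of order 2, hence constant on conjugacy
  classes.\<close>

primrec level_parity :: "nat \<Rightarrow> grig \<Rightarrow> bool" where
  "level_parity 0 g = swp g"
| "level_parity (Suc n) g \<longleftrightarrow> level_parity n (sec g False) \<noteq> level_parity n (sec g True)"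

lemma level_parity_zero [simp]: "\<not> level_parity n 0"
  by (induction n) auto

lemma level_parity_plus [simp]: "level_parity n (g + h) \<longleftrightarrow> level_parity n g \<noteq> level_parity n h"
proof (induction n arbitrary: g h)
  case (Suc n)
  show ?case by (cases "swp h") (simp_all only: level_parity.simps sec_plus Suc.IH, auto)
qed simp

lemma level_parity_uminus [simp]: "level_parity n (- g) \<longleftrightarrow> level_parity n g"
  using level_parity_plus[of n "- g" g] by simp

lemma level_parity_minus [simp]: "level_parity n (g - h) \<longleftrightarrow> level_parity n g \<noteq> level_parity n h"
  using level_parity_plus[of n g "- h"] by simp

lemma cong_level_parity: "cong n g h \<Longrightarrow> m < n \<Longrightarrow> level_parity m g = level_parity m h"
proof (induction n arbitrary: m g h)
  case (Suc n) then show ?case by (cases m) auto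
qed simp

text \<open>
  The weights 3, 4, 3, 2 of \<open>a\<close>, \<open>b\<close>, \<open>c\<close>, \<open>d\<close> satisfy the triangle inequality in
  \<open>{1, b, c, d}\<close>, and the two sections of \<open>a u\<close> have together a smaller weight than \<open>a u\<close>
  for each \<open>u \<in> {1, b, c, d}\<close>.
\<close>

inductive wt :: "nat \<Rightarrow> grig \<Rightarrow> bool" where
  zero: "wt 0 0"
| a: "wt r g \<Longrightarrow> wt (r + 3) (ga + g)"
| b: "wt r g \<Longrightarrow> wt (r + 4) (gb + g)"
| c: "wt r g \<Longrightarrow> wt (r + 3) (gc + g)"
| d: "wt r g \<Longrightarrow> wt (r + 2) (gd + g)"

lemma wt_plus: "wt r g \<Longrightarrow> wt s h \<Longrightarrow> wt (r + s) (g + h)"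
proof (induction rule: wt.induct)
  case zero then show ?case by simp
next
  case (a r g) then show ?case using wt.a[of "r + s" "g + h"] by (simp add: add_ac)
next
  case (b r g) then show ?case using wt.b[of "r + s" "g + h"] by (simp add: add_ac)
next
  case (c r g) then show ?case using wt.c[of "r + s" "g + h"] by (simp add: add_ac)
next
  case (d r g) then show ?case using wt.d[of "r + s" "g + h"] by (simp add: add_ac)
qed

lemma ex_wt: "\<exists>r. wt r g"
  by (induction g rule: grig_gen_induct) (blast intro: wt.intros)+

lemma wt_generators: "wt 3 ga" "wt 4 gb" "wt 3 gc" "wt 2 gd"
  using wt.intros(2-5)[OF wt.zero] by (simp_all add: numeral_2_eq_2)

definition klein :: "nat \<Rightarrow> grig \<Rightarrow> bool" where
  "klein r u \<longleftrightarrow> (r, u) \<in> {(0, 0), (4, gb), (3, gc), (2, gd)}"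

lemma gen_products [simp]:
  "gb + gc = gd" "gc + gb = gd" "gb + gd = gc" "gd + gb = gc" "gc + gd = gb" "gd + gc = gb"
proof -
  have "Rep_grig (gb + gc) w = Rep_grig gd w \<and> Rep_grig (gc + gd) w = Rep_grig gb w
    \<and> Rep_grig (gd + gb) w = Rep_grig gc w" for w
  proof (induction w)
    case (Cons x w) then show ?case by (cases x) (auto simp: grig_generator_involution)
  qed simp
  then show bc: "gb + gc = gd" and cd: "gc + gd = gb" and db: "gd + gb = gc"
    by (auto intro: grig_eqI)
  show "gc + gb = gd" "gb + gd = gc" "gd + gc = gb"
    using arg_cong[OF bc, of uminus] arg_cong[OF cd, of uminus] arg_cong[OF db, of uminus]
    by (simp_all add: minus_add del: add_uminus_conv_diff)
qed

lemma gen_products_left [simp]: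
  "gb + (gc + x) = gd + x" "gc + (gb + x) = gd + x" "gb + (gd + x) = gc + x"
  "gd + (gb + x) = gc + x" "gc + (gd + x) = gb + x" "gd + (gc + x) = gb + x"
  by (simp_all flip: add.assoc)

lemma klein_plus:
  assumes "klein r u" "klein s v"
  shows "\<exists>q\<le>r + s. klein q (u + v)"
proof -
  have "\<exists>q\<le>n. klein q 0" "4 \<le> n \<Longrightarrow> \<exists>q\<le>n. klein q gb" "3 \<le> n \<Longrightarrow> \<exists>q\<le>n. klein q gc"
    "2 \<le> n \<Longrightarrow> \<exists>q\<le>n. klein q gd"
    "klein 0 0" for n
    by (auto simp: klein_def)
  then show ?thesis
    using assms by (auto simp: klein_def[of r u] klein_def[of s v])
qed

text \<open>Words made of blocks \<open>ga + u\<close> with \<open>u\<close> in the Klein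
  four-group. A trivial \<open>u\<close> is allowed, so words need not be reduced and products in
  the four-group never leave the format.\<close>

inductive syl :: "nat \<Rightarrow> grig \<Rightarrow> bool" where
  zero: "syl 0 0"
| step: "klein r u \<Longrightarrow> syl q g \<Longrightarrow> syl (3 + r + q) (ga + u + g)"

lemma wt_syl:
  assumes "wt r g"
  shows "\<exists>s q u h. klein s u \<and> syl q h \<and> s + q \<le> r \<and> g = u + h"
  using assms
proof (induction rule: wt.induct)
  case zero
  have "klein 0 0" by (simp add: klein_def)
  then show ?case using syl.zero by force
next
  case (a r g)
  then obtain s q u h where *: "klein s u" "syl q h" "s + q \<le> r" "g = u + h" by blast
  have "klein 0 0" by (simp add: klein_def)
  moreover have "ga + g = 0 + (ga + u + h)" using * by (simp add: add.assoc)
  moreover have "0 + (3 + s + q) \<le> r + 3" using * by simp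
  ultimately show ?case using syl.step[OF *(1,2)] by blast
next
  case (b r g)
  then obtain s q u h where *: "klein s u" "syl q h" "s + q \<le> r" "g = u + h" by blast
  moreover obtain s' where "s' \<le> 4 + s" "klein s' (gb + u)"
    using klein_plus[of 4 gb s u] * by (auto simp: klein_def)
  moreover have "gb + g = (gb + u) + h" using * by (simp add: add.assoc)
  moreover have "s' + q \<le> r + 4" using calculation by linarith
  ultimately show ?case by blast
next
  case (c r g)
  then obtain s q u h where *: "klein s u" "syl q h" "s + q \<le> r" "g = u + h" by blast
  moreover obtain s' where "s' \<le> 3 + s" "klein s' (gc + u)"
    using klein_plus[of 3 gc s u] * by (auto simp: klein_def)
  moreover have "gc + g = (gc + u) + h" using * by (simp add: add.assoc)
  moreover have "s' + q \<le> r + 3" using calculation by linarith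
  ultimately show ?case by blast
next
  case (d r g)
  then obtain s q u h where *: "klein s u" "syl q h" "s + q \<le> r" "g = u + h" by blast
  moreover obtain s' where "s' \<le> 2 + s" "klein s' (gd + u)"
    using klein_plus[of 2 gd s u] * by (auto simp: klein_def)
  moreover have "gd + g = (gd + u) + h" using * by (simp add: add.assoc)
  moreover have "s' + q \<le> r + 2" using calculation by linarith
  ultimately show ?case by blast
qed

text \<open>Used to move a leading Klein letter to the end of a word, where the last block absorbs
  it. Only the empty word has no such block, which accounts for the first alternative.\<close>

lemma syl_append:
  assumes "syl q g" "klein s v"
  shows "g = 0 \<and> q = 0 \<or> (\<exists>q'\<le>q + s. q' > 0 \<and> syl q' (g + v))"
  using assms
proof (induction rule: syl.induct)
  case zero then show ?case by simp
next
  case (step r u q g)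
  from step.IH[OF step.prems] show ?case
  proof
    assume g: "g = 0 \<and> q = 0"
    obtain p where p: "p \<le> r + s" "klein p (u + v)" using klein_plus[OF step.hyps(1) step.prems] by blast
    then have "syl (3 + p + 0) (ga + (u + v) + 0)" using syl.step syl.zero by blast
    moreover have "3 + p + 0 \<le> 3 + r + q + s" using p by simp
    moreover have "0 < 3 + p + 0" by simp
    moreover have "ga + u + g + v = ga + (u + v) + 0" using g by (simp add: add.assoc)
    ultimately show ?thesis by metis
  next
    assume "\<exists>q'\<le>q + s. q' > 0 \<and> syl q' (g + v)"
    then obtain q' where q': "q' \<le> q + s" "syl q' (g + v)" by blast
    then have "syl (3 + r + q') (ga + u + (g + v))" using syl.step step.hyps(1) by blast
    moreover have "3 + r + q' \<le> 3 + r + q + s" "0 < 3 + r + q'" using q' by simp_all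
    moreover have "ga + u + g + v = ga + u + (g + v)" by (simp add: add.assoc)
    ultimately show ?thesis by metis
  qed
qed

lemma klein_sections:
  assumes "klein r u"
  shows "\<not> swp u" "\<exists>s t. wt s (sec u False) \<and> wt t (sec u True) \<and> s + t < 3 + r"
  using assms wt_generators wt.zero by (force simp: klein_def)+

text \<open>Each block loses weight by \<open>klein_sections\<close>. If the rest of the word swaps
  the first level, the two sections of the block change places, which leaves the total
  unchanged.\<close>

lemma syl_sections:
  assumes "syl q g"
  shows "\<exists>s t. wt s (sec g False) \<and> wt t (sec g True) \<and> s + t \<le> q \<and> (0 < q \<longrightarrow> s + t < q)"
  using assms
proof (induction rule: syl.induct)
  case zero then show ?case using wt.zero by force
next
  case (step r u q g)
  then obtain s t where st: "wt s (sec g False)" "wt t (sec g True)" "s + t \<le> q" by blast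
  obtain s' t' where st': "wt s' (sec u False)" "wt t' (sec u True)" "s' + t' < 3 + r"
    using klein_sections[OF step.hyps(1)] by blast
  have nswp: "\<not> swp u" by (rule klein_sections[OF step.hyps(1)])
  have p: "wt (s' + s) (sec u False + sec g False)" "wt (t' + s) (sec u True + sec g False)"
    "wt (t' + t) (sec u True + sec g True)" "wt (s' + t) (sec u False + sec g True)"
    using wt_plus st st' by blast+
  have w: "(s' + s) + (t' + t) < 3 + r + q" "(t' + s) + (s' + t) < 3 + r + q" using st st' by linarith+
  show ?case
  proof (cases "swp g")
    case True
    then have "sec (ga + u + g) False = sec u True + sec g False" "sec (ga + u + g) True = sec u False + sec g True"
      using nswp by simp_all
    then show ?thesis using p w by (metis less_imp_le)
  next
    case False
    then have "sec (ga + u + g) False = sec u False + sec g False" "sec (ga + u + g) True = sec u True + sec g True"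
      using nswp by simp_all
    then show ?thesis using p w by (metis less_imp_le)
  qed
qed

text \<open>After a conjugation the word consists of blocks only, and then both sections together
  weigh strictly less than the word. This serves the sections separately in \<open>stab\<close> and
  their product in \<open>move\<close>. Words that are a single Klein letter are the base.\<close>

theorem grig_contraction_induct:
  assumes conj: "\<And>g x. P x \<Longrightarrow> P (g + x - g)"
    and base: "P 0" "P gb" "P gc" "P gd"
    and stab: "\<And>x. \<not> swp x \<Longrightarrow> P (sec x False) \<Longrightarrow> P (sec x True) \<Longrightarrow> P x"
    and move: "\<And>x. swp x \<Longrightarrow> P (sec x False + sec x True) \<Longrightarrow> P x"
  shows "P x"
proof -
  have "wt r x \<Longrightarrow> P x" for r x
  proof (induction r arbitrary: x rule: less_induct)
    case (less r)
    obtain s q u h where *: "klein s u" "syl q h" "s + q \<le> r" "x = u + h"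
      using wt_syl[OF less.prems] by blast
    from syl_append[OF *(2,1)] show ?case
    proof
      assume "h = 0 \<and> q = 0"
      then have "x = u" using * by simp
      then show ?thesis using base *(1) by (auto simp: klein_def)
    next
      assume "\<exists>q'\<le>q + s. q' > 0 \<and> syl q' (h + u)"
      then obtain q' where q': "q' \<le> q + s" "q' > 0" "syl q' (h + u)" by blast
      obtain s' t' where st: "wt s' (sec (h + u) False)" "wt t' (sec (h + u) True)" "s' + t' < q'"
        using syl_sections[OF q'(3)] q'(2) by blast
      have "P (h + u)"
      proof (cases "swp (h + u)")
        case True
        have "P (sec (h + u) False + sec (h + u) True)"
          using less.IH[of "s' + t'"] wt_plus st q' * by auto
        then show ?thesis using move True by blast
      next
        case False
        have "P (sec (h + u) False)" "P (sec (h + u) True)"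
          using less.IH[of "s'"] less.IH[of "t'"] st q' * by auto
        then show ?thesis using stab False by blast
      qed
      \<comment> \<open>This conjugation moves the last letter \<open>u\<close> back to the front
        and restores \<open>u + h\<close>.\<close>
      then have "P (u + (h + u) - u)" by (rule conj)
      then show ?thesis using * by (simp only: group_add_simps)
    qed
  qed
  then show ?thesis using ex_wt by blast
qed

section \<open>Powers and torsion\<close>

primrec npow :: "nat \<Rightarrow> 'g :: monoid_add \<Rightarrow> 'g" where
  "npow 0 x = 0"
| "npow (Suc n) x = x + npow n x"

lemma npow_add: "npow (m + n) x = npow m x + npow n x"
  by (induction m) (simp_all add: add.assoc)

lemma npow_mult: "npow (m * n) x = npow m (npow n x)"
  by (induction m) (simp_all add: npow_add)

lemma npow_zero [simp]: "npow n 0 = 0"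
  by (induction n) simp_all

lemma npow_conj: "npow n (g + x - g) = g + npow n x - (g :: 'g :: group_add)"
  by (induction n) (simp_all add: group_add_norm del: add_uminus_conv_diff)

lemma npow_sec: "\<not> swp x \<Longrightarrow> \<not> swp (npow n x) \<and> sec (npow n x) y = npow n (sec x y)"
  by (induction n) simp_all

text \<open>If \<open>x\<close> fixes the first level, its powers act through powers of its
  sections. If it swaps, its square fixes the first level and has the sections \<open>v + u\<close>
  and \<open>u + v\<close>, which are conjugate and thus killed by the same power.\<close>

theorem grig_torsion: "\<exists>k. npow (2 ^ k) (x :: grig) = 0"
proof (induction x rule: grig_contraction_induct)
  case (1 g x)
  then show ?case by (metis npow_conj add_0_right diff_self)
next
  case (6 x)
  then obtain k l where kl: "npow (2 ^ k) (sec x False) = 0" "npow (2 ^ l) (sec x True) = 0" by blast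
  have "npow (2 ^ (k + l)) (sec x True) = 0"
    by (simp only: power_add npow_mult kl npow_zero)
  moreover have "npow (2 ^ (k + l)) (sec x False) = 0"
    by (simp only: add.commute[of k l] power_add npow_mult kl npow_zero)
  ultimately have sec0: "npow (2 ^ (k + l)) (sec x y) = 0" for y
    by (cases y) simp_all
  have "npow (2 ^ (k + l)) x = 0"
    by (rule grig_ext) (simp_all add: npow_sec[OF 6(1)] sec0)
  then show ?case by blast
next
  case (7 x)
  define u v where "u = sec x False" and "v = sec x True"
  obtain k where k: "npow (2 ^ k) (u + v) = 0" using 7 by (auto simp: u_def v_def)
  have "v + u = v + (u + v) - v" by (simp only: group_add_simps)
  then have "npow (2 ^ k) (v + u) = v + npow (2 ^ k) (u + v) - v" by (simp only: npow_conj)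
  then have k': "npow (2 ^ k) (v + u) = 0" using k by simp
  have s: "\<not> swp (npow 2 x)" "sec (npow 2 x) False = v + u" "sec (npow 2 x) True = u + v"
    using 7(1) by (simp_all add: numeral_2_eq_2 u_def v_def)
  have sec0: "sec (npow (2 ^ k) (npow 2 x)) y = 0" for y
    using k k' npow_sec[OF s(1)] s by (cases y) simp_all
  have "npow (2 ^ k) (npow 2 x) = 0"
  proof (rule grig_ext)
    show "swp (npow (2 ^ k) (npow 2 x)) = swp 0"
      by (simp add: npow_sec[OF s(1)])
    show "sec (npow (2 ^ k) (npow 2 x)) y = sec 0 y" for y
      by (simp only: sec0 sec_zero)
  qed
  then have "npow (2 ^ Suc k) x = 0" by (metis npow_mult power_Suc2)
  then show ?case by blast
qed (auto intro!: exI[of _ 1] simp: numeral_2_eq_2)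

lemma sec_minus [simp]: "sec (g - h) x = sec g (x \<noteq> swp h) - sec h (x \<noteq> swp h)"
  unfolding diff_conv_add_uminus sec_plus sec_uminus swp_uminus by (rule refl)

lemma gen_nonzero [simp]: "ga \<noteq> 0" "gb \<noteq> 0" "gc \<noteq> 0" "gd \<noteq> 0"
  by (metis sec_generators sec_zero swp_zero)+

section \<open>Normal subgroups of finite index and coset representatives\<close>

definition nsub :: "'g :: group_add set \<Rightarrow> bool" where
  "nsub L \<longleftrightarrow> 0 \<in> L \<and> (\<forall>x\<in>L. \<forall>y\<in>L. x + y \<in> L) \<and> (\<forall>x\<in>L. - x \<in> L) \<and> (\<forall>g. \<forall>x\<in>L. g + x - g \<in> L)"

lemma nsub_zero: "nsub L \<Longrightarrow> 0 \<in> L"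
  and nsub_plus: "nsub L \<Longrightarrow> x \<in> L \<Longrightarrow> y \<in> L \<Longrightarrow> x + y \<in> L"
  and nsub_uminus: "nsub L \<Longrightarrow> x \<in> L \<Longrightarrow> - x \<in> L"
  and nsub_conj: "nsub L \<Longrightarrow> x \<in> L \<Longrightarrow> g + x - g \<in> L"
  by (auto simp: nsub_def)

lemma nsub_minus: "nsub L \<Longrightarrow> x \<in> L \<Longrightarrow> y \<in> L \<Longrightarrow> x - y \<in> L"
  using nsub_plus[of L x "- y"] nsub_uminus by auto

lemma nsub_conj_iff: "nsub L \<Longrightarrow> g + x - g \<in> L \<longleftrightarrow> x \<in> L"
  using nsub_conj[of L "g + x - g" "- g"] nsub_conj[of L x g]
  by (auto simp: group_add_norm simp del: add_uminus_conv_diff)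

lemma nsub_commute: "nsub L \<Longrightarrow> x + y \<in> L \<longleftrightarrow> y + x \<in> L"
  using nsub_conj_iff[of L "- x" "x + y"] by (simp only: group_add_simps)

definition fin_index :: "'g :: group_add set \<Rightarrow> bool" where
  "fin_index L \<longleftrightarrow> (\<exists>F. finite F \<and> (\<forall>g. \<exists>r\<in>F. - r + g \<in> L))"

lemma fin_indexI:
  assumes "finite (range f)" "\<And>g h. f g = f h \<Longrightarrow> - h + g \<in> L"
  shows "fin_index L"
  unfolding fin_index_def
proof (intro exI conjI allI)
  show "finite (range (\<lambda>g. inv_into UNIV f (f g)))"
    using assms(1) by (metis finite_imageI image_image)
  show "\<exists>r\<in>range (\<lambda>g. inv_into UNIV f (f g)). - r + g \<in> L" for g
    using assms(2)[of g "inv_into UNIV f (f g)"] by (auto simp: f_inv_into_f)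
qed

text \<open>The predicate under \<open>SOME\<close> depends only on the coset of \<open>g\<close>,
  so congruent elements receive the same representative and \<open>coset_rep L\<close> can stand for
  the quotient map.\<close>

definition coset_rep :: "'g :: group_add set \<Rightarrow> 'g \<Rightarrow> 'g" where
  "coset_rep L g = (SOME r. - r + g \<in> L)"

lemma coset_rep_mem:
  assumes "nsub L" shows "- coset_rep L g + g \<in> L"
  unfolding coset_rep_def by (rule someI[of _ g]) (simp add: nsub_zero[OF assms] left_minus)

lemma coset_rep_cong:
  assumes L: "nsub L" and gh: "- g + h \<in> L" shows "coset_rep L g = coset_rep L h"
proof -
  have "- r + g \<in> L \<longleftrightarrow> - r + h \<in> L" for r
  proof
    assume "- r + g \<in> L"
    then have "(- r + g) + (- g + h) \<in> L" using gh nsub_plus[OF L] by blast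
    then show "- r + h \<in> L" by (simp only: group_add_simps)
  next
    assume "- r + h \<in> L"
    then have "(- r + h) + - (- g + h) \<in> L" using gh nsub_plus[OF L] nsub_uminus[OF L] by blast
    then show "- r + g \<in> L" by (simp only: group_add_simps)
  qed
  then show ?thesis by (simp add: coset_rep_def)
qed

lemma coset_rep_eqD:
  assumes L: "nsub L" and "coset_rep L g = coset_rep L h" shows "- h + g \<in> L"
proof -
  have "- (- coset_rep L g + h) + (- coset_rep L g + g) \<in> L"
    using coset_rep_mem[OF L, of g] coset_rep_mem[OF L, of h] assms nsub_plus nsub_uminus by metis
  then show ?thesis by (simp only: group_add_simps)
qed

lemma finite_range_coset_rep:
  assumes L: "nsub L" and "fin_index L" shows "finite (range (coset_rep L))"
proof -
  obtain F where F: "finite F" "\<And>g. \<exists>r\<in>F. - r + g \<in> L" using assms by (auto simp: fin_index_def)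
  have "coset_rep L g \<in> coset_rep L ` F" for g
    using F(2)[of g] coset_rep_cong[OF L] by (metis imageI)
  then have "range (coset_rep L) \<subseteq> coset_rep L ` F" by blast
  then show ?thesis using F(1) finite_surj by blast
qed

lemma nsub_Int: "nsub L \<Longrightarrow> nsub L' \<Longrightarrow> nsub (L \<inter> L')"
  by (auto simp: nsub_def)

lemma fin_index_Int:
  assumes "nsub L" "nsub L'" "fin_index L" "fin_index L'"
  shows "fin_index (L \<inter> L')"
proof (rule fin_indexI)
  show "finite (range (\<lambda>g. (coset_rep L g, coset_rep L' g)))"
    by (rule finite_subset[of _ "range (coset_rep L) \<times> range (coset_rep L')"])
      (use finite_range_coset_rep assms in auto)
  show "- h + g \<in> L \<inter> L'" if "(coset_rep L g, coset_rep L' g) = (coset_rep L h, coset_rep L' h)" for g h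
    using that coset_rep_eqD assms(1,2) by blast
qed

text \<open>For a subgroup this says that it contains a level stabiliser.\<close>

definition cong_closed :: "grig set \<Rightarrow> bool" where
  "cong_closed L \<longleftrightarrow> (\<exists>n. \<forall>g h. cong n g h \<longrightarrow> g \<in> L \<longrightarrow> h \<in> L)"

section \<open>The branching subgroup\<close>

abbreviation (input) "gt \<equiv> ga + gb + ga + gb"

text \<open>
  This is \<open>K\<close>, the normal closure of \<open>(ab)\<^sup>2\<close>. The generators need no inverses, because
  conjugation by \<open>a\<close> inverts \<open>(ab)\<^sup>2\<close>.
\<close>

inductive_set brK :: "grig set" where
  zero: "0 \<in> brK"
| step: "k \<in> brK \<Longrightarrow> g + gt - g + k \<in> brK"

lemma brK_plus: "k \<in> brK \<Longrightarrow> l \<in> brK \<Longrightarrow> k + l \<in> brK"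
proof (induction rule: brK.induct)
  case (step k g) then show ?case using brK.step[of "k + l" g] by (simp add: add.assoc)
qed simp

lemma brK_gen: "g + gt - g \<in> brK"
  using brK.step[OF brK.zero, of g] by simp

lemma brK_uminus: "k \<in> brK \<Longrightarrow> - k \<in> brK"
proof (induction rule: brK.induct)
  case (step k g)
  have "- k + ((g + ga) + gt - (g + ga)) \<in> brK" using step brK_plus brK_gen by blast
  then show ?case by (simp add: group_add_norm del: add_uminus_conv_diff)
qed (simp add: brK.zero)

lemma nsub_brK: "nsub brK"
proof -
  have "g + k - g \<in> brK" if "k \<in> brK" for g k
    using that
  proof (induction rule: brK.induct)
    case (step k h)
    have "((g + h) + gt - (g + h)) + (g + k - g) \<in> brK" using step brK.step by blast
    then show ?case by (simp only: group_add_simps)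
  qed (simp add: brK.zero)
  then show ?thesis using brK.zero brK_plus brK_uminus by (auto simp: nsub_def)
qed

lemma brK_least:
  assumes "nsub N" "gt \<in> N" shows "brK \<subseteq> N"
proof
  fix k assume "k \<in> brK" then show "k \<in> N"
    by (induction rule: brK.induct) (use assms nsub_zero nsub_plus nsub_conj in blast)+
qed

lemma gt_mem: "gt \<in> brK"
  using brK_gen[of 0] by simp

lemma adad_nonzero: "ga + (gd + ga) \<noteq> 0"
proof
  assume "ga + (gd + ga) = 0"
  then have "ga + ((ga + (gd + ga)) + ga) = ga + (0 + ga)" by (simp only:)
  then show False by (simp add: add.assoc)
qed

text \<open>The elements \<open>gd\<close> and \<open>ga + gd + ga\<close> act on different subtrees
  of the root, so they commute.\<close>

lemma ad_order_four: "gd + (ga + (gd + ga)) = ga + (gd + (ga + gd))"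
proof (rule grig_ext)
  show "sec (gd + (ga + (gd + ga))) x = sec (ga + (gd + (ga + gd))) x" for x
    by (cases x) simp_all
qed simp

lemma ad_order_four_left: "gd + (ga + (gd + (ga + x))) = ga + (gd + (ga + (gd + x)))"
  using arg_cong[OF ad_order_four, of "\<lambda>g. g + x"] by (simp add: add.assoc)

text \<open>Modulo \<open>K\<close> the generator \<open>gb\<close> is central, because
  \<open>gt\<close> is in \<open>K\<close>, and \<open>ga\<close> exchanges \<open>gd\<close> with
  \<open>ga + gd + ga\<close>. Hence left multiplication by generators permutes the cosets of these
  sixteen products; \<open>brK_iff\<close> tells them apart.\<close>

lemma brK_coset_cases:
  obtains k i j l m where "k \<in> brK" "g = k + (i + (j + (l + m)))"
    "i \<in> {0, gb}" "j \<in> {0, gd}" "l \<in> {0, ga + (gd + ga)}" "m \<in> {0, ga}"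
proof -
  define R where "R = {i + (j + (l + m)) | i j l m.
    i \<in> {0, gb} \<and> j \<in> {0, gd} \<and> l \<in> {0, ga + (gd + ga)} \<and> m \<in> {0, ga}}"
  have lift: "\<exists>k\<in>brK. \<exists>r\<in>R. s + g = k + r"
    if g: "\<exists>k\<in>brK. \<exists>r\<in>R. g = k + r" and s: "\<And>r. r \<in> R \<Longrightarrow> \<exists>k\<in>brK. \<exists>r'\<in>R. s + r = k + r'" for s g
  proof -
    obtain k r where kr: "k \<in> brK" "r \<in> R" "g = k + r" using g by blast
    obtain k' r' where kr': "k' \<in> brK" "r' \<in> R" "s + r = k' + r'" using s kr by blast
    have "s + g = (s + k - s) + (s + r)"
      using kr by (simp only: group_add_simps)
    then have "s + g = ((s + k - s) + k') + r'" using kr' by (simp add: add.assoc)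
    then show ?thesis using kr kr' nsub_brK nsub_plus nsub_conj by blast
  qed
  have R_b: "gb + r \<in> R" if "r \<in> R" for r
  proof -
    obtain i j l m where "r = i + (j + (l + m))" "i \<in> {0, gb}" "j \<in> {0, gd}" "l \<in> {0, ga + (gd + ga)}" "m \<in> {0, ga}"
      using \<open>r \<in> R\<close> by (auto simp only: R_def)
    moreover from this have "gb + r = (gb + i) + (j + (l + m))" "gb + i \<in> {0, gb}" by (auto simp: add.assoc)
    ultimately show ?thesis unfolding R_def by blast
  qed
  have R_d: "gd + r \<in> R" if "r \<in> R" for r
  proof -
    obtain i j l m where "r = i + (j + (l + m))" "i \<in> {0, gb}" "j \<in> {0, gd}" "l \<in> {0, ga + (gd + ga)}" "m \<in> {0, ga}"
      using \<open>r \<in> R\<close> by (auto simp only: R_def)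
    moreover from this have "gd + r = i + ((gd + j) + (l + m))" "gd + j \<in> {0, gd}" by (auto simp: add.assoc)
    ultimately show ?thesis unfolding R_def by blast
  qed
  have R_a: "\<exists>k\<in>brK. \<exists>r'\<in>R. ga + r = k + r'" if "r \<in> R" for r
  proof -
    obtain i j l m where r: "r = i + (j + (l + m))" "i \<in> {0, gb}" "j \<in> {0, gd}" "l \<in> {0, ga + (gd + ga)}" "m \<in> {0, ga}"
      using \<open>r \<in> R\<close> by (auto simp only: R_def)
    \<comment> \<open>Conjugation by \<open>ga\<close> turns \<open>l\<close> into a power of
      \<open>gd\<close> and \<open>j\<close> into a power of \<open>ga + gd + ga\<close>. The
      element \<open>k\<close>, which is \<open>gt\<close> or \<open>0\<close>, is the cost of
      moving \<open>ga\<close> past \<open>i\<close>.\<close>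
    define j' where "j' = ga + (l + ga)"
    define l' where "l' = ga + (j + ga)"
    define k where "k = ga + (i + (ga + i))"
    have "k \<in> brK" using r(2) gt_mem brK.zero by (auto simp: k_def add.assoc)
    moreover have jl: "j' \<in> {0, gd}" "l' \<in> {0, ga + (gd + ga)}" "ga + m \<in> {0, ga}"
      using r by (auto simp: j'_def l'_def add.assoc)
    moreover have "ga + r = k + (i + (j' + (l' + (ga + m))))"
    proof -
      have "ga + (j + (l + m)) = j' + (l' + (ga + m))"
        using r(3,4) ad_order_four_left[of m] by (auto simp: j'_def l'_def add.assoc)
      moreover have "k + i = ga + (i + ga)" using r(2) by (auto simp: k_def add.assoc)
      ultimately show ?thesis using r(1) by (metis add.assoc gen_double_left(1))
    qed
    ultimately show ?thesis unfolding R_def using r(2) by blast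
  qed
  have R_mem: "\<exists>k\<in>brK. \<exists>r'\<in>R. r = k + r'" if "r \<in> R" for r
    by (rule bexI[of _ 0], rule bexI[of _ r]) (use that brK.zero in simp_all)
  have "\<exists>k\<in>brK. \<exists>r\<in>R. g = k + r"
  proof (induction g rule: grig_gen_induct)
    case zero
    have "0 = 0 + (0 + (0 + (0 :: grig)))" by simp
    then have "0 \<in> R" unfolding R_def by blast
    then show ?case by (rule R_mem)
  next
    case (a g) show ?case by (rule lift[OF a]) (rule R_a)
  next
    case (b g) show ?case
      by (rule lift[OF b]) (use R_mem[OF R_b] in blast)
  next
    case (d g) show ?case
      by (rule lift[OF d]) (use R_mem[OF R_d] in blast)
  next
    case (c g)
    have "\<exists>k\<in>brK. \<exists>r'\<in>R. gc + r = k + r'" if "r \<in> R" for r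
      using R_mem[OF R_b[OF R_d[OF that]]] by simp
    then show ?case by (rule lift[OF c])
  qed
  then show ?thesis using that unfolding R_def by blast
qed

text \<open>All four bits vanish on \<open>gt\<close> and hence on its normal closure. Conversely,
  \<open>swp\<close>, \<open>level_parity 1\<close>, \<open>level_parity 2\<close> of the section at
  \<open>False\<close>, and \<open>level_parity 3\<close> detect, one after the other, the factors
  \<open>ga\<close>, \<open>gb\<close>, \<open>ga + gd + ga\<close> and \<open>gd\<close> of the
  coset representative.\<close>

lemma brK_iff:
  "g \<in> brK \<longleftrightarrow> \<not> swp g \<and> \<not> level_parity 1 g \<and> \<not> level_parity 3 g \<and> \<not> level_parity 2 (sec g False)"
proof
  \<comment> \<open>Both sections are listed, because conjugation by an element that swaps the first
    level exchanges them.\<close>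
  let ?N = "{g. \<not> swp g \<and> \<not> level_parity 1 g \<and> \<not> level_parity 3 g \<and>
    \<not> level_parity 2 (sec g False) \<and> \<not> level_parity 2 (sec g True)}"
  have "nsub ?N"
    unfolding nsub_def
  proof (intro conjI ballI allI)
    fix g x assume "x \<in> ?N"
    then show "g + x - g \<in> ?N"
      by (cases "swp g") (simp_all del: One_nat_def)
  qed (auto simp del: One_nat_def)
  moreover have "gt \<in> ?N" by (simp add: eval_nat_numeral)
  ultimately show "g \<in> brK \<Longrightarrow> \<not> swp g \<and> \<not> level_parity 1 g \<and> \<not> level_parity 3 g \<and> \<not> level_parity 2 (sec g False)"
    using brK_least[of ?N] by blast
  then have K: "\<And>k. k \<in> brK \<Longrightarrow> \<not> swp k \<and> \<not> level_parity 1 k \<and> \<not> level_parity 3 k \<and> \<not> level_parity 2 (sec k False)"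
    using \<open>nsub ?N\<close> \<open>gt \<in> ?N\<close> brK_least[of ?N] by blast
  assume g: "\<not> swp g \<and> \<not> level_parity 1 g \<and> \<not> level_parity 3 g \<and> \<not> level_parity 2 (sec g False)"
  obtain k i j l m where *: "k \<in> brK" "g = k + (i + (j + (l + m)))"
    "i \<in> {0, gb}" "j \<in> {0, gd}" "l \<in> {0, ga + (gd + ga)}" "m \<in> {0, ga}"
    by (rule brK_coset_cases)
  have "\<not> swp i" "\<not> swp j" "\<not> swp l" using *(3-5) by auto
  note k = K[OF *(1)]
  have "swp g \<longleftrightarrow> swp m"
    unfolding *(2) using k \<open>\<not> swp i\<close> \<open>\<not> swp j\<close> \<open>\<not> swp l\<close> by simp
  then have m: "m = 0" using g *(6) by auto
  have g': "g = k + (i + (j + l))" using *(2) m by simp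
  have "level_parity 1 i \<longleftrightarrow> i = gb" "\<not> level_parity 1 j" "\<not> level_parity 1 l"
    using *(3-5) level_parity_zero[of 1] by (auto simp: eval_nat_numeral)
  then have "level_parity 1 g \<longleftrightarrow> i = gb"
    unfolding g' using k by simp
  then have i: "i = 0" using g *(3) by auto
  have g': "g = k + (j + l)" using g' i by simp
  have "\<not> level_parity 2 (sec j False)" "level_parity 2 (sec l False) \<longleftrightarrow> l = ga + (gd + ga)"
    using *(4,5) level_parity_zero[of 2] adad_nonzero by (auto simp: eval_nat_numeral)
  then have "level_parity 2 (sec g False) \<longleftrightarrow> l = ga + (gd + ga)"
    unfolding g' using k \<open>\<not> swp j\<close> \<open>\<not> swp l\<close> by simp
  then have l: "l = 0" using g *(5) by auto
  have g': "g = k + j" using g' l by simp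
  have "level_parity 3 j \<longleftrightarrow> j = gd"
    using *(4) level_parity_zero[of 3] by (auto simp: eval_nat_numeral)
  then have "level_parity 3 g \<longleftrightarrow> j = gd"
    unfolding g' using k by simp
  then have "j = 0" using g *(4) by auto
  then show "g \<in> brK" using g' *(1) by simp
qed

lemma brK_not_swp: "k \<in> brK \<Longrightarrow> \<not> swp k"
  by (simp add: brK_iff)

text \<open>Depth 4 is enough, since \<open>level_parity 3\<close> is visible in the action on words
  of length 4.\<close>

lemma cong_closed_brK: "cong_closed brK"
  unfolding cong_closed_def
proof (intro exI[of _ 4] allI impI)
  fix g h assume gh: "cong 4 g h" and g: "g \<in> brK"
  have "4 = Suc 3" by simp
  then have "cong (Suc 3) g h" using gh by metis
  then have "cong 3 (sec g False) (sec h False)" unfolding cong.simps by blast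
  then have "level_parity 2 (sec g False) = level_parity 2 (sec h False)" by (rule cong_level_parity) simp
  moreover note cong_level_parity[OF gh, of 0] cong_level_parity[OF gh, of 1] cong_level_parity[OF gh, of 3]
  ultimately show "h \<in> brK" using g by (simp add: brK_iff)
qed

lemma fin_index_brK: "fin_index brK"
proof (rule fin_indexI)
  show "finite (range (\<lambda>g. (swp g, level_parity 1 g, level_parity 3 g, level_parity 2 (sec g False))))"
    by (rule finite)
  show "- h + g \<in> brK" if "(swp g, level_parity 1 g, level_parity 3 g, level_parity 2 (sec g False)) =
    (swp h, level_parity 1 h, level_parity 3 h, level_parity 2 (sec h False))" for g h
    using that unfolding brK_iff by simp
qed

text \<open>Self-replication. The sections of \<open>gd\<close>, \<open>gb\<close>,
  \<open>gc\<close> at \<open>True\<close> are \<open>gb\<close>, \<open>gc\<close>,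
  \<open>gd\<close>, and \<open>gb\<close> has the section \<open>ga\<close> at
  \<open>False\<close>; conjugation by \<open>ga\<close> moves sections to the other letter.\<close>

lemma ex_section_lift: "\<exists>g. \<not> swp g \<and> sec g x = h"
proof (induction h rule: grig_gen_induct)
  case zero show ?case by (rule exI[of _ 0]) simp
next
  case (a h)
  then obtain g where g: "\<not> swp g" "sec g x = h" by blast
  show ?case by (rule exI[of _ "(if x then ga + gb + ga else gb) + g"]) (cases x; use g in simp)
next
  case (b h)
  then obtain g where g: "\<not> swp g" "sec g x = h" by blast
  show ?case by (rule exI[of _ "(if x then gd else ga + gd + ga) + g"]) (cases x; use g in simp)
next
  case (c h)
  then obtain g where g: "\<not> swp g" "sec g x = h" by blast
  show ?case by (rule exI[of _ "(if x then gb else ga + gb + ga) + g"]) (cases x; use g in simp)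
next
  case (d h)
  then obtain g where g: "\<not> swp g" "sec g x = h" by blast
  show ?case by (rule exI[of _ "(if x then gc else ga + gc + ga) + g"]) (cases x; use g in simp)
qed

text \<open>The branching property. By self-replication the elements \<open>k\<close> that can be
  inserted form a normal subgroup, so it suffices to insert \<open>gt\<close>.\<close>

lemma brK_insert_ex:
  assumes "k \<in> brK"
  shows "\<exists>g\<in>brK. \<not> swp g \<and> sec g x = k \<and> sec g (\<not> x) = 0"
proof -
  define J where "J = {k. \<exists>g\<in>brK. \<not> swp g \<and> sec g x = k \<and> sec g (\<not> x) = 0}"
  have "nsub J"
    unfolding nsub_def
  proof (intro conjI ballI allI)
    show "0 \<in> J" using brK.zero by (force simp: J_def)
  next
    fix k l assume "k \<in> J" "l \<in> J"
    then obtain g h where "g \<in> brK" "\<not> swp g" "sec g x = k" "sec g (\<not> x) = 0"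
      "h \<in> brK" "\<not> swp h" "sec h x = l" "sec h (\<not> x) = 0" by (auto simp: J_def)
    then show "k + l \<in> J" using brK_plus by (auto simp: J_def intro!: bexI[of _ "g + h"])
  next
    fix k assume "k \<in> J"
    then obtain g where "g \<in> brK" "\<not> swp g" "sec g x = k" "sec g (\<not> x) = 0" by (auto simp: J_def)
    then show "- k \<in> J" using brK_uminus by (auto simp: J_def intro!: bexI[of _ "- g"])
  next
    fix h k assume "k \<in> J"
    then obtain g where g: "g \<in> brK" "\<not> swp g" "sec g x = k" "sec g (\<not> x) = 0" by (auto simp: J_def)
    obtain u where u: "\<not> swp u" "sec u x = h" using ex_section_lift by blast
    have "u + g - u \<in> brK" using g nsub_conj nsub_brK by blast
    then show "h + k - h \<in> J"
      using g u by (auto simp: J_def diff_conv_add_uminus simp del: add_uminus_conv_diff intro!: bexI[of _ "u + g + - u"])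
  qed
  moreover have "gt \<in> J"
  proof -
    \<comment> \<open>The sections of \<open>gt\<close> are \<open>gc + ga\<close> and
      \<open>ga + gc\<close>, those of its conjugate \<open>gd + ga + gb\<close> and
      \<open>ga + gc\<close>. So the sections at \<open>True\<close> cancel, and at
      \<open>False\<close> remains \<open>ga + gc + gd + ga + gb\<close>, which is \<open>gt\<close>
      because \<open>gc + gd = gb\<close>.\<close>
    define g where "g = - gt + ((ga + gc) + gt - (ga + gc))"
    have g: "g \<in> brK" unfolding g_def using nsub_brK gt_mem nsub_plus nsub_uminus nsub_conj by blast
    have sec_g: "\<not> swp g" "sec g False = gt" "sec g True = 0"
      unfolding g_def by (simp_all add: group_add_norm del: add_uminus_conv_diff)
    have J: "gt \<in> J" if "h \<in> brK" "\<not> swp h" "sec h x = gt" "sec h (\<not> x) = 0" for h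
      unfolding J_def using that by blast
    show ?thesis
    proof (cases "x = False")
      case True
      then show ?thesis using g sec_g by (intro J[of g]) simp_all
    next
      case False
      then show ?thesis using nsub_conj[OF nsub_brK g, of ga] sec_g by (intro J[of "ga + g - ga"]) simp_all
    qed
  qed
  ultimately have "brK \<subseteq> J" by (rule brK_least)
  then show ?thesis using assms by (auto simp: J_def)
qed

text \<open>The copy of \<open>k\<close> acting on the subtree below \<open>x\<close>. It exists by
  \<open>brK_insert_ex\<close> for \<open>k\<close> in \<open>K\<close> and is then unique.\<close>

definition ins :: "bool \<Rightarrow> grig \<Rightarrow> grig" where
  "ins x k = (SOME g. g \<in> brK \<and> \<not> swp g \<and> sec g x = k \<and> sec g (\<not> x) = 0)"

lemma ins:
  assumes "k \<in> brK"
  shows "ins x k \<in> brK" "\<not> swp (ins x k)" "sec (ins x k) y = (if y = x then k else 0)"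
proof -
  have *: "ins x k \<in> brK \<and> \<not> swp (ins x k) \<and> sec (ins x k) x = k \<and> sec (ins x k) (\<not> x) = 0"
    unfolding ins_def by (rule someI_ex) (use brK_insert_ex[OF assms, of x] in blast)
  then show "ins x k \<in> brK" "\<not> swp (ins x k)" by simp_all
  show "sec (ins x k) y = (if y = x then k else 0)"
    using * by (cases "y = x") auto
qed

text \<open>For \<open>L\<close> inside \<open>K\<close> this is the full product
  \<open>L \<times> L\<close> on the first level, see \<open>prod2_ex\<close>; in general some pairs
  are not realised.\<close>

definition prod2 :: "grig set \<Rightarrow> grig set" where
  "prod2 L = {g. \<not> swp g \<and> (\<forall>x. sec g x \<in> L)}"

definition admissible :: "grig set \<Rightarrow> bool" where
  "admissible L \<longleftrightarrow> nsub L \<and> fin_index L \<and> L \<subseteq> brK \<and> cong_closed L"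

lemma admissible_brK: "admissible brK"
  by (simp add: admissible_def nsub_brK fin_index_brK cong_closed_brK)

lemma prod2_ex:
  assumes "L \<subseteq> brK" "u \<in> L" "v \<in> L"
  shows "\<exists>z\<in>prod2 L. sec z False = u \<and> sec z True = v"
proof -
  have uv: "u \<in> brK" "v \<in> brK" using assms by auto
  let ?z = "ins False u + ins True v"
  have "\<not> swp ?z" "sec ?z False = u" "sec ?z True = v"
    using ins[OF uv(1)] ins[OF uv(2)] by simp_all
  moreover have "sec ?z x \<in> L" for x
    using calculation assms by (cases x) simp_all
  ultimately show ?thesis unfolding prod2_def by blast
qed

lemma nsub_prod2:
  assumes "nsub L" shows "nsub (prod2 L)"
  unfolding nsub_def
proof (intro conjI ballI allI)
  show "0 \<in> prod2 L" using assms by (simp add: prod2_def nsub_zero)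
next
  fix g h assume "g \<in> prod2 L" "h \<in> prod2 L"
  then show "g + h \<in> prod2 L" using assms by (simp add: prod2_def nsub_plus)
next
  fix g assume "g \<in> prod2 L"
  then show "- g \<in> prod2 L" using assms by (simp add: prod2_def nsub_uminus)
next
  fix h g assume "g \<in> prod2 L"
  then show "h + g - h \<in> prod2 L" using assms by (simp add: prod2_def nsub_conj)
qed

lemma fin_index_prod2:
  assumes L: "nsub L" "fin_index L" shows "fin_index (prod2 L)"
proof (rule fin_indexI)
  let ?f = "\<lambda>g. (swp g, coset_rep L (sec g False), coset_rep L (sec g True))"
  show "finite (range ?f)"
    by (rule finite_subset[of _ "UNIV \<times> range (coset_rep L) \<times> range (coset_rep L)"])
      (use finite_range_coset_rep[OF L(1,2)] in auto)
  fix g h assume gh: "?f g = ?f h"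
  have "- sec h x + sec g x \<in> L" for x
    using gh coset_rep_eqD[OF L(1)] by (cases x) auto
  moreover have "sec (- h + g) x = - sec h x + sec g x" for x
    using gh by (cases "swp h") simp_all
  ultimately show "- h + g \<in> prod2 L" using gh by (simp add: prod2_def)
qed

lemma admissible_prod2:
  assumes "admissible L"
  shows "admissible (prod2 L)"
  unfolding admissible_def
proof (intro conjI)
  have L: "nsub L" "fin_index L" "L \<subseteq> brK" "cong_closed L" using assms by (auto simp: admissible_def)
  show "nsub (prod2 L)" by (rule nsub_prod2[OF L(1)])
  show "prod2 L \<subseteq> brK"
  proof
    fix g assume g: "g \<in> prod2 L"
    have k: "sec g False \<in> brK" "sec g True \<in> brK" using g L(3) by (auto simp: prod2_def)
    have "g = ins False (sec g False) + ins True (sec g True)"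
    proof (rule grig_ext)
      show "swp g = swp (ins False (sec g False) + ins True (sec g True))"
        using g ins[OF k(1)] ins[OF k(2)] by (simp add: prod2_def)
      show "sec g x = sec (ins False (sec g False) + ins True (sec g True)) x" for x
        using ins[OF k(1)] ins[OF k(2)] by (cases x) simp_all
    qed
    then show "g \<in> brK" using ins(1)[OF k(1)] ins(1)[OF k(2)] brK_plus by metis
  qed
  show "fin_index (prod2 L)" by (rule fin_index_prod2[OF L(1,2)])
  obtain n where n: "\<And>g h. cong n g h \<Longrightarrow> g \<in> L \<Longrightarrow> h \<in> L" using L(4) unfolding cong_closed_def by metis
  show "cong_closed (prod2 L)"
    unfolding cong_closed_def
  proof (intro exI[of _ "Suc n"] allI impI)
    fix g h assume "cong (Suc n) g h" "g \<in> prod2 L"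
    then show "h \<in> prod2 L" using n unfolding prod2_def by auto
  qed
qed

section \<open>Conjugacy in the Grigorchuk group\<close>

text \<open>The element \<open>y\<close> lies in the closure of the \<open>L\<close>-class of
  \<open>x\<close> for the topology given by the level stabilisers.\<close>

definition near_conj :: "grig set \<Rightarrow> grig \<Rightarrow> grig \<Rightarrow> bool" where
  "near_conj L x y \<longleftrightarrow> (\<forall>n. \<exists>z\<in>L. cong n (z + x - z) y)"

definition conj_by :: "'g :: group_add set \<Rightarrow> 'g \<Rightarrow> 'g \<Rightarrow> bool" where
  "conj_by L x y \<longleftrightarrow> (\<exists>z\<in>L. z + x - z = y)"

lemma conj_conj: "z + (r + x - r) - z = (z + r) + x - (z + r :: 'g :: group_add)"
  by (simp only: group_add_simps)

lemma conj_uminus_cancel: "- z + (z + x - z) + z = (x :: 'g :: group_add)"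
  by (simp only: group_add_simps)

text \<open>The conjugators for the various depths fall into finitely many cosets of
  \<open>L'\<close>. One coset serves infinitely many depths, and a deep conjugator also serves all
  smaller depths.\<close>

lemma near_conj_descend:
  assumes L': "nsub L'" "fin_index L'" "L' \<subseteq> L" and L: "nsub L" and xy: "near_conj L x y"
  shows "\<exists>r\<in>L. near_conj L' (r + x - r) y"
proof -
  obtain F where F: "finite F" "\<And>g. \<exists>r\<in>F. - r + g \<in> L'" using L' unfolding fin_index_def by metis
  have "\<exists>r. r \<in> F \<and> r \<in> L \<and> (\<exists>w\<in>L'. cong n (w + (r + x - r) - w) y)" for n
  proof -
    obtain z where z: "z \<in> L" "cong n (z + x - z) y" using xy unfolding near_conj_def by metis
    obtain r where r: "r \<in> F" "- r + z \<in> L'" using F(2) by metis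
    have "r + (- r + z) - r \<in> L'" by (rule nsub_conj[OF L'(1) r(2)])
    then have w: "z - r \<in> L'" by (simp only: group_add_simps)
    have "- (z - r) + z \<in> L" using w z L' L nsub_plus nsub_uminus by blast
    then have "r \<in> L" by (simp only: group_add_simps)
    moreover have "(z - r) + (r + x - r) - (z - r) = z + x - z"
      by (simp only: group_add_simps)
    then have "cong n ((z - r) + (r + x - r) - (z - r)) y" using z(2) by (simp only:)
    ultimately show ?thesis using r(1) w by blast
  qed
  then obtain \<rho> where \<rho>: "\<And>n. \<rho> n \<in> F" "\<And>n. \<rho> n \<in> L" "\<And>n. \<exists>w\<in>L'. cong n (w + (\<rho> n + x - \<rho> n) - w) y"
    by metis
  have "finite (range \<rho>)" using F(1) \<rho>(1) by (metis finite_subset image_subsetI)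
  then obtain n0 where n0: "infinite {n \<in> UNIV. \<rho> n = \<rho> n0}" using pigeonhole_infinite[of UNIV \<rho>] by blast
  have "near_conj L' (\<rho> n0 + x - \<rho> n0) y"
    unfolding near_conj_def
  proof
    fix n
    obtain m where m: "m > n" "\<rho> m = \<rho> n0" using n0 unfolding infinite_nat_iff_unbounded by blast
    then obtain w where "w \<in> L'" "cong m (w + (\<rho> n0 + x - \<rho> n0) - w) y" using \<rho>(3)[of m] by auto
    then show "\<exists>w\<in>L'. cong n (w + (\<rho> n0 + x - \<rho> n0) - w) y" using m(1) cong_mono less_imp_le by metis
  qed
  then show ?thesis using \<rho>(2) by blast
qed

lemma conj_by_ascend:
  assumes "L' \<subseteq> L" "nsub L" "r \<in> L" "conj_by L' (r + x - r) y"
  shows "conj_by L x y"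
proof -
  obtain z where z: "z \<in> L'" "z + (r + x - r) - z = y" using assms(4) unfolding conj_by_def by blast
  have "z + r \<in> L" using z assms nsub_plus by blast
  then show ?thesis using z(2) unfolding conj_by_def conj_conj by blast
qed

lemma near_conj_swp: "near_conj L x y \<Longrightarrow> swp x = swp y"
proof -
  assume "near_conj L x y"
  then obtain z where "cong 1 (z + x - z) y" unfolding near_conj_def by blast
  then have "swp (z + x - z) = swp y" by simp
  then show ?thesis by auto
qed

lemma near_conj_prod2_stab:
  assumes "near_conj (prod2 L) x y" "\<not> swp x"
  shows "near_conj L (sec x i) (sec y i)"
  unfolding near_conj_def
proof
  fix n
  obtain z where z: "z \<in> prod2 L" "cong (Suc n) (z + x - z) y" using assms(1) unfolding near_conj_def by metis
  have "sec (z + x - z) i = sec z i + sec x i - sec z i" using z(1) assms(2) by (simp add: prod2_def)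
  moreover have "cong n (sec (z + x - z) i) (sec y i)" using z(2) unfolding cong.simps by blast
  ultimately show "\<exists>z\<in>L. cong n (z + sec x i - z) (sec y i)" using z(1) unfolding prod2_def by auto
qed

lemma conj_by_prod2_stab:
  assumes L: "L \<subseteq> brK" and xy: "\<not> swp x" "\<not> swp y" and c: "\<And>i. conj_by L (sec x i) (sec y i)"
  shows "conj_by (prod2 L) x y"
proof -
  obtain u v where uv: "u \<in> L" "u + sec x False - u = sec y False" "v \<in> L" "v + sec x True - v = sec y True"
    using c unfolding conj_by_def by metis
  obtain z where z: "z \<in> prod2 L" "sec z False = u" "sec z True = v" using prod2_ex[OF L uv(1,3)] by blast
  have nz: "\<not> swp z" using z by (simp add: prod2_def)
  have "z + x - z = y"
  proof (rule grig_ext)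
    show "swp (z + x - z) = swp y" using nz xy by simp
    show "sec (z + x - z) i = sec y i" for i
      using nz xy uv z by (cases i) simp_all
  qed
  then show ?thesis using z unfolding conj_by_def by blast
qed

text \<open>If \<open>x\<close> swaps and \<open>z\<close> has sections \<open>u\<close> and
  \<open>v\<close>, the conjugate has the sections \<open>v + sec x False - u\<close> and
  \<open>u + sec x True - v\<close>. In their sum \<open>u\<close> cancels and a conjugate by
  \<open>v\<close> remains; the coset of the first section modulo \<open>L\<close> is preserved.
  \<open>conj_by_prod2_move\<close> shows that these two data suffice.\<close>

lemma near_conj_prod2_move:
  assumes nc: "near_conj (prod2 L) x y" and x: "swp x"
  shows "near_conj L (sec x False + sec x True) (sec y False + sec y True)"
    and "nsub L \<Longrightarrow> cong_closed L \<Longrightarrow> - sec y False + sec x False \<in> L"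
proof -
  have *: "\<exists>u\<in>L. \<exists>v\<in>L. cong n (v + sec x False - u) (sec y False) \<and> cong n (u + sec x True - v) (sec y True)" for n
  proof -
    obtain z where z: "z \<in> prod2 L" "cong (Suc n) (z + x - z) y" using nc unfolding near_conj_def by metis
    have "cong n (sec (z + x - z) i) (sec y i)" for i using z(2) unfolding cong.simps by blast
    moreover have "sec (z + x - z) False = sec z True + sec x False - sec z False"
      "sec (z + x - z) True = sec z False + sec x True - sec z True"
      using z(1) x by (simp_all add: prod2_def)
    ultimately have "cong n (sec z True + sec x False - sec z False) (sec y False)"
      "cong n (sec z False + sec x True - sec z True) (sec y True)" by metis+
    then show ?thesis using z(1) unfolding prod2_def by blast
  qed
  show "near_conj L (sec x False + sec x True) (sec y False + sec y True)"
    unfolding near_conj_def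
  proof
    fix n
    obtain u v where uv: "u \<in> L" "v \<in> L" "cong n (v + sec x False - u) (sec y False)" "cong n (u + sec x True - v) (sec y True)"
      using * by blast
    have "cong n ((v + sec x False - u) + (u + sec x True - v)) (sec y False + sec y True)"
      using uv cong_plus by blast
    moreover have "(v + sec x False - u) + (u + sec x True - v) = v + (sec x False + sec x True) - v"
      by (simp only: group_add_simps)
    ultimately show "\<exists>z\<in>L. cong n (z + (sec x False + sec x True) - z) (sec y False + sec y True)"
      using uv(2) by metis
  qed
  assume L: "nsub L" "cong_closed L"
  then obtain n where n: "\<And>g h. cong n g h \<Longrightarrow> g \<in> L \<Longrightarrow> h \<in> L" unfolding cong_closed_def by metis
  obtain u v where uv: "u \<in> L" "v \<in> L" "cong n (v + sec x False - u) (sec y False)" using * by blast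
  have "u + ((- sec x False) + (- v) - (- sec x False)) \<in> L"
    using uv L nsub_plus nsub_uminus nsub_conj by blast
  moreover have "u + ((- sec x False) + (- v) - (- sec x False)) = - (v + sec x False - u) + sec x False"
    by (simp only: group_add_simps)
  moreover have "cong n (- (v + sec x False - u) + sec x False) (- sec y False + sec x False)"
    using cong_plus[OF cong_uminus[OF uv(3)] cong_refl] .
  ultimately show "- sec y False + sec x False \<in> L" using n by metis
qed

text \<open>A conjugator \<open>v\<close> of the products leaves no choice for the other section:
  matching the sections at \<open>False\<close> forces \<open>u\<close>, and the hypothesis on
  cosets puts it into \<open>L\<close>.\<close>

lemma conj_by_prod2_move:
  assumes L: "L \<subseteq> brK" "nsub L" and xy: "swp x" "swp y"
    and d: "- sec y False + sec x False \<in> L"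
    and c: "conj_by L (sec x False + sec x True) (sec y False + sec y True)"
  shows "conj_by (prod2 L) x y"
proof -
  obtain v where v: "v \<in> L" "v + (sec x False + sec x True) - v = sec y False + sec y True"
    using c unfolding conj_by_def by blast
  define u where "u = - sec y False + v + sec x False"
  have "(- sec y False + sec x False) + (- sec x False + v - - sec x False) \<in> L"
    using d v L nsub_plus nsub_conj by blast
  then have u: "u \<in> L" unfolding u_def by (simp only: group_add_simps)
  obtain z where z: "z \<in> prod2 L" "sec z False = u" "sec z True = v" using prod2_ex[OF L(1) u v(1)] by blast
  have nz: "\<not> swp z" using z by (simp add: prod2_def)
  have "z + x - z = y"
  proof (rule grig_ext)
    show "swp (z + x - z) = swp y" using nz xy by simp
    fix i
    have "sec (z + x - z) False = v + sec x False - u" using nz xy z by simp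
    also have "\<dots> = sec y False" unfolding u_def by (simp only: group_add_simps)
    finally have F: "sec (z + x - z) False = sec y False" .
    have "sec (z + x - z) True = u + sec x True - v" using nz xy z by simp
    also have "\<dots> = - sec y False + (v + (sec x False + sec x True) - v)"
      unfolding u_def by (simp only: group_add_simps)
    also have "\<dots> = sec y True" unfolding v(2) by (simp only: group_add_simps)
    finally have T: "sec (z + x - z) True = sec y True" .
    show "sec (z + x - z) i = sec y i" using F T by (cases i) (simp_all only:)
  qed
  then show ?thesis using z unfolding conj_by_def by blast
qed

definition conj_separates :: "grig set \<Rightarrow> bool" where
  "conj_separates L \<longleftrightarrow> (\<forall>x y. near_conj L x y \<longrightarrow> conj_by L x y)"

lemma conj_separates_prod2:
  assumes L: "admissible L" and hc: "conj_separates L"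
  shows "conj_separates (prod2 L)"
  unfolding conj_separates_def
proof (intro allI impI)
  fix x y assume nc: "near_conj (prod2 L) x y"
  have L': "nsub L" "L \<subseteq> brK" "cong_closed L" using L by (auto simp: admissible_def)
  have s: "swp x = swp y" by (rule near_conj_swp[OF nc])
  show "conj_by (prod2 L) x y"
  proof (cases "swp x")
    case True
    show ?thesis
      by (rule conj_by_prod2_move)
        (use True s L' near_conj_prod2_move[OF nc True] hc in \<open>simp_all add: conj_separates_def\<close>)
  next
    case False
    show ?thesis
      by (rule conj_by_prod2_stab)
        (use False s L' near_conj_prod2_stab[OF nc False] hc in \<open>simp_all add: conj_separates_def\<close>)
  qed
qed

lemma conj_separates_mono:
  assumes "conj_separates L'" "nsub L'" "fin_index L'" "L' \<subseteq> L" "nsub L"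
  shows "conj_separates L"
  using assms near_conj_descend conj_by_ascend unfolding conj_separates_def by meson

text \<open>The quantifier over \<open>h\<close> makes the notion invariant under conjugation of
  either argument in \<open>G\<close>, as the contraction induction demands, while the conjugators
  themselves stay in \<open>K\<close>.\<close>

definition good_pair :: "grig \<Rightarrow> grig \<Rightarrow> bool" where
  "good_pair x y \<longleftrightarrow> (\<forall>h. near_conj brK x (h + y - h) \<longrightarrow> conj_by brK x (h + y - h))"

lemma good_pair_conj_left:
  assumes "good_pair x y" shows "good_pair (g + x - g) y"
  unfolding good_pair_def
proof (intro allI impI)
  fix h assume nc: "near_conj brK (g + x - g) (h + y - h)"
  have eq: "- g + (h + y - h) + g = (- g + h) + y - (- g + h)"
    by (simp only: group_add_simps)
  have "near_conj brK x ((- g + h) + y - (- g + h))"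
    unfolding near_conj_def
  proof
    fix n
    obtain z where z: "z \<in> brK" "cong n (z + (g + x - g) - z) (h + y - h)" using nc unfolding near_conj_def by metis
    have "cong n (- g + (z + (g + x - g) - z) + g) (- g + (h + y - h) + g)"
      using z(2) cong_plus cong_refl by metis
    moreover have "- g + (z + (g + x - g) - z) + g = (- g + z - - g) + x - (- g + z - - g)"
      by (simp only: group_add_simps)
    ultimately have "cong n ((- g + z - - g) + x - (- g + z - - g)) ((- g + h) + y - (- g + h))"
      unfolding eq by (simp only:)
    then show "\<exists>z\<in>brK. cong n (z + x - z) ((- g + h) + y - (- g + h))"
      using nsub_conj[OF nsub_brK z(1)] by blast
  qed
  then obtain z where z: "z \<in> brK" "z + x - z = (- g + h) + y - (- g + h)"
    using assms unfolding good_pair_def conj_by_def by blast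
  have "(g + z - g) + (g + x - g) - (g + z - g) = g + (z + x - z) - g"
    by (simp only: group_add_simps)
  also have "\<dots> = h + y - h" unfolding z(2) by (simp only: group_add_simps)
  finally show "conj_by brK (g + x - g) (h + y - h)"
    using nsub_conj[OF nsub_brK z(1)] unfolding conj_by_def by blast
qed

lemma good_pair_conj_right:
  assumes "good_pair x y" shows "good_pair x (g + y - g)"
  using assms unfolding good_pair_def conj_conj by blast

lemma good_pair_sym:
  assumes "good_pair x y" shows "good_pair y x"
  unfolding good_pair_def
proof (intro allI impI)
  fix h assume nc: "near_conj brK y (h + x - h)"
  have "near_conj brK x (- h + y - - h)"
    unfolding near_conj_def
  proof
    fix n
    obtain z where z: "z \<in> brK" "cong n (z + y - z) (h + x - h)" using nc unfolding near_conj_def by metis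
    have "cong n (- h + (- z + (z + y - z) + z) + h) (- h + (- z + (h + x - h) + z) + h)"
      using z(2) cong_plus cong_refl by metis
    moreover have "- h + (- z + (z + y - z) + z) + h = - h + y - - h"
      by (simp only: group_add_simps)
    moreover have "- h + (- z + (h + x - h) + z) + h = (- h + (- z) - - h) + x - (- h + (- z) - - h)"
      by (simp only: group_add_simps)
    ultimately have "cong n ((- h + (- z) - - h) + x - (- h + (- z) - - h)) (- h + y - - h)"
      using cong_sym by metis
    then show "\<exists>z\<in>brK. cong n (z + x - z) (- h + y - - h)"
      using nsub_conj[OF nsub_brK nsub_uminus[OF nsub_brK z(1)]] by blast
  qed
  then obtain z where z: "z \<in> brK" "z + x - z = - h + y - - h"
    using assms unfolding good_pair_def conj_by_def by blast
  have "(h + - z - h) + y - (h + - z - h) = h + (- z + (- h + y - - h) + z) - h"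
    by (simp only: group_add_simps)
  also have "- h + y - - h = z + x - z"
    by (rule z(2)[symmetric])
  also have "h + (- z + (z + x - z) + z) - h = h + x - h"
    by (simp only: conj_uminus_cancel)
  finally show "conj_by brK y (h + x - h)"
    using nsub_conj[OF nsub_brK nsub_uminus[OF nsub_brK z(1)]] unfolding conj_by_def by blast
qed

lemma good_pair_zero: "good_pair x 0"
  unfolding good_pair_def
proof (intro allI impI)
  fix h assume nc: "near_conj brK x (h + 0 - h)"
  have "cong n x 0" for n
  proof -
    obtain z where z: "cong n (z + x - z) 0" using nc unfolding near_conj_def by auto
    have "cong n (- z + (z + x - z) + z) (- z + 0 + z)" using z cong_plus cong_refl by metis
    then show ?thesis unfolding conj_uminus_cancel by simp
  qed
  then have "x = 0" by (rule cong_all_eq)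
  then show "conj_by brK x (h + 0 - h)" unfolding conj_by_def using brK.zero by auto
qed

lemma prod2_brK: "nsub (prod2 brK)" "fin_index (prod2 brK)" "prod2 brK \<subseteq> brK"
  using admissible_prod2[OF admissible_brK] by (auto simp: admissible_def)

text \<open>After descending to \<open>prod2 brK\<close> the two sections can be conjugated
  independently. All pairs \<open>i\<close>, \<open>j\<close> are needed, since \<open>h\<close> may
  exchange the sections of \<open>y\<close>.\<close>

lemma good_pair_stab:
  assumes x: "\<not> swp x" and y: "\<not> swp y" and s: "\<And>i j. good_pair (sec x i) (sec y j)"
  shows "good_pair x y"
  unfolding good_pair_def
proof (intro allI impI)
  fix h assume "near_conj brK x (h + y - h)"
  then obtain r where r: "r \<in> brK" "near_conj (prod2 brK) (r + x - r) (h + y - h)"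
    using near_conj_descend[OF prod2_brK nsub_brK] by blast
  have nr: "\<not> swp r" by (rule brK_not_swp[OF r(1)])
  have "conj_by brK (sec (r + x - r) i) (sec (h + y - h) i)" for i
  proof -
    have "sec (r + x - r) i = sec r i + sec x i - sec r i" using nr x by simp
    moreover obtain j where "sec (h + y - h) i = sec h j + sec y j - sec h j"
      using y by (cases "swp h") simp_all
    moreover have "good_pair (sec r i + sec x i - sec r i) (sec y j)" by (rule good_pair_conj_left[OF s])
    moreover have "near_conj brK (sec (r + x - r) i) (sec (h + y - h) i)"
      using near_conj_prod2_stab[OF r(2)] x nr by simp
    ultimately show ?thesis unfolding good_pair_def by metis
  qed
  then have "conj_by (prod2 brK) (r + x - r) (h + y - h)"
    by (intro conj_by_prod2_stab) (use x y in simp_all)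
  then show "conj_by brK x (h + y - h)" using conj_by_ascend prod2_brK(3) nsub_brK r(1) by blast
qed

lemma sec_conj_move:
  assumes "swp x"
  shows "\<exists>u. sec (r + x - r) False + sec (r + x - r) True = u + (sec x False + sec x True) - u"
proof (cases "swp r")
  case True
  have "sec (r + x - r) False + sec (r + x - r) True
    = (sec r False + sec x True - sec r True) + (sec r True + sec x False - sec r False)"
    using assms True by simp
  also have "\<dots> = (sec r False + - sec x False) + (sec x False + sec x True) - (sec r False + - sec x False)"
    by (simp only: group_add_simps)
  finally show ?thesis by blast
next
  case False
  have "sec (r + x - r) False + sec (r + x - r) True
    = (sec r True + sec x False - sec r False) + (sec r False + sec x True - sec r True)"
    using assms False by simp
  also have "\<dots> = sec r True + (sec x False + sec x True) - sec r True"
    by (simp only: group_add_simps)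
  finally show ?thesis by blast
qed

text \<open>Conjugation changes the product of the sections only to a conjugate, by
  \<open>sec_conj_move\<close>. The coset condition for reassembling a conjugator comes from near
  conjugacy, because \<open>K\<close> contains a level stabiliser.\<close>

lemma good_pair_move:
  assumes x: "swp x" and y: "swp y" and s: "good_pair (sec x False + sec x True) (sec y False + sec y True)"
  shows "good_pair x y"
  unfolding good_pair_def
proof (intro allI impI)
  fix h assume "near_conj brK x (h + y - h)"
  then obtain r where r: "r \<in> brK" "near_conj (prod2 brK) (r + x - r) (h + y - h)"
    using near_conj_descend[OF prod2_brK nsub_brK] by blast
  have sx: "swp (r + x - r)" and sy: "swp (h + y - h)" using x y by simp_all
  note mv = near_conj_prod2_move[OF r(2) sx]
  obtain u where u: "sec (r + x - r) False + sec (r + x - r) True = u + (sec x False + sec x True) - u"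
    using sec_conj_move[OF x] by metis
  obtain v where v: "sec (h + y - h) False + sec (h + y - h) True = v + (sec y False + sec y True) - v"
    using sec_conj_move[OF y] by metis
  have "conj_by brK (sec (r + x - r) False + sec (r + x - r) True) (sec (h + y - h) False + sec (h + y - h) True)"
    using good_pair_conj_left[OF s, of u] mv(1) unfolding u v good_pair_def by blast
  then have "conj_by (prod2 brK) (r + x - r) (h + y - h)"
    using conj_by_prod2_move[OF subset_refl nsub_brK sx sy] mv(2) nsub_brK cong_closed_brK by blast
  then show "conj_by brK x (h + y - h)" using conj_by_ascend prod2_brK(3) nsub_brK r(1) by blast
qed

lemma good_pair_mixed: "swp x \<noteq> swp y \<Longrightarrow> good_pair x y"
  unfolding good_pair_def using near_conj_swp by (metis swp_minus swp_plus)

lemma near_conj_level_parity: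
  assumes "near_conj L x (h + y - h)" shows "level_parity n x = level_parity n y"
proof -
  obtain z where "cong (Suc n) (z + x - z) (h + y - h)" using assms unfolding near_conj_def by blast
  then have "level_parity n (z + x - z) = level_parity n (h + y - h)"
    by (rule cong_level_parity) simp
  then show ?thesis by auto
qed

lemma good_pair_parity: "level_parity n x \<noteq> level_parity n y \<Longrightarrow> good_pair x y"
  using near_conj_level_parity unfolding good_pair_def by blast

text \<open>Comparing \<open>x\<close> with its own conjugates becomes a question about
  centralisers: \<open>h\<close> agrees modulo \<open>K\<close> with an element that commutes with
  \<open>x\<close> to any prescribed depth.\<close>

lemma near_conj_centraliser:
  assumes "near_conj brK x (h + x - h)"
  shows "\<exists>z w. z \<in> brK \<and> h = z + w \<and> cong n (w + x - w) x"
proof -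
  obtain z where z: "z \<in> brK" "cong n (z + x - z) (h + x - h)" using assms unfolding near_conj_def by metis
  have "cong n (- z + (z + x - z) + z) (- z + (h + x - h) + z)" using z(2) cong_plus cong_refl by metis
  moreover have "- z + (h + x - h) + z = (- z + h) + x - (- z + h)"
    by (simp only: group_add_simps)
  ultimately have "cong n ((- z + h) + x - (- z + h)) x"
    unfolding conj_uminus_cancel using cong_sym by metis
  then show ?thesis using z(1) by (intro exI[of _ z] exI[of _ "- z + h"]) simp
qed

text \<open>If \<open>w\<close> swaps the first level and nearly commutes with \<open>x\<close>, it
  nearly conjugates one section of \<open>x\<close> to the other. The sections of \<open>gb\<close>,
  \<open>gc\<close> and \<open>gd\<close> have different parities at some level, so
  near-centralisers of these cannot swap.\<close>

lemma cong_commute_swap_parity: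
  assumes "cong (Suc n) (w + x - w) x" "swp w" "\<not> swp x" "m < n"
  shows "level_parity m (sec x False) = level_parity m (sec x True)"
proof -
  have "cong n (sec (w + x - w) True) (sec x True)" using assms(1) unfolding cong.simps by blast
  moreover have "sec (w + x - w) True = sec w False + sec x False - sec w False" using assms(2,3) by simp
  ultimately have "level_parity m (sec w False + sec x False - sec w False) = level_parity m (sec x True)"
    using cong_level_parity assms(4) by metis
  then show ?thesis by auto
qed

text \<open>Commuting with \<open>ga\<close> to this depth makes the two sections of
  \<open>w\<close> agree to depth 3, so their parities cancel.\<close>

lemma parity_of_near_centraliser_of_a:
  assumes "cong 4 (w + ga - w) ga"
  shows "\<not> level_parity 2 w"
proof -
  have "4 = Suc 3" by simp
  then have "cong 3 (sec (w + ga - w) False) (sec ga False)" using assms cong.simps(2) by metis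
  moreover have "\<exists>s. sec (w + ga - w) False = sec w s - sec w (\<not> s)"
    by (cases "swp w") (auto intro: exI[of _ False] exI[of _ True])
  ultimately obtain s where "cong 3 (sec w s - sec w (\<not> s)) 0" by auto
  then have "level_parity 1 (sec w s - sec w (\<not> s)) = level_parity 1 0" by (rule cong_level_parity) simp
  then have "level_parity 1 (sec w s) = level_parity 1 (sec w (\<not> s))" by (simp del: One_nat_def)
  then have "level_parity 1 (sec w False) = level_parity 1 (sec w True)" by (cases s) (simp_all del: One_nat_def)
  then show ?thesis by (simp add: numeral_2_eq_2)
qed

lemma conj_by_brK_of_centraliser:
  assumes "k \<in> brK" "h = k + r" "r + x = x + r"
  shows "conj_by brK x (h + x - h)"
proof -
  have "h + x - h = k + (r + x - r) - k" unfolding assms(2) by (simp only: group_add_simps)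
  also have "r + x - r = x" by (simp add: assms(3))
  finally show ?thesis using assms(1) unfolding conj_by_def by auto
qed

text \<open>
  An element centralising \<open>b\<close> or \<open>c\<close> modulo a deep level lies in \<open>K \<langle>b, c, d\<rangle>\<close>, since its
  section at \<open>0\<close> then nearly centralises \<open>a\<close>.
\<close>

lemma good_pair_bc:
  assumes x: "x = gb \<or> x = gc"
  shows "good_pair x x"
  unfolding good_pair_def
proof (intro allI impI)
  fix h assume nc: "near_conj brK x (h + x - h)"
  have sx: "\<not> swp x" "sec x False = ga" "level_parity 0 (sec x True) = False" using x by auto
  obtain z w where zw: "z \<in> brK" "h = z + w" "cong 5 (w + x - w) x" using near_conj_centraliser[OF nc] by blast
  have "5 = Suc 4" by simp
  then have c5: "cong (Suc 4) (w + x - w) x" using zw(3) by metis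
  have w: "\<not> swp w"
  proof
    assume "swp w"
    from cong_commute_swap_parity[OF c5 this sx(1), of 0] sx show False by simp
  qed
  have "cong 4 (sec (w + x - w) False) (sec x False)" using c5 unfolding cong.simps by blast
  moreover have "sec (w + x - w) False = sec w False + ga - sec w False" using w sx by simp
  ultimately have "cong 4 (sec w False + ga - sec w False) ga" unfolding sx(2) by metis
  then have lw: "\<not> level_parity 2 (sec w False)" by (rule parity_of_near_centraliser_of_a)
  have z: "\<not> swp z" "\<not> level_parity 2 (sec z False)" using zw(1) brK_iff by blast+
  have h: "\<not> swp h" "\<not> level_parity 2 (sec h False)" unfolding zw(2) using w lw z by simp_all
  obtain k i j l m where *: "k \<in> brK" "h = k + (i + (j + (l + m)))"
    "i \<in> {0, gb}" "j \<in> {0, gd}" "l \<in> {0, ga + (gd + ga)}" "m \<in> {0, ga}"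
    by (rule brK_coset_cases)
  have k: "\<not> swp k" "\<not> level_parity 2 (sec k False)" using *(1) brK_iff by blast+
  have ns: "\<not> swp i" "\<not> swp j" "\<not> swp l" using *(3-5) by auto
  have "swp h \<longleftrightarrow> swp m" unfolding *(2) using k ns by simp
  then have m: "m = 0" using h *(6) by auto
  have h2: "h = k + (i + (j + l))" using *(2) m by simp
  have "\<not> level_parity 2 (sec i False)" "\<not> level_parity 2 (sec j False)"
    "level_parity 2 (sec l False) \<longleftrightarrow> l = ga + (gd + ga)"
    using *(3-5) level_parity_zero[of 2] adad_nonzero by (auto simp: eval_nat_numeral)
  then have "level_parity 2 (sec h False) \<longleftrightarrow> l = ga + (gd + ga)"
    unfolding h2 using k ns by simp
  then have l: "l = 0" using h *(5) by auto
  show "conj_by brK x (h + x - h)"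
    by (rule conj_by_brK_of_centraliser[OF *(1), of _ "i + j"]) (use h2 l x *(3,4) in \<open>auto simp: add.assoc\<close>)
qed

text \<open>Every coset of \<open>K\<close> that fixes the first level has a representative built
  from \<open>gb\<close>, \<open>gd\<close> and \<open>ga + gd + ga\<close>, all of which commute
  with \<open>gd\<close>. Swapping is excluded by the sections \<open>0\<close> and
  \<open>gb\<close> of \<open>gd\<close>, whose parities at level 1 differ.\<close>

lemma good_pair_d: "good_pair gd gd"
  unfolding good_pair_def
proof (intro allI impI)
  fix h assume nc: "near_conj brK gd (h + gd - h)"
  obtain z w where zw: "z \<in> brK" "h = z + w" "cong 3 (w + gd - w) gd" using near_conj_centraliser[OF nc] by blast
  have "3 = Suc 2" by simp
  then have c3: "cong (Suc 2) (w + gd - w) gd" using zw(3) by metis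
  have w: "\<not> swp w"
  proof
    assume "swp w"
    from cong_commute_swap_parity[OF c3 this, of 1] show False by simp
  qed
  have h: "\<not> swp h" unfolding zw(2) using w brK_not_swp[OF zw(1)] by simp
  obtain k i j l m where *: "k \<in> brK" "h = k + (i + (j + (l + m)))"
    "i \<in> {0, gb}" "j \<in> {0, gd}" "l \<in> {0, ga + (gd + ga)}" "m \<in> {0, ga}"
    by (rule brK_coset_cases)
  have ns: "\<not> swp i" "\<not> swp j" "\<not> swp l" using *(3-5) by auto
  have "swp h \<longleftrightarrow> swp m" unfolding *(2) using brK_not_swp[OF *(1)] ns by simp
  then have m: "m = 0" using h *(6) by auto
  have l: "l + gd = gd + l" using *(5) ad_order_four by (auto simp: add.assoc)
  have ij: "i + gd = gd + i" "j + gd = gd + j" using *(3,4) by auto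
  show "conj_by brK gd (h + gd - h)"
  proof (rule conj_by_brK_of_centraliser[OF *(1)])
    show "h = k + (i + (j + l))" using *(2) m by simp
    show "(i + (j + l)) + gd = gd + (i + (j + l))"
      by (metis add.assoc ij l)
  qed
qed

lemma good_pair_swap_gen: "good_pair ga y"
proof (cases "swp y")
  case True
  show ?thesis
    by (rule good_pair_move) (use True good_pair_sym[OF good_pair_zero] in simp_all)
qed (simp add: good_pair_mixed)

text \<open>Only \<open>y\<close> contracts here: the sections of \<open>gb\<close>,
  \<open>gc\<close>, \<open>gd\<close> are again among these letters, \<open>ga\<close> and
  \<open>0\<close>, so the three claims must be proved together.\<close>

lemma good_pair_klein: "good_pair gb y \<and> good_pair gc y \<and> good_pair gd y"
proof -
  have par: "level_parity 1 gb" "level_parity 1 gc" "\<not> level_parity 1 gd"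
    "level_parity 2 gb" "\<not> level_parity 2 gc" "level_parity 2 gd"
    by (simp_all add: eval_nat_numeral)
  have bc: "good_pair gb gc" by (rule good_pair_parity[of 2]) (use par in simp)
  have bd: "good_pair gb gd" by (rule good_pair_parity[of 1]) (use par in simp)
  have cd: "good_pair gc gd" by (rule good_pair_parity[of 1]) (use par in simp)
  show ?thesis
  proof (induction y rule: grig_contraction_induct)
    case (1 g x) then show ?case using good_pair_conj_right by blast
  next
    case 2 show ?case using good_pair_zero by blast
  next
    case 3 show ?case using good_pair_bc bc bd good_pair_sym by blast
  next
    case 4 show ?case using good_pair_bc bc cd good_pair_sym by blast
  next
    case 5 show ?case using good_pair_d bd cd by blast
  next
    case (6 y)
    have IH: "good_pair gb (sec y j)" "good_pair gc (sec y j)" "good_pair gd (sec y j)" for j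
      using 6 by (cases j; simp)+
    have "good_pair gb y"
    proof (rule good_pair_stab)
      show "good_pair (sec gb i) (sec y j)" for i j
        using IH good_pair_swap_gen by (cases i) simp_all
    qed (use 6 in simp_all)
    moreover have "good_pair gc y"
    proof (rule good_pair_stab)
      show "good_pair (sec gc i) (sec y j)" for i j
        using IH good_pair_swap_gen by (cases i) simp_all
    qed (use 6 in simp_all)
    moreover have "good_pair gd y"
    proof (rule good_pair_stab)
      show "good_pair (sec gd i) (sec y j)" for i j
        using IH good_pair_sym[OF good_pair_zero] by (cases i) simp_all
    qed (use 6 in simp_all)
    ultimately show ?case by blast
  next
    case (7 y)
    then show ?case using good_pair_mixed by simp
  qed
qed

lemma good_pair: "good_pair x y"
proof -
  have "\<forall>y. good_pair x y"
  proof (induction x rule: grig_contraction_induct)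
    case (1 g x) then show ?case using good_pair_conj_left by blast
  next
    case 2 show ?case using good_pair_sym[OF good_pair_zero] by blast
  next
    case (6 x)
    have IH: "good_pair (sec x i) y" for i y using 6 by (cases i) simp_all
    show ?case
    proof
      fix y show "good_pair x y"
        using good_pair_stab[OF 6(1) _ IH] good_pair_mixed[of x y] 6(1) by blast
    qed
  next
    case (7 x)
    show ?case
    proof
      fix y show "good_pair x y"
        using good_pair_move[OF 7(1)] 7(2) good_pair_mixed[of x y] 7(1) by blast
    qed
  qed (use good_pair_klein in blast)+
  then show ?thesis ..
qed

lemma conj_separates_brK: "conj_separates brK"
  unfolding conj_separates_def
proof (intro allI impI)
  fix x y assume "near_conj brK x y"
  then show "conj_by brK x y" using good_pair[of x y] unfolding good_pair_def
    by (metis add_0_left diff_0_right)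
qed

section \<open>Copies of the branching subgroup inside normal subgroups\<close>

lemma ins_unique:
  assumes "k \<in> brK" "\<not> swp g" "sec g x = k" "sec g (\<not> x) = 0"
  shows "ins x k = g"
proof (rule grig_ext)
  show "swp (ins x k) = swp g" using ins[OF assms(1)] assms by simp
  show "sec (ins x k) y = sec g y" for y
    using ins[OF assms(1), of x] assms by (cases "y = x") auto
qed

lemma sec_ins [simp]: "k \<in> brK \<Longrightarrow> sec (ins x k) x = k" "k \<in> brK \<Longrightarrow> sec (ins x k) (\<not> x) = 0"
  "k \<in> brK \<Longrightarrow> \<not> swp (ins x k)" "k \<in> brK \<Longrightarrow> ins x k \<in> brK"
  using ins by simp_all

lemma ins_plus: "k \<in> brK \<Longrightarrow> l \<in> brK \<Longrightarrow> ins x (k + l) = ins x k + ins x l"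
  by (rule ins_unique) (simp_all add: brK_plus)

lemma ins_zero: "ins x 0 = 0"
  by (rule ins_unique) (simp_all add: brK.zero)

lemma ins_uminus: "k \<in> brK \<Longrightarrow> ins x (- k) = - ins x k"
  by (rule ins_unique) (simp_all add: brK_uminus)

lemma ins_conj:
  assumes "k \<in> brK"
  shows "\<exists>u. ins x (h + k - h) = u + ins x k - u"
proof -
  obtain u where "\<not> swp u" "sec u x = h" using ex_section_lift by blast
  then have "ins x (h + k - h) = u + ins x k - u"
    using assms by (intro ins_unique) (simp_all add: nsub_conj[OF nsub_brK])
  then show ?thesis by blast
qed

text \<open>The part of \<open>K\<close> whose copies on the first level lie in \<open>N\<close>.
  Iterating it asks about copies on deeper levels; for normal \<open>N\<close> one of the two copies
  is enough, as \<open>ga\<close> exchanges them.\<close>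

definition down :: "grig set \<Rightarrow> grig set" where
  "down N = {k \<in> brK. \<forall>x. ins x k \<in> N}"

lemma nsub_down:
  assumes N: "nsub N" shows "nsub (down N)"
  unfolding nsub_def
proof (intro conjI ballI allI)
  show "0 \<in> down N" using N by (simp add: down_def ins_zero nsub_zero brK.zero)
next
  fix g h assume "g \<in> down N" "h \<in> down N"
  then show "g + h \<in> down N" using N by (simp add: down_def ins_plus nsub_plus brK_plus)
next
  fix g assume "g \<in> down N"
  then show "- g \<in> down N" using N by (simp add: down_def ins_uminus nsub_uminus brK_uminus)
next
  fix h g assume g: "g \<in> down N"
  have "ins x (h + g - h) \<in> N" for x
  proof -
    obtain u where "ins x (h + g - h) = u + ins x g - u" using ins_conj g unfolding down_def by blast
    then show ?thesis using N g nsub_conj unfolding down_def by auto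
  qed
  then show "h + g - h \<in> down N" using g nsub_conj[OF nsub_brK] by (simp add: down_def)
qed

lemma down_memI:
  assumes N: "nsub N" and k: "k \<in> brK" "ins x k \<in> N"
  shows "k \<in> down N"
proof -
  have "ins (\<not> x) k = ga + ins x k - ga"
    using k by (intro ins_unique) simp_all
  then have "ins (\<not> x) k \<in> N" using nsub_conj[OF N k(2)] by simp
  then have "ins y k \<in> N" for y using k by (cases "y = x") auto
  then show ?thesis using k unfolding down_def by blast
qed

lemma prod2_subset_of_down:
  assumes N: "nsub N" and M: "M \<subseteq> down N"
  shows "prod2 M \<subseteq> N"
proof
  fix g assume g: "g \<in> prod2 M"
  have k: "sec g x \<in> brK" "ins y (sec g x) \<in> N" for x y using g M by (auto simp: prod2_def down_def)
  have "g = ins False (sec g False) + ins True (sec g True)"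
  proof (rule grig_ext)
    show "swp g = swp (ins False (sec g False) + ins True (sec g True))"
      using g k by (simp add: prod2_def)
    show "sec g x = sec (ins False (sec g False) + ins True (sec g True)) x" for x
      using ins(3)[OF k(1)] k by (cases x) simp_all
  qed
  then show "g \<in> N" using k(2) nsub_plus[OF N] by metis
qed

text \<open>A copy of \<open>gt\<close> two levels down is a commutator of elements of
  \<open>K\<close>. The reason is that \<open>ins False gt\<close> is the commutator of
  \<open>gt\<close> with its own section \<open>gc + ga\<close> at \<open>False\<close>; inserting
  the first of these two elements at \<open>False\<close> realises that commutator inside
  \<open>K\<close>.\<close>

lemma gt_insert_commutator:
  "ins False (ins False gt) = - ins False gt + - gt + ins False gt - - gt"
proof (rule ins_unique)
  note gt = gt_mem
  let ?t = "ins False gt"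
  show "?t \<in> brK" using gt by simp
  have swt: "\<not> swp gt" by simp
  show "\<not> swp (- ?t + - gt + ?t - - gt)" using gt swt by (simp add: group_add_norm del: add_uminus_conv_diff)
  have "?t = - gt + ((ga + gc) + gt - (ga + gc))"
    by (rule ins_unique[OF gt]) (simp_all add: group_add_norm del: add_uminus_conv_diff)
  also have "\<dots> = - gt + - sec gt False + gt + sec gt False"
    by (simp add: group_add_norm del: add_uminus_conv_diff)
  also have "\<dots> = - sec ?t False + - sec gt False + sec ?t False - - sec gt False"
    unfolding sec_ins(1)[OF gt] by simp
  also have "\<dots> = sec (- ?t + - gt + ?t - - gt) False"
    using gt swt sec_ins(3)[OF gt, of False]
    by (simp only: sec_plus sec_uminus sec_minus swp_plus swp_uminus swp_minus simp_thms)
  finally show "sec (- ?t + - gt + ?t - - gt) False = ?t" ..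
  have "sec ?t True = 0" using sec_ins(2)[OF gt, of False] by simp
  then show "sec (- ?t + - gt + ?t - - gt) (\<not> False) = 0"
    using gt swt sec_ins(3)[OF gt, of False]
    by (simp only: sec_plus sec_uminus sec_minus swp_plus swp_uminus swp_minus simp_thms) simp
qed

text \<open>One commutator is enough: \<open>down (down N)\<close> is normal and \<open>K\<close> is
  the normal closure of \<open>gt\<close>.\<close>

lemma brK_subset_of_commutators:
  assumes N: "nsub N" and c: "\<And>k l. k \<in> brK \<Longrightarrow> l \<in> brK \<Longrightarrow> - k + l + k - l \<in> N"
  shows "brK \<subseteq> down (down N)"
proof (rule brK_least)
  show "nsub (down (down N))" by (intro nsub_down N)
  have "ins False (ins False gt) \<in> N"
    unfolding gt_insert_commutator by (rule c[OF sec_ins(4)[OF gt_mem] brK_uminus[OF gt_mem]])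
  then have "ins False gt \<in> down N" by (rule down_memI[OF N sec_ins(4)[OF gt_mem]])
  then show "gt \<in> down (down N)" by (rule down_memI[OF nsub_down[OF N] gt_mem])
qed

primrec brK_level :: "nat \<Rightarrow> grig set" where
  "brK_level 0 = brK"
| "brK_level (Suc n) = prod2 (brK_level n)"

lemma admissible_brK_level: "admissible (brK_level n)"
  by (induction n) (simp_all add: admissible_brK admissible_prod2)

lemma conj_separates_brK_level: "conj_separates (brK_level n)"
  by (induction n) (simp_all add: conj_separates_brK conj_separates_prod2 admissible_brK_level)

text \<open>
  If \<open>g\<close> moves a vertex \<open>v\<close>, the double commutators of \<open>g\<close> with elements supported below \<open>v\<close>
  are commutators of such elements, and these already generate a copy of \<open>K\<close> two levels deeper.
\<close>

lemma brK_level_subset: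
  assumes "nsub N" "\<And>k. k \<in> brK \<Longrightarrow> g + k - g - k \<in> N" "\<not> cong n g 0"
  shows "\<exists>m. brK_level m \<subseteq> N"
  using assms
proof (induction n arbitrary: g N)
  case (Suc n)
  note N = Suc.prems(1)
  show ?case
  proof (cases "swp g")
    case True
    have "- k + l + k - l \<in> down N" if k: "k \<in> brK" and l: "l \<in> brK" for k l
    proof (rule down_memI[OF N, of _ False])
      show kl: "- k + l + k - l \<in> brK"
        using k l nsub_brK by (intro nsub_minus nsub_plus nsub_uminus)
      \<comment> \<open>As \<open>g\<close> carries the copy of \<open>k\<close> to the other
        subtree, the section of \<open>c\<close> at \<open>False\<close> is just
        \<open>- k\<close>.\<close>
      define c where "c = g + ins False k - g - ins False k"
      have c: "c \<in> N" unfolding c_def using Suc.prems(2) k by simp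
      have sc: "\<not> swp c" "sec c False = - k"
        unfolding c_def using k True ins(3)[OF k, of False] by simp_all
      have "c + (ins False l + - c - ins False l) \<in> N"
        using c N nsub_plus nsub_conj nsub_uminus by blast
      moreover have "ins False (- k + l + k - l) = c + (ins False l + - c - ins False l)"
        using sc l kl ins(3)[OF l, of False]
        by (intro ins_unique) (simp_all add: group_add_norm del: add_uminus_conv_diff)
      ultimately show "ins False (- k + l + k - l) \<in> N" by simp
    qed
    then have "brK \<subseteq> down (down (down N))" by (intro brK_subset_of_commutators nsub_down N)
    then have "brK_level 3 \<subseteq> N"
      by (simp add: eval_nat_numeral N nsub_down prod2_subset_of_down)
    then show ?thesis by blast
  next
    case False
    then obtain x where x: "\<not> cong n (sec g x) 0" using Suc.prems(3) by auto
    have "sec g x + k - sec g x - k \<in> down N" if k: "k \<in> brK" for k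
    proof (rule down_memI[OF N])
      have "sec g x + k - sec g x \<in> brK" using nsub_conj[OF nsub_brK k] .
      then show kk: "sec g x + k - sec g x - k \<in> brK" using k nsub_minus[OF nsub_brK] by blast
      have "ins x (sec g x + k - sec g x - k) = g + ins x k - g - ins x k"
        using k kk False by (intro ins_unique) simp_all
      then show "ins x (sec g x + k - sec g x - k) \<in> N" using Suc.prems(2) k by simp
    qed
    then obtain m where "brK_level m \<subseteq> down N" using Suc.IH[OF nsub_down[OF N] _ x] by blast
    then have "brK_level (Suc m) \<subseteq> N" using prod2_subset_of_down[OF N] by simp
    then show ?thesis by blast
  qed
qed simp

text \<open>The map \<open>ins False\<close> sends \<open>K\<close> injectively into itself and
  misses \<open>gt\<close>, whose section at \<open>True\<close> is not trivial.\<close>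

lemma infinite_brK: "infinite brK"
proof
  assume fin: "finite brK"
  have "inj_on (ins False) brK" by (metis inj_onI sec_ins(1))
  moreover have "ins False ` brK \<subseteq> brK" by auto
  ultimately have "ins False ` brK = brK" using fin endo_inj_surj by blast
  then obtain k where k: "k \<in> brK" "gt = ins False k" using gt_mem by blast
  then have "sec gt True = 0" using sec_ins(2)[of k False] by simp
  moreover have "swp (sec gt True)" by simp
  ultimately show False by simp
qed

lemma fin_index_nonzero:
  fixes L :: "grig set"
  assumes "nsub L" "fin_index L" shows "\<exists>g\<in>L. g \<noteq> 0"
proof (rule ccontr)
  assume "\<not> ?thesis"
  then have "inj (coset_rep L)" using coset_rep_eqD[OF assms(1)]
    by (metis injI eq_neg_iff_add_eq_0 neg_eq_iff_add_eq_0 minus_minus)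
  then have "finite (UNIV :: grig set)" using finite_range_coset_rep[OF assms] finite_imageD by blast
  then show False using infinite_brK finite_subset[OF subset_UNIV] by metis
qed

theorem fin_index_conj_separates:
  assumes L: "nsub L" "fin_index L" shows "conj_separates L"
proof -
  obtain g where g: "g \<in> L" "g \<noteq> 0" using fin_index_nonzero[OF L] by blast
  then obtain n where n: "\<not> cong n g 0" using cong_all_eq by blast
  have "g + k - g - k \<in> L" for k
  proof -
    have "g + (k + - g - k) \<in> L" using g nsub_plus[OF L(1)] nsub_conj[OF L(1)] nsub_uminus[OF L(1)] by blast
    then show ?thesis by (simp only: group_add_simps)
  qed
  then obtain m where "brK_level m \<subseteq> L" using brK_level_subset[OF L(1) _ n] by blast
  then show ?thesis
    using conj_separates_mono[OF conj_separates_brK_level[of m]] admissible_brK_level[of m] L(1)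
    unfolding admissible_def by blast
qed

lemma level_stabiliser: "nsub {g. cong n g 0}" "fin_index {g. cong n g 0}"
proof -
  have "nsub {g. cong n g 0} \<and> fin_index {g. cong n g 0}"
  proof (induction n)
    case 0
    have "nsub (UNIV :: grig set)" "fin_index (UNIV :: grig set)"
      unfolding nsub_def fin_index_def by auto
    then show ?case by simp
  next
    case (Suc n)
    have "{g. cong (Suc n) g 0} = prod2 {g. cong n g 0}" by (auto simp: prod2_def)
    then show ?case using Suc nsub_prod2 fin_index_prod2 by metis
  qed
  then show "nsub {g. cong n g 0}" "fin_index {g. cong n g 0}" by auto
qed

section \<open>Conjugacy classes closed in the pro-p topology\<close>

text \<open>If a prime \<open>q\<close> divides the order, some nontrivial element has order
  dividing both \<open>q\<close> and a power of \<open>p\<close>, so \<open>q = p\<close>.\<close>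

lemma order_eq_prime_power:
  assumes Q: "group Q" "finite (carrier Q)" and p: "prime p"
    and pow: "\<And>x. x \<in> carrier Q \<Longrightarrow> \<exists>k. x [^]\<^bsub>Q\<^esub> (p ^ k :: nat) = \<one>\<^bsub>Q\<^esub>"
  shows "\<exists>k. order Q = p ^ k"
proof -
  interpret Q: group Q by fact
  have ord_pos: "order Q \<noteq> 0" using Q by (simp add: Q.order_gt_0_iff_finite)
  have only_p: "q = p" if q: "prime q" "q dvd order Q" for q
  proof -
    \<comment> \<open>Exponent 1 turns Sylow's theorem into Cauchy's; \<open>m\<close> may still be
      divisible by \<open>q\<close>.\<close>
    obtain m where "order Q = q ^ 1 * m" using q(2) by auto
    then obtain S where S: "subgroup S Q" "card S = q"
      using sylow_thm[OF q(1) Q(1)] Q(2) by fastforce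
    have "S \<noteq> {\<one>\<^bsub>Q\<^esub>}" using S(2) q(1) by auto
    then obtain x where x: "x \<in> S" "x \<noteq> \<one>\<^bsub>Q\<^esub>" using subgroup.one_closed[OF S(1)] by blast
    interpret S: group "Q\<lparr>carrier := S\<rparr>" by (rule Q.subgroup_imp_group[OF S(1)])
    have xQ: "x \<in> carrier Q" using x S(1) subgroup.mem_carrier by metis
    have "order (Q\<lparr>carrier := S\<rparr>) = q" using S(2) by (simp add: order_def)
    then have "x [^]\<^bsub>Q\<lparr>carrier := S\<rparr>\<^esub> q = \<one>\<^bsub>Q\<^esub>" using S.pow_order_eq_1[of x] x by simp
    then have "x [^]\<^bsub>Q\<^esub> q = \<one>\<^bsub>Q\<^esub>" by (simp add: Q.nat_pow_consistent[symmetric])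
    then have 1: "Q.ord x dvd q" using Q.pow_eq_id[OF xQ] by blast
    obtain k where "x [^]\<^bsub>Q\<^esub> (p ^ k :: nat) = \<one>\<^bsub>Q\<^esub>" using pow[OF xQ] by blast
    then have 2: "Q.ord x dvd p ^ k" using Q.pow_eq_id[OF xQ] by blast
    have "Q.ord x \<noteq> 1" using x(2) xQ Q.ord_eq_1 by blast
    then have "q dvd p ^ k" using 1 2 q(1) by (metis prime_nat_iff)
    then show "q = p" using q(1) p by (metis prime_dvd_power primes_dvd_imp_eq)
  qed
  obtain k m where km: "order Q = p ^ k * m" "\<not> p dvd m"
    using multiplicity_decompose'[of "order Q" p] ord_pos p by (metis not_prime_unit)
  have "m = 1"
  proof (rule ccontr)
    assume "m \<noteq> 1"
    then obtain q where "prime q" "q dvd m" using prime_factor_nat by blast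
    then show False using only_p[of q] km by auto
  qed
  then show ?thesis using km by auto
qed

text \<open>These are the normal subgroups that are open in the pro-\<open>p\<close>
  topology.\<close>

definition p_open :: "nat \<Rightarrow> ('a, 'b) monoid_scheme \<Rightarrow> 'a set \<Rightarrow> bool" where
  "p_open p H M \<longleftrightarrow> M \<lhd> H \<and> finite_p_group p (H Mod M)"

lemma (in group) rcos_eq_iff:
  assumes "subgroup M G" "x \<in> carrier G" "y \<in> carrier G"
  shows "M #> x = M #> y \<longleftrightarrow> x \<otimes> inv y \<in> M"
proof
  assume "M #> x = M #> y"
  then have "x \<in> M #> y" using rcos_self assms by blast
  then obtain m where m: "m \<in> M" "x = m \<otimes> y" unfolding r_coset_def by blast
  then show "x \<otimes> inv y \<in> M" using assms subgroup.mem_carrier[OF assms(1)] by (simp add: m_assoc)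
next
  assume m: "x \<otimes> inv y \<in> M"
  have "x = (x \<otimes> inv y) \<otimes> y" using assms by (simp add: m_assoc)
  then have "x \<in> M #> y" using m unfolding r_coset_def by blast
  then show "M #> x = M #> y" using repr_independence assms by metis
qed

text \<open>Any invariant \<open>f\<close> with finitely many values that separates cosets bounds
  the index, and \<open>p\<close>-power exponents of the elements make the finite quotient a
  \<open>p\<close>-group.\<close>

lemma p_openI:
  assumes H: "group H" and p: "prime p" and M: "M \<lhd> H"
    and fin: "finite (f ` carrier H)"
    and f: "\<And>x y. x \<in> carrier H \<Longrightarrow> y \<in> carrier H \<Longrightarrow> f x = f y \<Longrightarrow> x \<otimes>\<^bsub>H\<^esub> inv\<^bsub>H\<^esub> y \<in> M"
    and pow: "\<And>x. x \<in> carrier H \<Longrightarrow> \<exists>k. x [^]\<^bsub>H\<^esub> (p ^ k :: nat) \<in> M"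
  shows "p_open p H M"
proof -
  interpret H: group H by fact
  interpret M: normal M H by fact
  have MH: "subgroup M H" by (rule M.subgroup_axioms)
  have "(\<lambda>x. M #>\<^bsub>H\<^esub> x) ` carrier H \<subseteq> (\<lambda>v. M #>\<^bsub>H\<^esub> (SOME x. x \<in> carrier H \<and> f x = v)) ` (f ` carrier H)"
  proof (rule image_subsetI)
    fix x assume x: "x \<in> carrier H"
    define y where "y = (SOME y. y \<in> carrier H \<and> f y = f x)"
    have y: "y \<in> carrier H \<and> f y = f x" unfolding y_def by (rule someI[of _ x]) (simp add: x)
    then have "x \<otimes>\<^bsub>H\<^esub> inv\<^bsub>H\<^esub> y \<in> M" using f[of x y] x by simp
    then have "M #>\<^bsub>H\<^esub> x = M #>\<^bsub>H\<^esub> y" using H.rcos_eq_iff[OF MH x, of y] y by simp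
    then show "M #>\<^bsub>H\<^esub> x \<in> (\<lambda>v. M #>\<^bsub>H\<^esub> (SOME x. x \<in> carrier H \<and> f x = v)) ` (f ` carrier H)"
      using x unfolding y_def by blast
  qed
  then have fin_Q: "finite (carrier (H Mod M))"
    unfolding carrier_FactGroup using fin finite_surj by blast
  have Q: "group (H Mod M)" by (rule M.factorgroup_is_group)
  have "\<exists>k. X [^]\<^bsub>H Mod M\<^esub> (p ^ k :: nat) = \<one>\<^bsub>H Mod M\<^esub>" if X: "X \<in> carrier (H Mod M)" for X
  proof -
    obtain x where x: "x \<in> carrier H" "X = M #>\<^bsub>H\<^esub> x" using X unfolding carrier_FactGroup by blast
    obtain k where k: "x [^]\<^bsub>H\<^esub> (p ^ k :: nat) \<in> M" using pow x by blast
    have "X [^]\<^bsub>H Mod M\<^esub> (p ^ k :: nat) = M #>\<^bsub>H\<^esub> (x [^]\<^bsub>H\<^esub> (p ^ k :: nat))"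
      unfolding x(2) by (rule M.FactGroup_pow[OF x(1)])
    also have "\<dots> = M" using k MH by (simp add: H.coset_join2)
    finally show ?thesis by auto
  qed
  then have "\<exists>k. order (H Mod M) = p ^ k" by (rule order_eq_prime_power[OF Q fin_Q p])
  then show ?thesis unfolding p_open_def finite_p_group_def using M Q fin_Q by blast
qed

lemma p_openD:
  assumes H: "group H" and M: "p_open p H M"
  shows "M \<lhd> H" "subgroup M H" "finite ((\<lambda>x. M #>\<^bsub>H\<^esub> x) ` carrier H)"
    and "\<exists>k. \<forall>x\<in>carrier H. x [^]\<^bsub>H\<^esub> (p ^ k :: nat) \<in> M"
proof -
  interpret H: group H by fact
  show n: "M \<lhd> H" using M by (simp add: p_open_def)
  interpret M: normal M H by fact
  show MH: "subgroup M H" by (rule M.subgroup_axioms)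
  show "finite ((\<lambda>x. M #>\<^bsub>H\<^esub> x) ` carrier H)"
    using M by (simp add: p_open_def finite_p_group_def carrier_FactGroup)
  interpret Q: group "H Mod M" by (rule M.factorgroup_is_group)
  obtain k where k: "order (H Mod M) = p ^ k" using M by (auto simp: p_open_def finite_p_group_def)
  have "x [^]\<^bsub>H\<^esub> (p ^ k :: nat) \<in> M" if x: "x \<in> carrier H" for x
  proof -
    have "M #>\<^bsub>H\<^esub> (x [^]\<^bsub>H\<^esub> (p ^ k :: nat)) = (M #>\<^bsub>H\<^esub> x) [^]\<^bsub>H Mod M\<^esub> (p ^ k :: nat)"
      by (rule M.FactGroup_pow[OF x, symmetric])
    also have "\<dots> = M" using Q.pow_order_eq_1[of "M #>\<^bsub>H\<^esub> x"] x unfolding k by (simp add: carrier_FactGroup)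
    finally show ?thesis using H.coset_join1[OF _ _ MH] M.subset x by simp
  qed
  then show "\<exists>k. \<forall>x\<in>carrier H. x [^]\<^bsub>H\<^esub> (p ^ k :: nat) \<in> M" by blast
qed

lemma p_open_Int:
  assumes H: "group H" and p: "prime p" and M: "p_open p H M" and N: "p_open p H N"
  shows "p_open p H (M \<inter> N)"
proof -
  interpret H: group H by fact
  note M' = p_openD[OF H M] and N' = p_openD[OF H N]
  have MN: "M \<inter> N \<lhd> H"
    using M'(1) N'(1) H.subgroups_Inter_pair unfolding H.normal_inv_iff by blast
  obtain k where k: "\<forall>x\<in>carrier H. x [^]\<^bsub>H\<^esub> (p ^ k :: nat) \<in> M" using M' by blast
  obtain l where l: "\<forall>x\<in>carrier H. x [^]\<^bsub>H\<^esub> (p ^ l :: nat) \<in> N" using N' by blast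
  show ?thesis
  proof (rule p_openI[OF H p MN, where f = "\<lambda>x. (M #>\<^bsub>H\<^esub> x, N #>\<^bsub>H\<^esub> x)"])
    show "finite ((\<lambda>x. (M #>\<^bsub>H\<^esub> x, N #>\<^bsub>H\<^esub> x)) ` carrier H)"
      by (rule finite_subset[OF _ finite_cartesian_product[OF M'(3) N'(3)]]) auto
    show "x \<otimes>\<^bsub>H\<^esub> inv\<^bsub>H\<^esub> y \<in> M \<inter> N"
      if "x \<in> carrier H" "y \<in> carrier H" "(M #>\<^bsub>H\<^esub> x, N #>\<^bsub>H\<^esub> x) = (M #>\<^bsub>H\<^esub> y, N #>\<^bsub>H\<^esub> y)" for x y
      using that H.rcos_eq_iff M'(2) N'(2) by auto
    fix x assume x: "x \<in> carrier H"
    have "x [^]\<^bsub>H\<^esub> (p ^ (k + l) :: nat) = (x [^]\<^bsub>H\<^esub> (p ^ l :: nat)) [^]\<^bsub>H\<^esub> (p ^ k :: nat)"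
      using x by (simp add: H.nat_pow_pow power_add mult.commute)
    moreover have "x [^]\<^bsub>H\<^esub> (p ^ (k + l) :: nat) = (x [^]\<^bsub>H\<^esub> (p ^ k :: nat)) [^]\<^bsub>H\<^esub> (p ^ l :: nat)"
      using x by (simp add: H.nat_pow_pow power_add)
    ultimately show "\<exists>k. x [^]\<^bsub>H\<^esub> (p ^ k :: nat) \<in> M \<inter> N"
      using k l x by (metis H.nat_pow_closed IntI)
  qed
qed

lemma p_open_carrier:
  assumes "group H" "prime p" shows "p_open p H (carrier H)"
proof -
  interpret H: group H by fact
  have "carrier H \<lhd> H" unfolding H.normal_inv_iff using H.subgroup_self by auto
  then show ?thesis by (rule p_openI[OF assms, where f = "\<lambda>_. ()"]) simp_all
qed

lemma p_open_finite_Inter: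
  assumes H: "group H" and p: "prime p" and N: "p_open p H N"
    and R: "finite R" "\<And>r. r \<in> R \<Longrightarrow> p_open p H (M r)"
  shows "\<exists>L. p_open p H L \<and> L \<subseteq> N \<and> (\<forall>r\<in>R. L \<subseteq> M r)"
  using R
proof (induction R rule: finite_induct)
  case empty then show ?case using N by blast
next
  case (insert r R)
  then obtain L where L: "p_open p H L" "L \<subseteq> N" "\<forall>r\<in>R. L \<subseteq> M r" by auto
  have "p_open p H (L \<inter> M r)" using p_open_Int[OF H p L(1)] insert.prems by blast
  then show ?case using L by blast
qed

definition p_conj_closed_by :: "nat \<Rightarrow> ('a, 'b) monoid_scheme \<Rightarrow> 'a set \<Rightarrow> bool" where
  "p_conj_closed_by p H N \<longleftrightarrow> (\<forall>f g. f \<in> carrier H \<longrightarrow> g \<in> carrier H \<longrightarrow>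
     (\<forall>M. p_open p H M \<longrightarrow> (\<exists>h\<in>N. \<exists>u\<in>M. g = h \<otimes>\<^bsub>H\<^esub> f \<otimes>\<^bsub>H\<^esub> inv\<^bsub>H\<^esub> h \<otimes>\<^bsub>H\<^esub> u)) \<longrightarrow>
     (\<exists>h\<in>N. g = h \<otimes>\<^bsub>H\<^esub> f \<otimes>\<^bsub>H\<^esub> inv\<^bsub>H\<^esub> h))"

text \<open>Arbitrarily small \<open>N'\<close> are enough to treat all open subgroups, and in the
  wreath product this permits working with the subgroups \<open>wrN\<close> only.\<close>

definition p_conj_closed :: "nat \<Rightarrow> ('a, 'b) monoid_scheme \<Rightarrow> bool" where
  "p_conj_closed p H \<longleftrightarrow> (\<forall>N. p_open p H N \<longrightarrow> (\<exists>N'\<subseteq>N. p_open p H N' \<and> p_conj_closed_by p H N'))"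

text \<open>
  A conjugacy class of an open subgroup \<open>K \<supseteq> N\<close> is a finite union of conjugates, by coset
  representatives of \<open>N\<close>, of conjugacy classes under \<open>N\<close>.
\<close>

lemma p_conj_separable_of_closed:
  assumes H: "group H" and p: "prime p" and K: "subgroup K H"
    and N: "p_open p H N" and NK: "N \<subseteq> K" and cl: "p_conj_closed_by p H N"
  shows "p_conj_separable p (H\<lparr>carrier := K\<rparr>)"
  unfolding p_conj_separable_def
proof (intro ballI impI)
  interpret H: group H by fact
  let ?K = "H\<lparr>carrier := K\<rparr>"
  fix f g assume "f \<in> carrier ?K" "g \<in> carrier ?K" and nc: "\<not> conjugate_in ?K f g"
  then have fg: "f \<in> K" "g \<in> K" by auto
  have KH: "k \<in> carrier H" if "k \<in> K" for k using that K subgroup.mem_carrier by metis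
  note K_closed = subgroup.m_closed[OF K] subgroup.m_inv_closed[OF K]
  have nconj: "g \<noteq> k \<otimes>\<^bsub>H\<^esub> f \<otimes>\<^bsub>H\<^esub> inv\<^bsub>H\<^esub> k" if "k \<in> K" for k
    using nc that K unfolding conjugate_in_def by (auto simp: H.m_inv_consistent)
  note N' = p_openD[OF H N]
  \<comment> \<open>One representative inside \<open>K\<close> for each coset of \<open>N\<close>
    that meets \<open>K\<close>.\<close>
  define R where "R = (\<lambda>X. SOME r. r \<in> K \<and> N #>\<^bsub>H\<^esub> r = X) ` ((\<lambda>x. N #>\<^bsub>H\<^esub> x) ` K)"
  have finR: "finite R"
    unfolding R_def using finite_subset[OF image_mono[of K "carrier H"] N'(3)] KH by blast
  have R_K: "r \<in> K" if r: "r \<in> R" for r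
  proof -
    obtain x where x: "x \<in> K" "r = (SOME r. r \<in> K \<and> N #>\<^bsub>H\<^esub> r = N #>\<^bsub>H\<^esub> x)" using r unfolding R_def by blast
    have "r \<in> K \<and> N #>\<^bsub>H\<^esub> r = N #>\<^bsub>H\<^esub> x" unfolding x(2) by (rule someI[of _ x]) (simp add: x)
    then show ?thesis ..
  qed
  have R: "\<exists>r\<in>R. k \<otimes>\<^bsub>H\<^esub> inv\<^bsub>H\<^esub> r \<in> N" if k: "k \<in> K" for k
  proof -
    define r where "r = (SOME r. r \<in> K \<and> N #>\<^bsub>H\<^esub> r = N #>\<^bsub>H\<^esub> k)"
    have r: "r \<in> K \<and> N #>\<^bsub>H\<^esub> r = N #>\<^bsub>H\<^esub> k" unfolding r_def by (rule someI[of _ k]) (simp add: k)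
    moreover have "r \<in> R" unfolding R_def r_def using k by blast
    ultimately show ?thesis using H.rcos_eq_iff[OF N'(2), of k r] k KH by auto
  qed
  have "\<exists>M. p_open p H M \<and> (\<forall>h\<in>N. \<forall>u\<in>M. g \<noteq> h \<otimes>\<^bsub>H\<^esub> (r \<otimes>\<^bsub>H\<^esub> f \<otimes>\<^bsub>H\<^esub> inv\<^bsub>H\<^esub> r) \<otimes>\<^bsub>H\<^esub> inv\<^bsub>H\<^esub> h \<otimes>\<^bsub>H\<^esub> u)"
    if r: "r \<in> R" for r
  proof (rule ccontr)
    assume "\<not> ?thesis"
    then have "\<forall>M. p_open p H M \<longrightarrow> (\<exists>h\<in>N. \<exists>u\<in>M. g = h \<otimes>\<^bsub>H\<^esub> (r \<otimes>\<^bsub>H\<^esub> f \<otimes>\<^bsub>H\<^esub> inv\<^bsub>H\<^esub> r) \<otimes>\<^bsub>H\<^esub> inv\<^bsub>H\<^esub> h \<otimes>\<^bsub>H\<^esub> u)"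
      by blast
    moreover have "r \<otimes>\<^bsub>H\<^esub> f \<otimes>\<^bsub>H\<^esub> inv\<^bsub>H\<^esub> r \<in> carrier H" using R_K[OF r] fg KH by simp
    ultimately obtain h where h: "h \<in> N" "g = h \<otimes>\<^bsub>H\<^esub> (r \<otimes>\<^bsub>H\<^esub> f \<otimes>\<^bsub>H\<^esub> inv\<^bsub>H\<^esub> r) \<otimes>\<^bsub>H\<^esub> inv\<^bsub>H\<^esub> h"
      using cl fg KH unfolding p_conj_closed_by_def by blast
    have hr: "h \<in> K" "r \<in> K" using h NK R_K[OF r] by auto
    have "g = (h \<otimes>\<^bsub>H\<^esub> r) \<otimes>\<^bsub>H\<^esub> f \<otimes>\<^bsub>H\<^esub> inv\<^bsub>H\<^esub> (h \<otimes>\<^bsub>H\<^esub> r)"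
      unfolding h(2) using hr fg KH by (simp add: H.m_assoc H.inv_mult_group)
    then show False using nconj hr K_closed by blast
  qed
  then obtain M where M: "\<And>r. r \<in> R \<Longrightarrow> p_open p H (M r)"
    "\<And>r h u. r \<in> R \<Longrightarrow> h \<in> N \<Longrightarrow> u \<in> M r \<Longrightarrow> g \<noteq> h \<otimes>\<^bsub>H\<^esub> (r \<otimes>\<^bsub>H\<^esub> f \<otimes>\<^bsub>H\<^esub> inv\<^bsub>H\<^esub> r) \<otimes>\<^bsub>H\<^esub> inv\<^bsub>H\<^esub> h \<otimes>\<^bsub>H\<^esub> u"
    by metis
  \<comment> \<open>For each \<open>r\<close> the \<open>N\<close>-class of the conjugate of
    \<open>f\<close> by \<open>r\<close> misses a neighbourhood of \<open>g\<close>; as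
    \<open>R\<close> is finite, one \<open>L\<close> serves all of them.\<close>
  obtain L where L: "p_open p H L" "L \<subseteq> N" "\<forall>r\<in>R. L \<subseteq> M r"
    using p_open_finite_Inter[OF H p N finR, of M] M(1) by blast
  note L' = p_openD[OF H L(1)]
  interpret L: normal L H by (rule L'(1))
  define \<pi> where "\<pi> = (\<lambda>x. L #>\<^bsub>H\<^esub> x)"
  interpret Q: group "H Mod L" by (rule L.factorgroup_is_group)
  interpret \<pi>: group_hom H "H Mod L" \<pi>
    unfolding \<pi>_def by unfold_locales (rule L.r_coset_hom_Mod)
  \<comment> \<open>The separating quotient of \<open>K\<close> is its image in
    \<open>H Mod L\<close>, whose order divides a power of \<open>p\<close>.\<close>
  define S where "S = (H Mod L)\<lparr>carrier := \<pi> ` K\<rparr>"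
  have sub: "subgroup (\<pi> ` K) (H Mod L)" by (rule \<pi>.subgroup_img_is_subgroup[OF K])
  have S: "finite_p_group p S"
    unfolding finite_p_group_def
  proof (intro conjI)
    show "group S" unfolding S_def by (rule Q.subgroup_imp_group[OF sub])
    have fin: "finite (carrier (H Mod L))" using L(1) by (simp add: p_open_def finite_p_group_def)
    then show "finite (carrier S)" unfolding S_def using subgroup.subset[OF sub] finite_subset by auto
    obtain k where k: "order (H Mod L) = p ^ k" using L(1) by (auto simp: p_open_def finite_p_group_def)
    have "order S = card (\<pi> ` K)" by (simp add: S_def order_def)
    then have "order S dvd order (H Mod L)"
      using Q.lagrange[OF sub] dvd_triv_right by metis
    then show "\<exists>k. order S = p ^ k" unfolding k using divides_primepow_nat[OF p] by blast
  qed
  have epi: "\<pi> \<in> epi ?K S"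
    unfolding epi_def hom_def S_def using \<pi>.hom_mult KH by auto
  have "\<not> conjugate_in S (\<pi> f) (\<pi> g)"
  proof
    assume "conjugate_in S (\<pi> f) (\<pi> g)"
    then obtain k where k: "k \<in> K" "\<pi> g = \<pi> k \<otimes>\<^bsub>H Mod L\<^esub> \<pi> f \<otimes>\<^bsub>H Mod L\<^esub> inv\<^bsub>S\<^esub> (\<pi> k)"
      unfolding conjugate_in_def S_def by auto
    have "inv\<^bsub>S\<^esub> (\<pi> k) = inv\<^bsub>H Mod L\<^esub> (\<pi> k)" unfolding S_def by (rule Q.m_inv_consistent[OF sub]) (use k in blast)
    then have "\<pi> g = \<pi> (k \<otimes>\<^bsub>H\<^esub> f \<otimes>\<^bsub>H\<^esub> inv\<^bsub>H\<^esub> k)" using k fg KH by simp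
    then have u: "g \<otimes>\<^bsub>H\<^esub> inv\<^bsub>H\<^esub> (k \<otimes>\<^bsub>H\<^esub> f \<otimes>\<^bsub>H\<^esub> inv\<^bsub>H\<^esub> k) \<in> L"
      unfolding \<pi>_def using H.rcos_eq_iff[OF L'(2)] k fg KH by simp
    define e where "e = k \<otimes>\<^bsub>H\<^esub> f \<otimes>\<^bsub>H\<^esub> inv\<^bsub>H\<^esub> k"
    have e: "e \<in> carrier H" unfolding e_def using k fg KH by simp
    have "inv\<^bsub>H\<^esub> e \<otimes>\<^bsub>H\<^esub> (g \<otimes>\<^bsub>H\<^esub> inv\<^bsub>H\<^esub> e) \<otimes>\<^bsub>H\<^esub> e \<in> L"
      using L.inv_op_closed1[OF e] u unfolding e_def[symmetric] by blast
    then have v: "inv\<^bsub>H\<^esub> e \<otimes>\<^bsub>H\<^esub> g \<in> L" using e fg KH by (simp add: H.m_assoc)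
    obtain r where r: "r \<in> R" "k \<otimes>\<^bsub>H\<^esub> inv\<^bsub>H\<^esub> r \<in> N" using R[OF k(1)] by blast
    have rK: "r \<in> carrier H" "k \<in> carrier H" using R_K[OF r(1)] k KH by auto
    have "g = e \<otimes>\<^bsub>H\<^esub> (inv\<^bsub>H\<^esub> e \<otimes>\<^bsub>H\<^esub> g)" using e fg KH by (simp add: H.m_assoc[symmetric])
    then obtain v where v': "v \<in> L" "g = e \<otimes>\<^bsub>H\<^esub> v" using v by blast
    have "e = (k \<otimes>\<^bsub>H\<^esub> inv\<^bsub>H\<^esub> r) \<otimes>\<^bsub>H\<^esub> (r \<otimes>\<^bsub>H\<^esub> f \<otimes>\<^bsub>H\<^esub> inv\<^bsub>H\<^esub> r) \<otimes>\<^bsub>H\<^esub> inv\<^bsub>H\<^esub> (k \<otimes>\<^bsub>H\<^esub> inv\<^bsub>H\<^esub> r)"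
    proof -
      have *: "inv\<^bsub>H\<^esub> r \<otimes>\<^bsub>H\<^esub> (r \<otimes>\<^bsub>H\<^esub> x) = x" if "x \<in> carrier H" for x
        using that rK by (simp add: H.m_assoc[symmetric])
      show ?thesis unfolding e_def using rK fg KH by (simp add: H.m_assoc H.inv_mult_group *)
    qed
    then have "g = (k \<otimes>\<^bsub>H\<^esub> inv\<^bsub>H\<^esub> r) \<otimes>\<^bsub>H\<^esub> (r \<otimes>\<^bsub>H\<^esub> f \<otimes>\<^bsub>H\<^esub> inv\<^bsub>H\<^esub> r) \<otimes>\<^bsub>H\<^esub> inv\<^bsub>H\<^esub> (k \<otimes>\<^bsub>H\<^esub> inv\<^bsub>H\<^esub> r) \<otimes>\<^bsub>H\<^esub> v"
      using v'(2) by (simp only:)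
    moreover have "v \<in> M r" using v'(1) L(3) r(1) by blast
    ultimately show False using M(2)[OF r(1) r(2)] by blast
  qed
  then show "\<exists>(Q :: nat monoid) \<pi>. finite_p_group p Q \<and> \<pi> \<in> epi ?K Q \<and> \<not> conjugate_in Q (\<pi> f) (\<pi> g)"
    using p_separated_by_any_type[OF S epi] fg by auto
qed

theorem p_hereditarily_conj_separable_of_closed:
  assumes H: "group H" and p: "prime p" and cl: "p_conj_closed p H"
  shows "p_hereditarily_conj_separable p H"
proof -
  have *: "p_conj_separable p (H\<lparr>carrier := K\<rparr>)" if K: "subgroup K H" and N: "p_open p H N" "N \<subseteq> K" for K N
  proof -
    obtain N' where "N' \<subseteq> N" "p_open p H N'" "p_conj_closed_by p H N'"
      using cl N(1) unfolding p_conj_closed_def by blast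
    then show ?thesis using p_conj_separable_of_closed[OF H p K, of N'] N(2) by blast
  qed
  have "p_conj_separable p (H\<lparr>carrier := carrier H\<rparr>)"
    by (rule *[OF group.subgroup_self[OF H] p_open_carrier[OF H p] subset_refl])
  then show ?thesis
    unfolding p_hereditarily_conj_separable_def using * unfolding p_open_def by auto
qed

section \<open>Transport along isomorphisms\<close>

lemma p_open_iso_image:
  assumes H: "group H" and W: "group W" and p: "prime p" and iso: "\<theta> \<in> iso H W" and N: "p_open p H N"
  shows "p_open p W (\<theta> ` N)"
proof -
  interpret H: group H by fact
  interpret W: group W by fact
  interpret \<theta>: group_hom H W \<theta>
    using iso by unfold_locales (simp add: iso_def)
  have bij: "bij_betw \<theta> (carrier H) (carrier W)" using iso by (simp add: iso_def)
  note N' = p_openD[OF H N]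
  define \<eta> where "\<eta> = inv_into (carrier H) \<theta>"
  have \<eta>: "\<eta> w \<in> carrier H" "\<theta> (\<eta> w) = w" if "w \<in> carrier W" for w
    using bij that unfolding \<eta>_def by (auto simp: bij_betw_def inv_into_into f_inv_into_f)
  have NH: "x \<in> carrier H" if "x \<in> N" for x using that N'(2) subgroup.mem_carrier by metis
  have "\<theta> ` N \<lhd> W"
    unfolding W.normal_inv_iff
  proof (intro conjI ballI)
    show "subgroup (\<theta> ` N) W" by (rule \<theta>.subgroup_img_is_subgroup[OF N'(2)])
    fix w y assume w: "w \<in> carrier W" and "y \<in> \<theta> ` N"
    then obtain x where x: "x \<in> N" "y = \<theta> x" by blast
    have "w \<otimes>\<^bsub>W\<^esub> y \<otimes>\<^bsub>W\<^esub> inv\<^bsub>W\<^esub> w = \<theta> (\<eta> w \<otimes>\<^bsub>H\<^esub> x \<otimes>\<^bsub>H\<^esub> inv\<^bsub>H\<^esub> \<eta> w)"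
      using \<eta>[OF w] NH[OF x(1)] x(2) by simp
    moreover have "\<eta> w \<otimes>\<^bsub>H\<^esub> x \<otimes>\<^bsub>H\<^esub> inv\<^bsub>H\<^esub> \<eta> w \<in> N"
      using N'(1) \<eta>[OF w] x unfolding H.normal_inv_iff by blast
    ultimately show "w \<otimes>\<^bsub>W\<^esub> y \<otimes>\<^bsub>W\<^esub> inv\<^bsub>W\<^esub> w \<in> \<theta> ` N" by blast
  qed
  then show ?thesis
  proof (rule p_openI[OF W p, where f = "\<lambda>w. N #>\<^bsub>H\<^esub> \<eta> w"])
    show "finite ((\<lambda>w. N #>\<^bsub>H\<^esub> \<eta> w) ` carrier W)"
      by (rule finite_subset[OF _ N'(3)]) (use \<eta> in blast)
    fix x y assume xy: "x \<in> carrier W" "y \<in> carrier W" "N #>\<^bsub>H\<^esub> \<eta> x = N #>\<^bsub>H\<^esub> \<eta> y"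
    then have "\<eta> x \<otimes>\<^bsub>H\<^esub> inv\<^bsub>H\<^esub> \<eta> y \<in> N" using H.rcos_eq_iff[OF N'(2)] \<eta> by blast
    moreover have "\<theta> (\<eta> x \<otimes>\<^bsub>H\<^esub> inv\<^bsub>H\<^esub> \<eta> y) = x \<otimes>\<^bsub>W\<^esub> inv\<^bsub>W\<^esub> y" using xy \<eta> by simp
    ultimately show "x \<otimes>\<^bsub>W\<^esub> inv\<^bsub>W\<^esub> y \<in> \<theta> ` N" by (metis imageI)
  next
    fix x assume x: "x \<in> carrier W"
    obtain k where k: "\<forall>x\<in>carrier H. x [^]\<^bsub>H\<^esub> (p ^ k :: nat) \<in> N" using N'(4) by blast
    have "x [^]\<^bsub>W\<^esub> (p ^ k :: nat) = \<theta> (\<eta> x [^]\<^bsub>H\<^esub> (p ^ k :: nat))"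
      using \<theta>.hom_nat_pow \<eta>[OF x] by simp
    then show "\<exists>k. x [^]\<^bsub>W\<^esub> (p ^ k :: nat) \<in> \<theta> ` N" using k \<eta>[OF x] by blast
  qed
qed

lemma p_conj_closed_iso:
  assumes H: "group H" and W: "group W" and p: "prime p" and iso: "\<theta> \<in> iso H W"
    and cl: "p_conj_closed p W"
  shows "p_conj_closed p H"
  unfolding p_conj_closed_def
proof (intro allI impI)
  interpret H: group H by fact
  interpret W: group W by fact
  interpret \<theta>: group_hom H W \<theta>
    using iso by unfold_locales (simp add: iso_def)
  define \<eta> where "\<eta> = inv_into (carrier H) \<theta>"
  have inj: "inj_on \<theta> (carrier H)" using iso by (simp add: iso_def bij_betw_def)
  have iso': "\<eta> \<in> iso W H" unfolding \<eta>_def by (rule H.iso_set_sym[OF iso])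
  have \<eta>: "\<eta> w \<in> carrier H" "\<theta> (\<eta> w) = w" if "w \<in> carrier W" for w
    using iso that unfolding \<eta>_def by (auto simp: iso_def bij_betw_def inv_into_into f_inv_into_f)
  have \<eta>\<theta>: "\<eta> (\<theta> x) = x" if "x \<in> carrier H" for x
    using inj that unfolding \<eta>_def by simp
  have openW: "x \<in> carrier W" if "p_open p W M" "x \<in> M" for x M
    using p_openD(2)[OF W that(1)] that(2) subgroup.mem_carrier by metis
  have openH: "x \<in> carrier H" if "p_open p H M" "x \<in> M" for x M
    using p_openD(2)[OF H that(1)] that(2) subgroup.mem_carrier by metis
  fix N assume N: "p_open p H N"
  obtain L where L: "L \<subseteq> \<theta> ` N" "p_open p W L" "p_conj_closed_by p W L"
    using cl p_open_iso_image[OF H W p iso N] unfolding p_conj_closed_def by blast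
  show "\<exists>N'\<subseteq>N. p_open p H N' \<and> p_conj_closed_by p H N'"
  proof (intro exI[of _ "\<eta> ` L"] conjI)
    show "\<eta> ` L \<subseteq> N"
    proof
      fix y assume "y \<in> \<eta> ` L"
      then obtain n where "n \<in> N" "y = \<eta> (\<theta> n)" using L(1) by blast
      then show "y \<in> N" using \<eta>\<theta> openH[OF N] by simp
    qed
    show "p_open p H (\<eta> ` L)" by (rule p_open_iso_image[OF W H p iso' L(2)])
    show "p_conj_closed_by p H (\<eta> ` L)"
      unfolding p_conj_closed_by_def
    proof (intro allI impI)
      fix f g
      assume fg: "f \<in> carrier H" "g \<in> carrier H"
        and appr: "\<forall>M. p_open p H M \<longrightarrow>
          (\<exists>h\<in>\<eta> ` L. \<exists>u\<in>M. g = h \<otimes>\<^bsub>H\<^esub> f \<otimes>\<^bsub>H\<^esub> inv\<^bsub>H\<^esub> h \<otimes>\<^bsub>H\<^esub> u)"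
      have "\<exists>h\<in>L. \<exists>u\<in>M. \<theta> g = h \<otimes>\<^bsub>W\<^esub> \<theta> f \<otimes>\<^bsub>W\<^esub> inv\<^bsub>W\<^esub> h \<otimes>\<^bsub>W\<^esub> u" if M: "p_open p W M" for M
      proof -
        have "p_open p H (\<eta> ` M)" by (rule p_open_iso_image[OF W H p iso' M])
        then obtain h u where hu: "h \<in> L" "u \<in> M" "g = \<eta> h \<otimes>\<^bsub>H\<^esub> f \<otimes>\<^bsub>H\<^esub> inv\<^bsub>H\<^esub> \<eta> h \<otimes>\<^bsub>H\<^esub> \<eta> u"
          using appr by blast
        have "\<theta> g = h \<otimes>\<^bsub>W\<^esub> \<theta> f \<otimes>\<^bsub>W\<^esub> inv\<^bsub>W\<^esub> h \<otimes>\<^bsub>W\<^esub> u"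
          unfolding hu(3) using \<eta>[OF openW[OF M hu(2)]] \<eta>[OF openW[OF L(2) hu(1)]] fg by simp
        then show ?thesis using hu by blast
      qed
      then have "\<exists>h\<in>L. \<theta> g = h \<otimes>\<^bsub>W\<^esub> \<theta> f \<otimes>\<^bsub>W\<^esub> inv\<^bsub>W\<^esub> h"
        by (rule L(3)[unfolded p_conj_closed_by_def, rule_format, OF \<theta>.hom_closed[OF fg(1)] \<theta>.hom_closed[OF fg(2)]])
      then obtain h where h: "h \<in> L" "\<theta> g = h \<otimes>\<^bsub>W\<^esub> \<theta> f \<otimes>\<^bsub>W\<^esub> inv\<^bsub>W\<^esub> h" by blast
      note \<eta>h = \<eta>[OF openW[OF L(2) h(1)]]
      have "\<theta> g = \<theta> (\<eta> h \<otimes>\<^bsub>H\<^esub> f \<otimes>\<^bsub>H\<^esub> inv\<^bsub>H\<^esub> \<eta> h)" using h \<eta>h fg by simp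
      then have "g = \<eta> h \<otimes>\<^bsub>H\<^esub> f \<otimes>\<^bsub>H\<^esub> inv\<^bsub>H\<^esub> \<eta> h"
        by (rule inj_onD[OF inj]) (use fg \<eta>h in simp_all)
      then show "\<exists>h\<in>\<eta> ` L. g = h \<otimes>\<^bsub>H\<^esub> f \<otimes>\<^bsub>H\<^esub> inv\<^bsub>H\<^esub> h" using h(1) by blast
    qed
  qed
qed

section \<open>Finitely supported functions on a group\<close>

lemma nsub_cong_refl: "nsub L \<Longrightarrow> - x + x \<in> L"
  by (simp add: nsub_zero left_minus)

lemma nsub_cong_sym:
  assumes L: "nsub L" and xy: "- x + y \<in> L" shows "- y + x \<in> L"
  using nsub_uminus[OF L xy] by (simp only: group_add_simps)

lemma nsub_cong_trans:
  assumes L: "nsub L" and xy: "- x + y \<in> L" and yz: "- y + z \<in> L" shows "- x + z \<in> L"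
  using nsub_plus[OF L xy yz] by (simp only: group_add_simps)

lemma nsub_cong_plus:
  assumes L: "nsub L" and xy: "- x + x' \<in> L" "- y + y' \<in> L" shows "- (x + y) + (x' + y') \<in> L"
proof -
  have "(- y + (- x + x') - - y) + (- y + y') \<in> L"
    using nsub_plus[OF L nsub_conj[OF L xy(1)] xy(2)] .
  then show ?thesis by (simp only: group_add_simps)
qed

lemma nsub_cong_uminus:
  assumes L: "nsub L" and xy: "- x + x' \<in> L" shows "- (- x) + - x' \<in> L"
proof -
  have "x + - (- x + x') - x \<in> L" using nsub_conj[OF L nsub_uminus[OF L xy]] .
  then show ?thesis by (simp only: group_add_simps)
qed

lemma nsub_cong_npow:
  assumes L: "nsub L" and xy: "- x + y \<in> L" shows "- npow n x + npow n y \<in> L"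
  by (induction n) (simp_all only: npow.simps nsub_cong_plus[OF L xy] nsub_cong_refl[OF L])

lemma nsub_cong_left:
  assumes "- (z + x) + (z + y) \<in> L" shows "- x + (y :: 'g :: group_add) \<in> L"
  using assms by (simp only: group_add_simps)

text \<open>Restricting to the support keeps the sum finite over infinite \<open>S\<close>, such as
  cosets, when \<phi> has finite support.\<close>

definition csum :: "'g set \<Rightarrow> ('g \<Rightarrow> 'v :: ab_group_add) \<Rightarrow> 'v" where
  "csum S \<phi> = (\<Sum>y\<in>{y \<in> S. \<phi> y \<noteq> 0}. \<phi> y)"

lemma csum_eq:
  assumes "finite F" "{y. \<phi> y \<noteq> 0} \<subseteq> F" shows "csum S \<phi> = (\<Sum>y\<in>F \<inter> S. \<phi> y)"
  unfolding csum_def by (rule sum.mono_neutral_left) (use assms in auto)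

lemma csum_zero [simp]: "csum S 0 = 0"
  unfolding csum_def by (rule sum.neutral) simp

lemma csum_add:
  assumes "finite {y. \<phi> y \<noteq> 0}" "finite {y. \<psi> y \<noteq> 0}"
  shows "csum S (\<phi> + \<psi>) = csum S \<phi> + csum S \<psi>"
proof -
  let ?F = "{y. \<phi> y \<noteq> 0} \<union> {y. \<psi> y \<noteq> 0}"
  have F: "finite ?F" using assms by simp
  have "csum S (\<phi> + \<psi>) = (\<Sum>y\<in>?F \<inter> S. (\<phi> + \<psi>) y)" by (rule csum_eq[OF F]) auto
  also have "\<dots> = csum S \<phi> + csum S \<psi>"
    using csum_eq[OF F, of \<phi> S] csum_eq[OF F, of \<psi> S] by (auto simp: sum.distrib)
  finally show ?thesis .
qed

lemma csum_uminus: "csum S (- \<phi>) = - csum S \<phi>"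
  unfolding csum_def by (simp add: sum_negf)

lemma csum_diff:
  assumes "finite {y. \<phi> y \<noteq> 0}" "finite {y. \<psi> y \<noteq> 0}"
  shows "csum S (\<phi> - \<psi>) = csum S \<phi> - csum S \<psi>"
proof -
  have "csum S (\<phi> + - \<psi>) = csum S \<phi> + csum S (- \<psi>)" by (rule csum_add) (use assms in simp_all)
  then show ?thesis by (simp add: csum_uminus)
qed

lemma csum_mem:
  assumes "finite {y. \<phi> y \<noteq> 0}" "0 \<in> V" "\<And>v w. v \<in> V \<Longrightarrow> w \<in> V \<Longrightarrow> v + w \<in> V" "\<And>y. \<phi> y \<in> V"
  shows "csum S \<phi> \<in> V"
proof -
  have "finite A \<Longrightarrow> (\<Sum>y\<in>A. \<phi> y) \<in> V" for A
    by (induction A rule: finite_induct) (use assms in auto)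
  moreover have "finite {y \<in> S. \<phi> y \<noteq> 0}" by (rule finite_subset[OF _ assms(1)]) auto
  ultimately show ?thesis unfolding csum_def by blast
qed

lemma csum_single:
  assumes "{y \<in> S. \<phi> y \<noteq> 0} \<subseteq> {r}" "r \<in> S" shows "csum S \<phi> = \<phi> r"
proof (cases "\<phi> r = 0")
  case True
  then have "{y \<in> S. \<phi> y \<noteq> 0} = {}" using assms by auto
  then show ?thesis unfolding csum_def using True by simp
next
  case False
  then have "{y \<in> S. \<phi> y \<noteq> 0} = {r}" using assms by auto
  then show ?thesis unfolding csum_def by simp
qed

lemma csum_cong_set:
  assumes "\<And>y. \<phi> y \<noteq> 0 \<Longrightarrow> y \<in> S \<longleftrightarrow> y \<in> S'" shows "csum S \<phi> = csum S' \<phi>"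
proof -
  have "{y \<in> S. \<phi> y \<noteq> 0} = {y \<in> S'. \<phi> y \<noteq> 0}" using assms by auto
  then show ?thesis unfolding csum_def by simp
qed

definition lsh :: "'g :: group_add \<Rightarrow> ('g \<Rightarrow> 'v) \<Rightarrow> 'g \<Rightarrow> 'v" where
  "lsh x \<phi> = (\<lambda>y. \<phi> (- x + y))"

lemma lsh_add [simp]: "lsh x (\<phi> + \<psi>) = lsh x \<phi> + lsh x \<psi>"
  and lsh_diff [simp]: "lsh x (\<alpha> - \<beta>) = lsh x \<alpha> - lsh x \<beta>"
  and lsh_uminus [simp]: "lsh x (- \<gamma>) = - lsh x \<gamma>"
  and lsh_zero [simp]: "lsh x 0 = 0"
  by (auto simp: lsh_def fun_eq_iff)

lemma lsh_lsh: "lsh x (lsh y \<phi>) = lsh (x + y) \<phi>"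
  by (simp add: lsh_def group_add_norm del: add_uminus_conv_diff)

lemma lsh_0 [simp]: "lsh 0 \<phi> = \<phi>"
  by (simp add: lsh_def)

lemma csum_lsh: "csum S (lsh x \<phi>) = csum {u. x + u \<in> S} (\<phi> :: 'g :: group_add \<Rightarrow> 'v :: ab_group_add)"
  unfolding csum_def
proof (rule sum.reindex_bij_witness[of _ "\<lambda>u. x + u" "\<lambda>u. - x + u"])
qed (auto simp: lsh_def)

definition coset :: "'g :: group_add set \<Rightarrow> 'g \<Rightarrow> 'g set" where
  "coset L g = {y. - g + y \<in> L}"

lemma coset_eq:
  assumes L: "nsub L" and "- g + h \<in> L" shows "coset L g = coset L h"
  using nsub_cong_trans[OF L] nsub_cong_sym[OF L] assms(2) unfolding coset_def by blast

lemma csum_coset_lsh: "csum (coset L g) (lsh x \<phi>) = csum (coset L (- x + g)) \<phi>"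
  unfolding csum_lsh coset_def by (simp only: mem_Collect_eq group_add_simps)

lemma sum_fun_apply: "(\<Sum>y\<in>A. f y) r = (\<Sum>y\<in>A. f y r)"
  by (induction A rule: infinite_finite_induct) simp_all

definition single :: "'g \<Rightarrow> 'v \<Rightarrow> 'g \<Rightarrow> 'v :: zero" where
  "single y v = (\<lambda>z. if z = y then v else 0)"

lemma lsh_single: "lsh x (single y v) = single (x + y) (v :: 'v :: zero)"
proof
  fix z
  have "- x + z = y \<longleftrightarrow> z = x + y" by auto
  then show "lsh x (single y v) z = single (x + y) v z" by (simp add: lsh_def single_def)
qed

text \<open>The subtracted function is the push-forward of \<phi> along \<tau>, so the difference is
  a sum of transports of single values. It is used with \<tau> choosing a point in each orbit and
  with \<tau> choosing a point in each coset; only single transports then have to be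
  examined.\<close>

lemma push_forward_decomposition:
  fixes \<phi> :: "'g \<Rightarrow> 'v :: ab_group_add"
  assumes fin: "finite {y. \<phi> y \<noteq> 0}"
  shows "\<phi> - (\<lambda>r. csum {y. \<tau> y = r} \<phi>) = (\<Sum>y\<in>{y. \<phi> y \<noteq> 0}. single y (\<phi> y) - single (\<tau> y) (\<phi> y))"
proof
  fix r
  let ?F = "{y. \<phi> y \<noteq> 0}"
  have "csum {y. \<tau> y = r} \<phi> = (\<Sum>y\<in>?F \<inter> {y. \<tau> y = r}. \<phi> y)" by (rule csum_eq[OF fin]) simp
  also have "\<dots> = (\<Sum>y\<in>?F. if y \<in> {y. \<tau> y = r} then \<phi> y else 0)"
    by (rule sum.inter_restrict[OF fin])
  also have "\<dots> = (\<Sum>y\<in>?F. single (\<tau> y) (\<phi> y) r)"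
    by (rule sum.cong) (auto simp: single_def)
  finally have 1: "csum {y. \<tau> y = r} \<phi> = (\<Sum>y\<in>?F. single (\<tau> y) (\<phi> y) r)" .
  have "(\<Sum>y\<in>?F. single y (\<phi> y) r) = (\<Sum>y\<in>?F. if r = y then \<phi> y else 0)"
    by (simp add: single_def)
  also have "\<dots> = \<phi> r" using fin by simp
  finally have 2: "(\<Sum>y\<in>?F. single y (\<phi> y) r) = \<phi> r" .
  have "(\<Sum>y\<in>?F. single y (\<phi> y) - single (\<tau> y) (\<phi> y)) r = (\<Sum>y\<in>?F. single y (\<phi> y) r - single (\<tau> y) (\<phi> y) r)"
    unfolding sum_fun_apply by simp
  also have "\<dots> = \<phi> r - csum {y. \<tau> y = r} \<phi>" unfolding sum_subtractf 1 2 ..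
  finally show "(\<phi> - (\<lambda>r. csum {y. \<tau> y = r} \<phi>)) r = (\<Sum>y\<in>?F. single y (\<phi> y) - single (\<tau> y) (\<phi> y)) r"
    by simp
qed

lemma push_forward_mem:
  fixes \<phi> :: "'g \<Rightarrow> 'v :: ab_group_add"
  assumes fin: "finite {y. \<phi> y \<noteq> 0}" and "0 \<in> B" "\<And>\<alpha> \<beta>. \<alpha> \<in> B \<Longrightarrow> \<beta> \<in> B \<Longrightarrow> \<alpha> + \<beta> \<in> B"
    and "\<And>y. single y (\<phi> y) - single (\<tau> y) (\<phi> y) \<in> B"
  shows "\<phi> - (\<lambda>r. csum {y. \<tau> y = r} \<phi>) \<in> B"
proof -
  have "(\<Sum>y\<in>A. single y (\<phi> y) - single (\<tau> y) (\<phi> y)) \<in> B" if "finite A" for A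
    using that
  proof (induction A rule: finite_induct)
    case empty show ?case unfolding sum.empty by (rule assms(2))
  next
    case (insert y A) show ?case unfolding sum.insert[OF insert(1,2)] by (rule assms(3)[OF assms(4) insert(3)])
  qed
  then show ?thesis unfolding push_forward_decomposition[OF fin] using fin by blast
qed

section \<open>Integer vectors, divisibility by powers of 2, and the base group\<close>

definition zvec :: "nat \<Rightarrow> (nat \<Rightarrow> int) set" where
  "zvec m = {v. \<forall>i\<ge>m. v i = 0}"

definition dyadic :: "nat \<Rightarrow> (nat \<Rightarrow> int) set" where
  "dyadic e = {v. \<forall>i. 2 ^ e dvd v i}"

lemma zvec_closed: "0 \<in> zvec m" "v \<in> zvec m \<Longrightarrow> w \<in> zvec m \<Longrightarrow> v + w \<in> zvec m"
  "v \<in> zvec m \<Longrightarrow> w \<in> zvec m \<Longrightarrow> v - w \<in> zvec m" "v \<in> zvec m \<Longrightarrow> - v \<in> zvec m"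
  by (auto simp: zvec_def)

lemma dyadic_closed: "0 \<in> dyadic e" "v \<in> dyadic e \<Longrightarrow> w \<in> dyadic e \<Longrightarrow> v + w \<in> dyadic e"
  "v \<in> dyadic e \<Longrightarrow> w \<in> dyadic e \<Longrightarrow> v - w \<in> dyadic e" "v \<in> dyadic e \<Longrightarrow> - v \<in> dyadic e"
  by (auto simp: dyadic_def)

lemma dyadic_antimono: "e \<le> e' \<Longrightarrow> dyadic e' \<subseteq> dyadic e"
  unfolding dyadic_def using le_imp_power_dvd dvd_trans by blast

text \<open>A nonzero coordinate \<open>n\<close> is not divisible by 2 to the power
  \<open>\<bar>n\<bar>\<close>, which exceeds \<open>\<bar>n\<bar>\<close>.\<close>

lemma ex_not_dyadic:
  assumes "v \<noteq> 0" shows "\<exists>e. v \<notin> dyadic e"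
proof -
  obtain i where i: "v i \<noteq> 0" using assms by (auto simp: fun_eq_iff)
  have "int (nat \<bar>v i\<bar>) < int (2 ^ nat \<bar>v i\<bar>)" by (simp only: of_nat_less_iff less_exp)
  then have "\<bar>v i\<bar> < 2 ^ nat \<bar>v i\<bar>" by simp
  then have "\<not> 2 ^ nat \<bar>v i\<bar> dvd v i" using i zdvd_not_zless[of "\<bar>v i\<bar>"] by auto
  then show ?thesis unfolding dyadic_def by blast
qed

lemma ex_dyadic_separating:
  assumes "finite S" shows "\<exists>e'\<ge>e. \<forall>v\<in>S. v \<in> dyadic e' \<longrightarrow> v = 0"
  using assms
proof (induction S rule: finite_induct)
  case empty then show ?case by blast
next
  case (insert v S)
  then obtain e1 where e1: "e1 \<ge> e" "\<forall>v\<in>S. v \<in> dyadic e1 \<longrightarrow> v = 0" by blast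
  obtain e2 where e2: "v \<noteq> 0 \<longrightarrow> v \<notin> dyadic e2" using ex_not_dyadic by blast
  have "dyadic (max e1 e2) \<subseteq> dyadic e1" "dyadic (max e1 e2) \<subseteq> dyadic e2"
    by (auto intro!: dyadic_antimono)
  then have "\<forall>w\<in>insert v S. w \<in> dyadic (max e1 e2) \<longrightarrow> w = 0" using e1 e2 by blast
  moreover have "max e1 e2 \<ge> e" using e1(1) by simp
  ultimately show ?case by blast
qed

definition fs :: "nat \<Rightarrow> ('g \<Rightarrow> nat \<Rightarrow> int) set" where
  "fs m = {\<phi>. finite {y. \<phi> y \<noteq> 0} \<and> (\<forall>y. \<phi> y \<in> zvec m)}"

lemma fs_finite: "\<phi> \<in> fs m \<Longrightarrow> finite {y. \<phi> y \<noteq> 0}"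
  and fs_zvec: "\<phi> \<in> fs m \<Longrightarrow> \<phi> y \<in> zvec m"
  by (auto simp: fs_def)

lemma fs_zero: "0 \<in> fs m"
  by (simp add: fs_def zvec_closed)

lemma fs_add: "\<phi> \<in> fs m \<Longrightarrow> \<psi> \<in> fs m \<Longrightarrow> \<phi> + \<psi> \<in> fs m"
proof -
  assume *: "\<phi> \<in> fs m" "\<psi> \<in> fs m"
  have "finite {y. (\<phi> + \<psi>) y \<noteq> 0}"
    by (rule finite_subset[OF _ finite_UnI[OF fs_finite[OF *(1)] fs_finite[OF *(2)]]]) auto
  then show ?thesis using * zvec_closed by (simp add: fs_def)
qed

lemma fs_uminus: "\<phi> \<in> fs m \<Longrightarrow> - \<phi> \<in> fs m"
  by (simp add: fs_def zvec_closed)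

lemma fs_diff: "\<phi> \<in> fs m \<Longrightarrow> \<psi> \<in> fs m \<Longrightarrow> \<phi> - \<psi> \<in> fs m"
  using fs_add[of \<phi> m "- \<psi>"] fs_uminus[of \<psi> m] by simp

lemma fs_lsh: "\<phi> \<in> fs m \<Longrightarrow> lsh (x :: 'g :: group_add) \<phi> \<in> fs m"
proof -
  assume *: "\<phi> \<in> fs m"
  have "{y. lsh x \<phi> y \<noteq> 0} \<subseteq> (\<lambda>y. x + y) ` {y. \<phi> y \<noteq> 0}"
  proof
    fix y assume "y \<in> {y. lsh x \<phi> y \<noteq> 0}"
    then have "- x + y \<in> {y. \<phi> y \<noteq> 0}" by (simp add: lsh_def)
    then have "x + (- x + y) \<in> (\<lambda>y. x + y) ` {y. \<phi> y \<noteq> 0}" by (rule imageI)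
    then show "y \<in> (\<lambda>y. x + y) ` {y. \<phi> y \<noteq> 0}" by simp
  qed
  then have "finite {y. lsh x \<phi> y \<noteq> 0}" using fs_finite[OF *] finite_surj by blast
  then show ?thesis using * by (simp add: fs_def lsh_def)
qed

lemma fs_single: "v \<in> zvec m \<Longrightarrow> single y v \<in> fs m"
  unfolding fs_def single_def by (auto simp: zvec_closed)

lemma fs_push: 
  assumes \<phi>: "\<phi> \<in> fs m" shows "(\<lambda>r. csum {y. \<tau> y = r} \<phi>) \<in> fs m"
proof -
  have "csum {y. \<tau> y = r} \<phi> = 0" if "r \<notin> \<tau> ` {y. \<phi> y \<noteq> 0}" for r
  proof -
    have "{y \<in> {y. \<tau> y = r}. \<phi> y \<noteq> 0} = {}" using that by auto
    then show ?thesis unfolding csum_def by simp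
  qed
  then have "{r. csum {y. \<tau> y = r} \<phi> \<noteq> 0} \<subseteq> \<tau> ` {y. \<phi> y \<noteq> 0}" by blast
  then have "finite {r. csum {y. \<tau> y = r} \<phi> \<noteq> 0}" using fs_finite[OF \<phi>] finite_surj by blast
  moreover have "csum S \<phi> \<in> zvec m" for S
    by (rule csum_mem[OF fs_finite[OF \<phi>] zvec_closed(1,2) fs_zvec[OF \<phi>]])
  ultimately show ?thesis unfolding fs_def by simp
qed

text \<open>Coset sums modulo \<open>2 ^ e\<close> define a map from the finitely supported
  functions on the group with values in \<open>\<int>\<^sup>m\<close> to functions on the quotient
  by \<open>L\<close> with values modulo \<open>2 ^ e\<close>. This is its kernel.\<close>

definition cdiv :: "nat \<Rightarrow> 'g :: group_add set \<Rightarrow> nat \<Rightarrow> ('g \<Rightarrow> nat \<Rightarrow> int) set" where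
  "cdiv m L e = {\<phi> \<in> fs m. \<forall>g. csum (coset L g) \<phi> \<in> dyadic e}"

lemma cdiv_fs: "\<phi> \<in> cdiv m L e \<Longrightarrow> \<phi> \<in> fs m"
  by (simp add: cdiv_def)

lemma cdiv_zero: "0 \<in> cdiv m L e"
  by (simp add: cdiv_def fs_zero dyadic_closed)

lemma cdiv_add: "\<phi> \<in> cdiv m L e \<Longrightarrow> \<psi> \<in> cdiv m L e \<Longrightarrow> \<phi> + \<psi> \<in> cdiv m L e"
  unfolding cdiv_def
proof (intro CollectI conjI allI)
  assume *: "\<phi> \<in> {\<phi> \<in> fs m. \<forall>g. csum (coset L g) \<phi> \<in> dyadic e}"
    "\<psi> \<in> {\<phi> \<in> fs m. \<forall>g. csum (coset L g) \<phi> \<in> dyadic e}"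
  then have f: "\<phi> \<in> fs m" "\<psi> \<in> fs m" by blast+
  then show "\<phi> + \<psi> \<in> fs m" by (rule fs_add)
  show "csum (coset L g) (\<phi> + \<psi>) \<in> dyadic e" for g
    unfolding csum_add[OF fs_finite[OF f(1)] fs_finite[OF f(2)]] using * dyadic_closed(2) by blast
qed

lemma cdiv_uminus: "\<phi> \<in> cdiv m L e \<Longrightarrow> - \<phi> \<in> cdiv m L e"
  unfolding cdiv_def by (simp add: fs_uminus csum_uminus dyadic_closed)

lemma cdiv_lsh: "\<phi> \<in> cdiv m L e \<Longrightarrow> lsh x \<phi> \<in> cdiv m L e"
  unfolding cdiv_def by (simp add: fs_lsh csum_coset_lsh)

text \<open>Congruent elements shift each coset of \<open>L\<close> to the same coset, so the coset
  sums of the difference vanish exactly, whatever \<open>e\<close> is.\<close>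

lemma lsh_cong_cdiv:
  assumes L: "nsub L" and xy: "- x + y \<in> L" and \<phi>: "\<phi> \<in> fs m"
  shows "lsh x \<phi> - lsh y \<phi> \<in> cdiv m L e"
proof -
  have "csum (coset L g) (lsh x \<phi> - lsh y \<phi>) = 0" for g
  proof -
    have "- (- x + g) + (- y + g) \<in> L"
      using nsub_cong_plus[OF L nsub_cong_uminus[OF L xy] nsub_cong_refl[OF L, of g]] .
    then have "coset L (- x + g) = coset L (- y + g)" by (rule coset_eq[OF L])
    then show ?thesis
      using csum_diff[OF fs_finite[OF fs_lsh[OF \<phi>, of x]] fs_finite[OF fs_lsh[OF \<phi>, of y]]]
      by (simp add: csum_coset_lsh)
  qed
  then show ?thesis using \<phi> by (simp add: cdiv_def fs_diff fs_lsh dyadic_closed)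
qed

text \<open>Sorting the support by cosets splits the sum into full coset sums.\<close>

lemma csum_saturated:
  assumes L: "nsub L" and \<phi>: "\<phi> \<in> cdiv m L e" and S: "\<And>u v. u \<in> S \<Longrightarrow> - u + v \<in> L \<Longrightarrow> v \<in> S"
  shows "csum S \<phi> \<in> dyadic e"
proof -
  let ?F = "{y \<in> S. \<phi> y \<noteq> 0}"
  have fin: "finite ?F" by (rule finite_subset[OF _ fs_finite[OF cdiv_fs[OF \<phi>]]]) auto
  have "csum S \<phi> = (\<Sum>r\<in>coset_rep L ` ?F. \<Sum>y\<in>{y \<in> ?F. coset_rep L y = r}. \<phi> y)"
    unfolding csum_def by (rule sum.image_gen[OF fin])
  moreover have "(\<Sum>y\<in>{y \<in> ?F. coset_rep L y = r}. \<phi> y) \<in> dyadic e" if r: "r \<in> coset_rep L ` ?F" for r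
  proof -
    obtain y0 where y0: "y0 \<in> S" "r = coset_rep L y0" using r by blast
    have iff: "coset_rep L y = r \<longleftrightarrow> - y0 + y \<in> L" for y
      using coset_rep_eqD[OF L, of y y0] coset_rep_cong[OF L, of y0 y] y0(2) by auto
    have "{y \<in> ?F. coset_rep L y = r} = {y \<in> coset L y0. \<phi> y \<noteq> 0}"
      unfolding coset_def iff using S[OF y0(1)] by auto
    then have "(\<Sum>y\<in>{y \<in> ?F. coset_rep L y = r}. \<phi> y) = csum (coset L y0) \<phi>" unfolding csum_def by simp
    then show ?thesis using \<phi> by (simp add: cdiv_def)
  qed
  moreover have "finite A \<Longrightarrow> (\<And>r. r \<in> A \<Longrightarrow> h r \<in> dyadic e) \<Longrightarrow> (\<Sum>r\<in>A. h r) \<in> dyadic e" for A :: "'a set" and h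
    by (induction A rule: finite_induct) (auto simp: dyadic_closed)
  ultimately show ?thesis using fin by simp
qed

lemma cdiv_mono:
  assumes L': "nsub L'" and sub: "L' \<subseteq> L" "nsub L" "e \<le> e'"
  shows "cdiv m L' e' \<subseteq> cdiv m L e"
proof
  fix \<phi> assume \<phi>: "\<phi> \<in> cdiv m L' e'"
  have "csum (coset L g) \<phi> \<in> dyadic e'" for g
  proof (rule csum_saturated[OF L' \<phi>])
    fix u v assume "u \<in> coset L g" "- u + v \<in> L'"
    then show "v \<in> coset L g" using nsub_cong_trans[OF sub(2)] sub(1) unfolding coset_def by blast
  qed
  then show "\<phi> \<in> cdiv m L e" using \<phi> dyadic_antimono[OF sub(3)] unfolding cdiv_def by auto
qed

section \<open>Orbits of an element of finite order\<close>

lemma npow_eq_zero_mult: "npow n x = 0 \<Longrightarrow> npow (j * n) (x :: 'g :: monoid_add) = 0"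
  by (simp add: npow_mult)

lemma npow_uminus_ex:
  assumes "n > 0" "npow n x = 0" shows "\<exists>k. - npow j (x :: 'g :: group_add) = npow k x"
proof -
  have "j + (j * n - j) = j * n" using assms(1) by simp
  then have "npow j x + npow (j * n - j) x = 0"
    using npow_eq_zero_mult[OF assms(2), of j] npow_add[of j "j * n - j" x] by simp
  then show ?thesis using minus_unique by blast
qed

lemma npow_mod:
  assumes "n > 0" "npow n x = 0" shows "\<exists>k<n. npow j (x :: 'g :: group_add) = npow k x"
proof -
  have "npow ((j div n) * n + j mod n) x = npow (j mod n) x"
    by (simp only: npow_add npow_eq_zero_mult[OF assms(2)] add_0_left)
  then show ?thesis using assms(1) by (metis div_mult_mod_eq mod_less_divisor)
qed

text \<open>Exponents \<open>j\<close> are natural numbers; for \<open>x\<close> of finite order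
  this still gives the full orbit, see \<open>orb_sym\<close>.\<close>

definition orb :: "'g :: group_add \<Rightarrow> 'g \<Rightarrow> 'g set" where
  "orb x y = {u. \<exists>j. u = npow j x + y}"

lemma orb_self: "y \<in> orb x y"
  unfolding orb_def by (auto intro: exI[of _ 0])

lemma npow_orb: "npow j x + y \<in> orb x y"
  unfolding orb_def by blast

lemma orb_trans:
  assumes "u \<in> orb x v" "v \<in> orb x w" shows "u \<in> orb x w"
proof -
  obtain i j where "u = npow i x + v" "v = npow j x + w" using assms unfolding orb_def by blast
  then have "u = npow (i + j) x + w" by (simp add: npow_add add.assoc)
  then show ?thesis unfolding orb_def by blast
qed

lemma orb_sym:
  assumes "n > 0" "npow n x = 0" "u \<in> orb x v" shows "v \<in> orb x u"
proof -
  obtain j where j: "u = npow j x + v" using assms unfolding orb_def by blast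
  obtain k where "- npow j x = npow k x" using npow_uminus_ex[OF assms(1,2)] by blast
  then have "v = npow k x + u" unfolding j by (metis minus_add_cancel)
  then show ?thesis unfolding orb_def by blast
qed

text \<open>Transporting a value along an orbit changes a function by a boundary. Collecting all
  values at one point of each orbit therefore leaves, up to boundaries, the function of orbit sums,
  which is zero.\<close>

lemma orbit_sums_zero_imp_boundary:
  fixes x :: "'g :: group_add"
  assumes n: "n > 0" "npow n x = 0" and \<theta>: "\<theta> \<in> fs m" and z: "\<And>y. csum (orb x y) \<theta> = 0"
  shows "\<exists>\<eta>\<in>fs m. \<theta> = \<eta> - lsh x \<eta>"
proof -
  define B where "B = {\<theta>. \<exists>\<eta>\<in>fs m. \<theta> = \<eta> - lsh x \<eta>}"
  define \<tau> where "\<tau> = (\<lambda>y. SOME u. u \<in> orb x y)"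
  have \<tau>: "\<tau> y \<in> orb x y" for y
    unfolding \<tau>_def by (rule someI[where P = "\<lambda>u. u \<in> orb x y"], rule orb_self)
  have \<tau>_eq: "\<tau> u = \<tau> y" if "u \<in> orb x y" for u y
  proof -
    have "w \<in> orb x u \<longleftrightarrow> w \<in> orb x y" for w
      using that orb_trans orb_sym[OF n] by metis
    then show ?thesis unfolding \<tau>_def by simp
  qed
  have B0: "0 \<in> B" unfolding B_def by (rule CollectI, rule bexI[OF _ fs_zero]) simp
  have B_add: "\<alpha> + \<beta> \<in> B" if ab: "\<alpha> \<in> B" "\<beta> \<in> B" for \<alpha> \<beta>
  proof -
    obtain \<eta> \<zeta> where "\<eta> \<in> fs m" "\<zeta> \<in> fs m" "\<alpha> = \<eta> - lsh x \<eta>" "\<beta> = \<zeta> - lsh x \<zeta>"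
      using ab unfolding B_def by blast
    then have "\<eta> + \<zeta> \<in> fs m" "\<alpha> + \<beta> = (\<eta> + \<zeta>) - lsh x (\<eta> + \<zeta>)"
      by (simp_all only: fs_add lsh_add add_diff_add)
    then show ?thesis unfolding B_def by blast
  qed
  \<comment> \<open>One step along the orbit is the boundary of a single value; longer moves
    telescope.\<close>
  have pair: "single y v - single (npow j x + y) v \<in> B" if v: "v \<in> zvec m" for y v j
  proof (induction j)
    case 0
    have "single y v - single (npow 0 x + y) v = 0" by simp
    then show ?case using B0 by (simp only:)
  next
    case (Suc j)
    let ?s = "single (npow j x + y) v"
    have s: "?s - lsh x ?s \<in> B" unfolding B_def by (rule CollectI, rule bexI[OF refl fs_single[OF v]])
    have "a - c = (a - b) + (b - c)" for a b c :: "'g \<Rightarrow> nat \<Rightarrow> int" by (simp only: diff_add_eq_diff_diff_swap add_diff_eq diff_add_cancel)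
    then have "single y v - lsh x ?s = (single y v - ?s) + (?s - lsh x ?s)" .
    then have "single y v - lsh x ?s \<in> B" using B_add[OF Suc s] by (simp only:)
    then show ?case by (simp only: npow.simps lsh_single add.assoc)
  qed
  have "\<theta> - (\<lambda>r. csum {y. \<tau> y = r} \<theta>) \<in> B"
  proof (rule push_forward_mem)
    show "finite {y. \<theta> y \<noteq> 0}" by (rule fs_finite[OF \<theta>])
    show "0 \<in> B" by (rule B0)
    show "\<alpha> + \<beta> \<in> B" if "\<alpha> \<in> B" "\<beta> \<in> B" for \<alpha> \<beta> using that by (rule B_add)
    show "single y (\<theta> y) - single (\<tau> y) (\<theta> y) \<in> B" for y
    proof -
      obtain j where "\<tau> y = npow j x + y" using \<tau>[of y] unfolding orb_def by blast
      then show ?thesis using pair[OF fs_zvec[OF \<theta>], of y y j] by (simp only:)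
    qed
  qed
  moreover have "csum {y. \<tau> y = r} \<theta> = 0" for r
  proof (cases "\<exists>y0. \<tau> y0 = r")
    case True
    then obtain y0 where y0: "\<tau> y0 = r" by blast
    have orb_y0: "y \<in> orb x y0" if "\<tau> y = \<tau> y0" for y
      using \<tau>[of y] \<tau>[of y0] that orb_trans orb_sym[OF n] by metis
    have "{y. \<tau> y = r} = orb x y0"
    proof (rule Set.set_eqI)
      show "y \<in> {y. \<tau> y = r} \<longleftrightarrow> y \<in> orb x y0" for y
        using orb_y0[of y] \<tau>_eq[of y y0] y0 by auto
    qed
    then show ?thesis using z[of y0] by (simp only:)
  next
    case False
    then have "{y. \<tau> y = r} = {}" by auto
    then show ?thesis unfolding csum_def by simp
  qed
  then have "(\<lambda>r. csum {y. \<tau> y = r} \<theta>) = 0" by (intro ext) (simp only: zero_fun_apply)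
  ultimately have "\<theta> \<in> B" by (simp only: diff_0_right)
  then show ?thesis unfolding B_def by blast
qed

text \<open>
  Choose one point in every coset of \<open>L\<close>, equivariantly: this is possible because \<open>\<langle>x\<rangle>\<close>
  acts freely on these cosets.
\<close>

lemma invariant_lift:
  fixes x :: "'g :: group_add"
  assumes n: "n > 0" "npow n x = 0" and L: "nsub L" "fin_index L"
    and free: "\<And>j. npow j x \<in> L \<Longrightarrow> npow j x = 0"
    and \<xi>: "\<xi> \<in> fs m" "\<xi> - lsh x \<xi> \<in> cdiv m L e"
  shows "\<exists>\<beta>\<in>fs m. lsh x \<beta> = \<beta> \<and> \<xi> - \<beta> \<in> cdiv m L e"
proof -
  \<comment> \<open>\<open>R\<close> says that two cosets of \<open>L\<close> lie in the same orbit
    under the powers of \<open>x\<close>.\<close>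
  define R where "R = (\<lambda>y u. \<exists>j. - (npow j x + y) + u \<in> L)"
  have R_refl: "R y y" for y
    unfolding R_def using nsub_cong_refl[OF L(1)] by (intro exI[of _ 0]) simp
  have R_sym: "R u y" if yu: "R y u" for y u
  proof -
    obtain j where j: "- (npow j x + y) + u \<in> L" using yu unfolding R_def by blast
    obtain k where k: "- npow j x = npow k x" using npow_uminus_ex[OF n] by blast
    have "- (npow k x + (npow j x + y)) + (npow k x + u) \<in> L"
      by (rule nsub_cong_plus[OF L(1) nsub_cong_refl[OF L(1)] j])
    then have "- y + (npow k x + u) \<in> L" unfolding k[symmetric] by simp
    then show ?thesis unfolding R_def using nsub_cong_sym[OF L(1)] by blast
  qed
  have R_trans: "R y w" if yuw: "R y u" "R u w" for y u w
  proof -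
    obtain i j where ij: "- (npow i x + y) + u \<in> L" "- (npow j x + u) + w \<in> L" using yuw unfolding R_def by blast
    have "- (npow j x + (npow i x + y)) + (npow j x + u) \<in> L"
      by (rule nsub_cong_plus[OF L(1) nsub_cong_refl[OF L(1)] ij(1)])
    then have "- (npow j x + (npow i x + y)) + w \<in> L" by (rule nsub_cong_trans[OF L(1) _ ij(2)])
    then have "- (npow (j + i) x + y) + w \<in> L" by (simp only: npow_add add.assoc)
    then show ?thesis unfolding R_def by blast
  qed
  have R_cong: "R y u" if "- y + u \<in> L" for y u
    unfolding R_def using that by (intro exI[of _ 0]) simp
  have R_npow: "R y (npow j x + y)" for y j
    unfolding R_def using nsub_cong_refl[OF L(1)] by blast
  define \<rho> where "\<rho> = (\<lambda>y. SOME u. R y u)"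
  have \<rho>: "R y (\<rho> y)" for y
    unfolding \<rho>_def by (rule someI[where P = "\<lambda>u. R y u"], rule R_refl)
  have \<rho>_eq: "\<rho> y = \<rho> u" if "R y u" for y u
  proof -
    have "R y w \<longleftrightarrow> R u w" for w using that R_sym R_trans by blast
    then have "R y = R u" by (intro ext)
    then show ?thesis unfolding \<rho>_def by (simp only:)
  qed
  have "\<rho> y = \<rho> (coset_rep L y)" for y
    by (rule \<rho>_eq, rule R_sym, rule R_cong, rule coset_rep_mem[OF L(1)])
  then have "range \<rho> \<subseteq> \<rho> ` range (coset_rep L)" by blast
  then have fin_\<rho>: "finite (range \<rho>)" using finite_range_coset_rep[OF L] finite_surj by blast
  \<comment> \<open>Each class of \<open>R\<close> contributes one value, the coset sum of \<xi> at
    its representative, spread over the orbit of this representative. So \<beta> is exactly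
    invariant.\<close>
  define \<beta> where "\<beta> = (\<lambda>y. if y \<in> orb x (\<rho> y) then csum (coset L (\<rho> y)) \<xi> else 0)"
  have "\<beta> \<in> fs m"
  proof -
    have "{y. \<beta> y \<noteq> 0} \<subseteq> (\<lambda>(j, r). npow j x + r) ` ({..<n} \<times> range \<rho>)"
    proof
      fix y assume "y \<in> {y. \<beta> y \<noteq> 0}"
      then have "y \<in> orb x (\<rho> y)" unfolding \<beta>_def by (auto split: if_splits)
      then obtain j where "y = npow j x + \<rho> y" unfolding orb_def by blast
      then obtain k where "k < n" "y = npow k x + \<rho> y" using npow_mod[OF n, of j] by metis
      then show "y \<in> (\<lambda>(j, r). npow j x + r) ` ({..<n} \<times> range \<rho>)"
        by (intro image_eqI[of _ _ "(k, \<rho> y)"]) simp_all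
    qed
    then have "finite {y. \<beta> y \<noteq> 0}"
      by (rule finite_subset) (intro finite_imageI finite_cartesian_product finite_lessThan fin_\<rho>)
    moreover have "csum S \<xi> \<in> zvec m" for S
      by (rule csum_mem[OF fs_finite[OF \<xi>(1)] zvec_closed(1,2) fs_zvec[OF \<xi>(1)]])
    ultimately show ?thesis unfolding fs_def \<beta>_def by (simp add: zvec_closed)
  qed
  moreover have "lsh x \<beta> = \<beta>"
  proof
    fix y
    have xy: "y = npow 1 x + (- x + y)" by simp
    have r: "\<rho> (- x + y) = \<rho> y" using \<rho>_eq[OF R_npow[of "- x + y" 1]] xy by simp
    have "y \<in> orb x (- x + y)" using npow_orb[of 1 x "- x + y"] xy by simp
    then have "- x + y \<in> orb x (\<rho> y) \<longleftrightarrow> y \<in> orb x (\<rho> y)"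
      using orb_trans orb_sym[OF n] by metis
    then show "lsh x \<beta> y = \<beta> y" unfolding lsh_def \<beta>_def r by simp
  qed
  moreover have "\<xi> - \<beta> \<in> cdiv m L e"
  proof -
    have "csum (coset L g) (\<xi> - \<beta>) \<in> dyadic e" for g
    proof -
      define r where "r = \<rho> g"
      obtain j where j: "- (npow j x + g) + r \<in> L" using \<rho>[of g] unfolding R_def r_def by blast
      obtain k where k: "- npow j x = npow k x" using npow_uminus_ex[OF n] by blast
      define y0 where "y0 = npow k x + r"
      have "- (npow k x + (npow j x + g)) + (npow k x + r) \<in> L"
        by (rule nsub_cong_plus[OF L(1) nsub_cong_refl[OF L(1)] j])
      then have gy0: "- g + y0 \<in> L" unfolding y0_def k[symmetric] by simp
      have \<rho>_coset: "\<rho> y = r" if "y \<in> coset L g" for y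
        using \<rho>_eq[OF R_cong[of g y]] that unfolding coset_def r_def by simp
      have y0: "y0 \<in> coset L g" using gy0 unfolding coset_def by simp
      \<comment> \<open>Freeness enters here: two points of one orbit in the same coset differ by a
        power of \<open>x\<close> that lies in \<open>L\<close> after conjugation by
        \<open>r\<close>, hence is trivial.\<close>
      have unique: "y = y0" if y: "y \<in> coset L g" "\<beta> y \<noteq> 0" for y
      proof -
        have "y \<in> orb x r" using y(2) \<rho>_coset[OF y(1)] unfolding \<beta>_def by (auto split: if_splits)
        then obtain i where i: "y = npow i x + r" unfolding orb_def by blast
        have "- y + y0 \<in> L" using y(1) gy0 nsub_cong_trans[OF L(1)] nsub_cong_sym[OF L(1)] unfolding coset_def by blast
        then have "- y + y0 + - (- r + r) \<in> L" by simp
        then have "r + (- y + y0) - r \<in> L" using nsub_conj[OF L(1), of "- y + y0" r] by simp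
        then have d: "- npow i x + npow k x \<in> L"
          unfolding i y0_def by (simp only: group_add_simps)
        obtain i' where i': "- npow i x = npow i' x" using npow_uminus_ex[OF n] by blast
        then have "npow (i' + k) x \<in> L" using d by (simp only: npow_add)
        then have "npow (i' + k) x = 0" by (rule free)
        then have "- npow i x + npow k x = 0" unfolding i' by (simp only: npow_add)
        then have "npow i x = npow k x" by (metis add_minus_cancel add_0_right)
        then show "y = y0" unfolding i y0_def by simp
      qed
      have "csum (coset L g) \<beta> = \<beta> y0" by (rule csum_single[OF _ y0]) (use unique in blast)
      also have "\<dots> = csum (coset L r) \<xi>"
        unfolding \<beta>_def \<rho>_coset[OF y0] using npow_orb[of k x r] unfolding y0_def by simp
      also have "coset L r = coset L (npow j x + g)" by (rule coset_eq[OF L(1) j, symmetric])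
      finally have \<beta>g: "csum (coset L g) \<beta> = csum (coset L (npow j x + g)) \<xi>" .
      \<comment> \<open>Near invariance of \<xi> compares coset sums one step apart; summing the
        steps reaches the representative's coset.\<close>
      have "csum (coset L g) \<xi> - csum (coset L (npow i x + g)) \<xi> \<in> dyadic e" for i
      proof (induction i)
        case 0 show ?case by (simp only: npow.simps add_0_left diff_self dyadic_closed(1))
      next
        case (Suc i)
        have "csum (coset L (npow (Suc i) x + g)) (\<xi> - lsh x \<xi>) \<in> dyadic e" using \<xi>(2) unfolding cdiv_def by blast
        moreover have "csum (coset L (npow (Suc i) x + g)) (\<xi> - lsh x \<xi>)
          = csum (coset L (npow (Suc i) x + g)) \<xi> - csum (coset L (npow i x + g)) \<xi>"
          by (simp add: csum_diff[OF fs_finite[OF \<xi>(1)] fs_finite[OF fs_lsh[OF \<xi>(1)]]] csum_coset_lsh add.assoc)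
        ultimately have "(csum (coset L g) \<xi> - csum (coset L (npow i x + g)) \<xi>)
          - (csum (coset L (npow (Suc i) x + g)) \<xi> - csum (coset L (npow i x + g)) \<xi>) \<in> dyadic e"
          using dyadic_closed(3)[OF Suc] by metis
        moreover have "a - b - (c - b) = a - c" for a b c :: "nat \<Rightarrow> int" by simp
        ultimately show ?case by metis
      qed
      then show ?thesis
        using csum_diff[OF fs_finite[OF \<xi>(1)] fs_finite[OF \<open>\<beta> \<in> fs m\<close>]] \<beta>g by metis
    qed
    then show ?thesis unfolding cdiv_def using fs_diff[OF \<xi>(1) \<open>\<beta> \<in> fs m\<close>] by simp
  qed
  ultimately show ?thesis by blast
qed

section \<open>Conjugacy in the wreath product\<close>

lemma fin_index_UNIV: "nsub (UNIV :: 'g :: group_add set)" "fin_index (UNIV :: 'g set)"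
  unfolding nsub_def fin_index_def by auto

lemma ex_avoiding:
  fixes E :: "'g :: group_add set"
  assumes resid: "\<And>y. (y :: 'g) \<noteq> 0 \<Longrightarrow> \<exists>M. nsub M \<and> fin_index M \<and> y \<notin> M"
    and "finite E" "0 \<notin> E"
  shows "\<exists>M. nsub M \<and> fin_index M \<and> M \<inter> E = {}"
  using assms(2,3)
proof (induction E rule: finite_induct)
  case empty then show ?case using fin_index_UNIV by auto
next
  case (insert y E)
  then obtain M where M: "nsub M" "fin_index M" "M \<inter> E = {}" by auto
  obtain M' where M': "nsub M'" "fin_index M'" "y \<notin> M'" using resid[of y] insert.prems by auto
  have "nsub (M \<inter> M')" "fin_index (M \<inter> M')"
    using nsub_Int[OF M(1) M'(1)] fin_index_Int[OF M(1) M'(1) M(2) M'(2)] .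
  moreover have "(M \<inter> M') \<inter> insert y E = {}" using M(3) M'(3) by auto
  ultimately show ?case by blast
qed

lemma ab_group_rearrange1: "e + l - x' + s - (e + l - x) = s + (x - x')" for e :: "'a :: ab_group_add"
  by (simp add: algebra_simps)

lemma ab_group_rearrange2:
  "p - ((e + (b - a)) + (a - xa) - (xe + (xb - xa))) = (p - (e + zf - xe)) + (zf - (b - xb))"
  for p :: "'a :: ab_group_add"
  by (simp add: algebra_simps)

lemma ab_group_rearrange3: "p - (e + q - xe) = (p - q) - (e - xe)" for p :: "'a :: ab_group_add"
  by (simp add: algebra_simps)

text \<open>The orbit of \<open>p\<close> in the quotient by \<open>L\<close>, pulled back to the
  group. For normal \<open>L\<close> and \<open>x\<close> of finite order it is a union of cosets
  and invariant under \<open>x\<close>, so sums over it see functions only modulo \<open>L\<close>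
  and ignore boundaries.\<close>

definition orb_mod :: "'g :: group_add set \<Rightarrow> 'g \<Rightarrow> 'g \<Rightarrow> 'g set" where
  "orb_mod L x p = {u. \<exists>j. - (npow j x + p) + u \<in> L}"

lemma orb_mod_saturated:
  "nsub L \<Longrightarrow> u \<in> orb_mod L x p \<Longrightarrow> - u + v \<in> L \<Longrightarrow> v \<in> orb_mod L x p"
  unfolding orb_mod_def using nsub_cong_trans by blast

lemma orb_mod_invariant:
  assumes L: "nsub L" and n: "n > 0" "npow n x = 0"
  shows "x + u \<in> orb_mod L x p \<longleftrightarrow> u \<in> orb_mod L x p"
proof
  assume "u \<in> orb_mod L x p"
  then obtain j where "- (npow j x + p) + u \<in> L" unfolding orb_mod_def by blast
  then have "- (x + (npow j x + p)) + (x + u) \<in> L" by (rule nsub_cong_plus[OF L nsub_cong_refl[OF L]])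
  then have "- (npow (Suc j) x + p) + (x + u) \<in> L" by (simp only: npow.simps add.assoc)
  then show "x + u \<in> orb_mod L x p" unfolding orb_mod_def by blast
next
  assume "x + u \<in> orb_mod L x p"
  then obtain j where j: "- (npow j x + p) + (x + u) \<in> L" unfolding orb_mod_def by blast
  obtain k where k: "- npow 1 x = npow k x" using npow_uminus_ex[OF n] by blast
  have "- (- x + (npow j x + p)) + (- x + (x + u)) \<in> L"
    by (rule nsub_cong_plus[OF L nsub_cong_refl[OF L] j])
  moreover have "- x + (npow j x + p) = npow (k + j) x + p" using k by (simp add: npow_add add.assoc)
  ultimately have "- (npow (k + j) x + p) + u \<in> L" by (simp only: minus_add_cancel)
  then show "u \<in> orb_mod L x p" unfolding orb_mod_def by blast
qed

lemma csum_orb_mod_boundary: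
  assumes L: "nsub L" and n: "n > 0" "npow n x = 0" and \<eta>: "\<eta> \<in> fs m"
  shows "csum (orb_mod L x p) (\<eta> - lsh x \<eta>) = 0"
proof -
  have "csum (orb_mod L x p) (lsh x \<eta>) = csum (orb_mod L x p) \<eta>"
    unfolding csum_lsh orb_mod_invariant[OF L n] by simp
  then show ?thesis
    using csum_diff[OF fs_finite[OF \<eta>] fs_finite[OF fs_lsh[OF \<eta>, of x]], of "orb_mod L x p"] by (simp only: diff_self)
qed

text \<open>Since \<open>z\<close> depends on the depth, everything to be detected is fixed in
  finite sets beforehand. Orbit sums then provide \<eta>0 with the right boundary, possibly outside
  \<open>cdiv m L e\<close>. Its difference \<xi> from the approximate solution \<eta> is invariant
  modulo \<open>cdiv m L' e'\<close>; subtracting an exactly invariant \<beta> close to \<xi> keeps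
  the boundary and brings the solution back into \<open>cdiv m L e\<close>.\<close>

theorem wreath_conj_core:
  fixes x :: "'g :: group_add"
  assumes resid: "\<And>y. (y :: 'g) \<noteq> 0 \<Longrightarrow> \<exists>M. nsub M \<and> fin_index M \<and> y \<notin> M"
    and n: "n > 0" "npow n x = 0" and L: "nsub L" "fin_index L"
    and \<phi>: "\<phi> \<in> fs m" and \<psi>: "\<psi> \<in> fs m"
    and appr: "\<And>L' e'. nsub L' \<Longrightarrow> fin_index L' \<Longrightarrow>
      \<exists>\<eta>\<in>cdiv m L e. \<exists>z\<in>L. \<exists>\<zeta>\<in>cdiv m L' e'. \<exists>w\<in>L'. x = (z + x - z) + w \<and>
        \<psi> = \<eta> + lsh z \<phi> - lsh (z + x - z) \<eta> + lsh (z + x - z) \<zeta>"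
  shows "\<exists>\<eta>\<in>cdiv m L e. \<exists>z\<in>L. z + x - z = x \<and> \<psi> = \<eta> + lsh z \<phi> - lsh x \<eta>"
proof -
  \<comment> \<open>\<open>F\<close> holds the candidates for the group component of the conjugator.
    \<open>T\<close> is closed under \<open>x\<close> and contains the supports of all functions to
    be compared. \<open>L'\<close> must avoid \<open>E\<close>, so that it separates the points of
    \<open>T\<close> and detects both nontrivial powers of \<open>x\<close> and candidates that fail
    to centralise \<open>x\<close>. \<open>V\<close> holds the orbit sums that \<open>2 ^ e'\<close>
    must detect.\<close>
  define X where "X = range (\<lambda>j. npow j x)"
  define S where "S = {y. \<phi> y \<noteq> 0} \<union> {y. \<psi> y \<noteq> 0}"
  define T0 where "T0 = (\<lambda>(a, s). a + s) ` (X \<times> S)"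
  define F where "F = insert 0 ((\<lambda>(p, q). p - q) ` (T0 \<times> T0))"
  define T where "T = (\<lambda>(a, f, s). a + (f + s)) ` (X \<times> F \<times> S)"
  define E where "E = ((\<lambda>(p, q). - p + q) ` (T \<times> T) \<union> (\<lambda>q. q + x - q - x) ` F \<union> X) - {0}"
  define V where "V = (\<lambda>p. csum (orb x p) \<phi>) ` T \<union> (\<lambda>(p, q). csum (orb x p) (\<psi> - lsh q \<phi>)) ` (T \<times> F)"
  have "X \<subseteq> (\<lambda>j. npow j x) ` {..<n}" unfolding X_def using npow_mod[OF n] by fastforce
  then have fin_X: "finite X" by (rule finite_subset) simp
  have fin_S: "finite S" unfolding S_def using fs_finite[OF \<phi>] fs_finite[OF \<psi>] by simp
  have fin_T0: "finite T0" unfolding T0_def using fin_X fin_S by simp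
  have fin_F: "finite F" unfolding F_def using fin_T0 by simp
  have fin_T: "finite T" unfolding T_def using fin_X fin_F fin_S by simp
  have fin_E: "finite E" unfolding E_def using fin_T fin_F fin_X by simp
  have fin_V: "finite V" unfolding V_def using fin_T fin_F by simp
  have T_npow: "npow j x + t \<in> T" if t: "t \<in> T" for j t
  proof -
    obtain i f s where ifs: "t = npow i x + (f + s)" "f \<in> F" "s \<in> S" using t unfolding T_def X_def by auto
    have "npow j x + t = npow (j + i) x + (f + s)" unfolding ifs(1) by (simp only: npow_add add.assoc)
    moreover have "npow (j + i) x \<in> X" unfolding X_def by blast
    ultimately show ?thesis unfolding T_def using ifs(2,3) by (intro image_eqI[of _ _ "(npow (j + i) x, f, s)"]) simp_all
  qed
  have FS_T: "f + s \<in> T" if "f \<in> F" "s \<in> S" for f s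
  proof -
    have "npow 0 x \<in> X" unfolding X_def by blast
    then show ?thesis unfolding T_def using that by (intro image_eqI[of _ _ "(npow 0 x, f, s)"]) simp_all
  qed
  have S_T: "s \<in> T" if "s \<in> S" for s using FS_T[of 0 s] that unfolding F_def by simp
  obtain L1 where L1: "nsub L1" "fin_index L1" "L1 \<inter> E = {}"
    using ex_avoiding[OF resid fin_E] unfolding E_def by blast
  define L' where "L' = L1 \<inter> L"
  have L': "nsub L'" "fin_index L'" "L' \<subseteq> L" "L' \<inter> E = {}"
    unfolding L'_def using nsub_Int[OF L1(1) L(1)] fin_index_Int[OF L1(1) L(1) L1(2) L(2)] L1(3) by auto
  obtain e' where e': "e' \<ge> e" "\<forall>v\<in>V. v \<in> dyadic e' \<longrightarrow> v = 0"
    using ex_dyadic_separating[OF fin_V] by blast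
  have D_sub: "cdiv m L' e' \<subseteq> cdiv m L e" by (rule cdiv_mono[OF L'(1,3) L(1) e'(1)])
  obtain \<eta> z \<zeta> w where a: "\<eta> \<in> cdiv m L e" "z \<in> L" "\<zeta> \<in> cdiv m L' e'" "w \<in> L'"
    "x = (z + x - z) + w" "\<psi> = \<eta> + lsh z \<phi> - lsh (z + x - z) \<eta> + lsh (z + x - z) \<zeta>"
    using appr[OF L'(1,2), of e'] by blast
  define x' where "x' = z + x - z"
  have xx': "- x + x' \<in> L'"
  proof -
    have "- x + x' = - w" unfolding a(5)[folded x'_def] by (simp add: minus_add)
    then show ?thesis using nsub_uminus[OF L'(1) a(4)] by simp
  qed
  have zx: "z + x = x' + z" unfolding x'_def by simp
  have zx_npow: "z + npow j x = npow j x' + z" for j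
    unfolding x'_def npow_conj by simp
  have \<eta>: "\<eta> \<in> fs m" by (rule cdiv_fs[OF a(1)])
  \<comment> \<open>Replacing \<open>x'\<close> by \<open>x\<close> costs a difference of shifts by
    elements congruent modulo \<open>L'\<close>, which \<open>cdiv\<close> absorbs.\<close>
  have near: "\<psi> - (\<eta> + lsh z \<phi> - lsh x \<eta>) \<in> cdiv m L' e'"
  proof -
    have "\<psi> - (\<eta> + lsh z \<phi> - lsh x \<eta>) = lsh x' \<zeta> + (lsh x \<eta> - lsh x' \<eta>)"
      unfolding a(6)[folded x'_def] by (rule ab_group_rearrange1)
    moreover have "lsh x' \<zeta> + (lsh x \<eta> - lsh x' \<eta>) \<in> cdiv m L' e'"
      by (rule cdiv_add[OF cdiv_lsh[OF a(3)] lsh_cong_cdiv[OF L'(1) xx' \<eta>]])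
    ultimately show ?thesis by (simp only:)
  qed
  have sep: "p = q" if "p \<in> T" "q \<in> T" "- p + q \<in> L'" for p q
  proof (rule ccontr)
    assume "p \<noteq> q"
    then have "- p + q \<noteq> 0" using minus_unique[of "- p" q] by auto
    moreover have "- p + q \<in> (\<lambda>(p, q). - p + q) ` (T \<times> T)"
      by (rule image_eqI[of _ _ "(p, q)"]) (use that in simp_all)
    ultimately have "- p + q \<in> E" unfolding E_def by blast
    then show False using that(3) L'(4) by blast
  qed
  have orb_T: "csum (orb_mod L' x p) \<chi> = csum (orb x p) \<chi>"
    if p: "p \<in> T" and supp: "\<And>y. \<chi> y \<noteq> 0 \<Longrightarrow> y \<in> T" for p and \<chi> :: "'g \<Rightarrow> nat \<Rightarrow> int"
  proof (rule csum_cong_set)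
    fix u assume "\<chi> u \<noteq> 0"
    then have u: "u \<in> T" by (rule supp)
    show "u \<in> orb_mod L' x p \<longleftrightarrow> u \<in> orb x p"
    proof
      assume "u \<in> orb_mod L' x p"
      then obtain j where "- (npow j x + p) + u \<in> L'" unfolding orb_mod_def by blast
      then have "npow j x + p = u" by (rule sep[OF T_npow[OF p] u])
      then show "u \<in> orb x p" unfolding orb_def by blast
    next
      assume "u \<in> orb x p"
      then obtain j where "u = npow j x + p" unfolding orb_def by blast
      then have "- (npow j x + p) + u \<in> L'" using nsub_cong_refl[OF L'(1)] by simp
      then show "u \<in> orb_mod L' x p" unfolding orb_mod_def by blast
    qed
  qed
  have "\<exists>q\<in>F. q \<in> L \<and> q + x - q = x \<and>
    (\<exists>\<eta>\<in>cdiv m L e. \<psi> - (\<eta> + lsh q \<phi> - lsh x \<eta>) \<in> cdiv m L' e')"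
  proof (cases "\<forall>s. csum (orb x s) \<phi> = 0")
    case True
    \<comment> \<open>As \<phi> is a boundary, replacing \<open>z\<close> by \<open>0\<close> is
      compensated by adding \<open>lsh z \<eta>0 - \<eta>0\<close> to \<eta>, and this lies in
      \<open>cdiv m L e\<close> because \<open>z\<close> is in \<open>L\<close>.\<close>
    then obtain \<eta>0 where \<eta>0: "\<eta>0 \<in> fs m" "\<phi> = \<eta>0 - lsh x \<eta>0"
      using orbit_sums_zero_imp_boundary[OF n \<phi>] by blast
    have z0: "- z + 0 \<in> L" using nsub_uminus[OF L(1) a(2)] by simp
    have "lsh z \<eta>0 - lsh 0 \<eta>0 \<in> cdiv m L e" by (rule lsh_cong_cdiv[OF L(1) z0 \<eta>0(1)])
    then have "\<eta> + (lsh z \<eta>0 - \<eta>0) \<in> cdiv m L e" using cdiv_add[OF a(1)] by (simp only: lsh_0)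
    moreover have "\<psi> - (\<eta> + (lsh z \<eta>0 - \<eta>0) + lsh 0 \<phi> - lsh x (\<eta> + (lsh z \<eta>0 - \<eta>0))) \<in> cdiv m L' e'"
    proof -
      have c: "- (x + z) + (z + x) \<in> L'"
        unfolding zx by (rule nsub_cong_plus[OF L'(1) xx' nsub_cong_refl[OF L'(1)]])
      have e1: "lsh 0 \<phi> = \<eta>0 - lsh x \<eta>0" unfolding lsh_0 by (rule \<eta>0(2))
      have e2: "lsh z \<phi> - (lsh z \<eta>0 - lsh x (lsh z \<eta>0)) = lsh (x + z) \<eta>0 - lsh (z + x) \<eta>0"
      proof -
        have "(b - c) - (b - d) = d - c" for b c d :: "'c :: ab_group_add" by (simp add: algebra_simps)
        note r = this
        have "lsh z \<phi> = lsh z \<eta>0 - lsh (z + x) \<eta>0"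
          by (subst \<eta>0(2)) (simp only: lsh_diff lsh_lsh)
        then show ?thesis unfolding lsh_lsh by (simp only: r)
      qed
      have "\<psi> - (\<eta> + (lsh z \<eta>0 - \<eta>0) + lsh 0 \<phi> - lsh x (\<eta> + (lsh z \<eta>0 - \<eta>0)))
        = (\<psi> - (\<eta> + lsh z \<phi> - lsh x \<eta>)) + (lsh z \<phi> - (lsh z \<eta>0 - lsh x (lsh z \<eta>0)))"
        unfolding e1 lsh_add lsh_diff by (rule ab_group_rearrange2)
      also have "\<dots> \<in> cdiv m L' e'"
        unfolding e2 by (rule cdiv_add[OF near lsh_cong_cdiv[OF L'(1) c \<eta>0(1)]])
      finally show ?thesis .
    qed
    moreover have "(0 :: 'g) \<in> F" "(0 :: 'g) \<in> L" "0 + x - 0 = x" unfolding F_def using nsub_zero[OF L(1)] by simp_all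
    ultimately show ?thesis by blast
  next
    case False
    then obtain s0 where s0: "csum (orb x s0) \<phi> \<noteq> 0" by blast
    then have "{y \<in> orb x s0. \<phi> y \<noteq> 0} \<noteq> {}" unfolding csum_def by (metis sum.empty)
    then obtain s where s: "s \<in> orb x s0" "\<phi> s \<noteq> 0" by blast
    have orb_s: "orb x s = orb x s0"
      using orb_trans[of _ x] s(1) orb_sym[OF n s(1)] by blast
    have s_ne: "csum (orb x s) \<phi> \<noteq> 0" unfolding orb_s by (rule s0)
    have sS: "s \<in> S" using s(2) unfolding S_def by blast
    \<comment> \<open>Shifted back by \<open>z\<close>, this set meets the support of \<phi> in the
      orbit of \<open>s\<close>. The nonzero orbit sum survives modulo \<open>2 ^ e'\<close>,
      boundaries contribute nothing, so \<psi> must have a point of its support in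
      \<open>O'\<close>.\<close>
    define O' where "O' = orb_mod L' x (z + s)"
    have eq: "{u. z + u \<in> O'} = orb_mod L' x s"
    proof -
      have "- (npow j x + (z + s)) + (z + u) \<in> L' \<longleftrightarrow> - (npow j x + s) + u \<in> L'" for j u
      proof -
        have "- (npow j x + (z + s)) + (npow j x' + (z + s)) \<in> L'"
          by (rule nsub_cong_plus[OF L'(1) nsub_cong_npow[OF L'(1) xx'] nsub_cong_refl[OF L'(1)]])
        moreover have "npow j x' + (z + s) = z + (npow j x + s)" using zx_npow[of j] by (metis add.assoc)
        ultimately have c: "- (npow j x + (z + s)) + (z + (npow j x + s)) \<in> L'" by (simp only:)
        show ?thesis
        proof
          assume "- (npow j x + (z + s)) + (z + u) \<in> L'"
          then have "- (z + (npow j x + s)) + (z + u) \<in> L'"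
            by (rule nsub_cong_trans[OF L'(1) nsub_cong_sym[OF L'(1) c]])
          then show "- (npow j x + s) + u \<in> L'" by (rule nsub_cong_left)
        next
          assume "- (npow j x + s) + u \<in> L'"
          then have "- (z + (npow j x + s)) + (z + u) \<in> L'"
            by (rule nsub_cong_plus[OF L'(1) nsub_cong_refl[OF L'(1)]])
          then show "- (npow j x + (z + s)) + (z + u) \<in> L'" by (rule nsub_cong_trans[OF L'(1) c])
        qed
      qed
      then show ?thesis unfolding O'_def orb_mod_def by simp
    qed
    have "csum O' (lsh z \<phi>) = csum (orb x s) \<phi>"
      unfolding csum_lsh eq by (rule orb_T[OF S_T[OF sS]]) (rule S_T, simp add: S_def)
    moreover have "csum (orb x s) \<phi> \<in> V" unfolding V_def using S_T[OF sS] by blast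
    ultimately have not_dy: "csum O' (lsh z \<phi>) \<notin> dyadic e'" using e'(2) s_ne by metis
    have "csum O' (\<psi> - (\<eta> + lsh z \<phi> - lsh x \<eta>)) \<in> dyadic e'"
      unfolding O'_def by (rule csum_saturated[OF L'(1) near orb_mod_saturated[OF L'(1)]])
    moreover have "csum O' (\<psi> - (\<eta> + lsh z \<phi> - lsh x \<eta>)) = csum O' \<psi> - csum O' (lsh z \<phi>)"
    proof -
      have "csum O' ((\<psi> - lsh z \<phi>) - (\<eta> - lsh x \<eta>)) = csum O' (\<psi> - lsh z \<phi>) - csum O' (\<eta> - lsh x \<eta>)"
        by (rule csum_diff[OF fs_finite[OF fs_diff[OF \<psi> fs_lsh[OF \<phi>]]] fs_finite[OF fs_diff[OF \<eta> fs_lsh[OF \<eta>]]]])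
      also have "\<dots> = csum O' \<psi> - csum O' (lsh z \<phi>)"
        unfolding O'_def csum_orb_mod_boundary[OF L'(1) n \<eta>] diff_0_right
        by (rule csum_diff[OF fs_finite[OF \<psi>] fs_finite[OF fs_lsh[OF \<phi>]]])
      finally show ?thesis unfolding ab_group_rearrange3 .
    qed
    ultimately have "csum O' \<psi> - csum O' (lsh z \<phi>) \<in> dyadic e'" by metis
    then have "csum O' \<psi> \<noteq> 0" using not_dy dyadic_closed(4) by (metis diff_0 minus_minus)
    then have "{y \<in> O'. \<psi> y \<noteq> 0} \<noteq> {}" unfolding csum_def by (metis sum.empty)
    then obtain t where t: "t \<in> O'" "\<psi> t \<noteq> 0" by blast
    then obtain j where j: "- (npow j x + (z + s)) + t \<in> L'" unfolding O'_def orb_mod_def by blast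
    obtain k where k: "- npow j x = npow k x" using npow_uminus_ex[OF n] by blast
    \<comment> \<open>Solving \<open>t \<equiv> npow j x + (z + s)\<close> for \<open>z\<close>
      modulo \<open>L'\<close> gives an element that depends only on the supports and
      \<open>x\<close>.\<close>
    define q where "q = (npow k x + t) - s"
    have "- (- npow j x + (npow j x + (z + s))) + (- npow j x + t) \<in> L'"
      by (rule nsub_cong_plus[OF L'(1) nsub_cong_refl[OF L'(1)] j])
    then have "- (z + s) + (npow k x + t) \<in> L'" unfolding k[symmetric] by (simp only: minus_add_cancel)
    then have "- (z + s + - s) + (npow k x + t + - s) \<in> L'"
      by (rule nsub_cong_plus[OF L'(1) _ nsub_cong_refl[OF L'(1)]])
    then have zq: "- z + q \<in> L'" unfolding q_def by (simp only: add_uminus_conv_diff add_diff_cancel)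
    have XS: "npow i x + u \<in> T0" if "u \<in> S" for i u
      unfolding T0_def X_def using that by (intro image_eqI[of _ _ "(npow i x, u)"]) simp_all
    have "t \<in> S" using t(2) unfolding S_def by blast
    then have "npow k x + t \<in> T0" by (rule XS)
    moreover have "s \<in> T0" using XS[OF sS, of 0] by simp
    ultimately have qF: "q \<in> F" unfolding F_def q_def by (intro insertI2 image_eqI[of _ _ "(npow k x + t, s)"]) simp_all
    have qL: "q \<in> L"
    proof -
      have "z + (- z + q) \<in> L" using nsub_plus[OF L(1) a(2)] zq L'(3) by blast
      then show ?thesis by simp
    qed
    \<comment> \<open>Congruence with \<open>z\<close> puts \<open>q + x - q - x\<close> into
      \<open>L'\<close>; were it nontrivial, it would be one of the elements of \<open>E\<close>
      that \<open>L'\<close> avoids.\<close>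
    have qx: "q + x - q = x"
    proof (rule ccontr)
      assume ne: "q + x - q \<noteq> x"
      have 1: "- (z + x + - z) + (q + x + - q) \<in> L'"
        by (rule nsub_cong_plus[OF L'(1) nsub_cong_plus[OF L'(1) zq nsub_cong_refl[OF L'(1)]] nsub_cong_uminus[OF L'(1) zq]])
      have "- x + (q + x + - q) \<in> L'"
        by (rule nsub_cong_trans[OF L'(1) xx']) (use 1 in \<open>simp add: x'_def\<close>)
      then have "(q + x + - q) + - x \<in> L'" using nsub_commute[OF L'(1)] by blast
      then have in_L': "q + x - q - x \<in> L'" by simp
      have "q + x - q - x \<in> E" unfolding E_def using qF ne by auto
      then show False using in_L' L'(4) by blast
    qed
    have "\<psi> - (\<eta> + lsh q \<phi> - lsh x \<eta>) \<in> cdiv m L' e'"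
    proof -
      have "(p - (e + b - y)) + (b - c) = p - (e + c - y)" for p e b c y :: "'c :: ab_group_add"
        by (simp add: algebra_simps)
      note r = this
      have "(\<psi> - (\<eta> + lsh z \<phi> - lsh x \<eta>)) + (lsh z \<phi> - lsh q \<phi>) \<in> cdiv m L' e'"
        by (rule cdiv_add[OF near lsh_cong_cdiv[OF L'(1) zq \<phi>]])
      then show ?thesis by (simp only: r)
    qed
    then show ?thesis using qF qL qx a(1) by blast
  qed
  then obtain q \<eta> where q: "q \<in> F" "q \<in> L" "q + x - q = x" and \<eta>L: "\<eta> \<in> cdiv m L e"
    and near: "\<psi> - (\<eta> + lsh q \<phi> - lsh x \<eta>) \<in> cdiv m L' e'" by blast
  have \<eta>: "\<eta> \<in> fs m" by (rule cdiv_fs[OF \<eta>L])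
  define \<theta> where "\<theta> = \<psi> - lsh q \<phi>"
  have \<theta>: "\<theta> \<in> fs m" unfolding \<theta>_def by (rule fs_diff[OF \<psi> fs_lsh[OF \<phi>]])
  have near\<theta>: "\<theta> - (\<eta> - lsh x \<eta>) \<in> cdiv m L' e'"
    using near unfolding ab_group_rearrange3 \<theta>_def .
  have supp: "u \<in> T" if u: "\<theta> u \<noteq> 0" for u
  proof (cases "\<psi> u = 0")
    case True
    then have "\<phi> (- q + u) \<noteq> 0" using u unfolding \<theta>_def lsh_def by auto
    then have "- q + u \<in> S" unfolding S_def by blast
    then have "q + (- q + u) \<in> T" by (rule FS_T[OF q(1)])
    then show ?thesis by simp
  next
    case False
    then show ?thesis using S_T unfolding S_def by blast
  qed
  have "csum (orb x p) \<theta> = 0" for p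
  proof (cases "p \<in> T")
    case True
    have "csum (orb_mod L' x p) (\<theta> - (\<eta> - lsh x \<eta>)) \<in> dyadic e'"
      by (rule csum_saturated[OF L'(1) near\<theta> orb_mod_saturated[OF L'(1)]])
    moreover have "csum (orb_mod L' x p) (\<theta> - (\<eta> - lsh x \<eta>)) = csum (orb_mod L' x p) \<theta> - csum (orb_mod L' x p) (\<eta> - lsh x \<eta>)"
      by (rule csum_diff[OF fs_finite[OF \<theta>] fs_finite[OF fs_diff[OF \<eta> fs_lsh[OF \<eta>]]]])
    ultimately have "csum (orb x p) \<theta> \<in> dyadic e'"
      unfolding csum_orb_mod_boundary[OF L'(1) n \<eta>] diff_0_right using orb_T[OF True supp] by metis
    moreover have "csum (orb x p) \<theta> \<in> V"
      unfolding V_def \<theta>_def using True q(1) by (intro UnI2 image_eqI[of _ _ "(p, q)"]) simp_all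
    ultimately show ?thesis using e'(2) by blast
  next
    case False
    have "u \<notin> orb x p" if "\<theta> u \<noteq> 0" for u
    proof
      assume "u \<in> orb x p"
      then have "p \<in> orb x u" by (rule orb_sym[OF n])
      then show False using T_npow[OF supp[OF that]] False unfolding orb_def by blast
    qed
    then have "{u \<in> orb x p. \<theta> u \<noteq> 0} = {}" by auto
    then show ?thesis unfolding csum_def by (simp only: sum.empty)
  qed
  then obtain \<eta>0 where \<eta>0: "\<eta>0 \<in> fs m" "\<theta> = \<eta>0 - lsh x \<eta>0"
    using orbit_sums_zero_imp_boundary[OF n \<theta>] by blast
  \<comment> \<open>The boundary of \<xi> is the error of the approximate solution, which lies in
    \<open>cdiv m L' e'\<close>.\<close>
  define \<xi> where "\<xi> = \<eta>0 - \<eta>"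
  have \<xi>: "\<xi> \<in> fs m" unfolding \<xi>_def by (rule fs_diff[OF \<eta>0(1) \<eta>])
  have "\<xi> - lsh x \<xi> = \<theta> - (\<eta> - lsh x \<eta>)"
  proof -
    have "(a - e) - (xa - xe) = (a - xa) - (e - xe)" for a e xa xe :: "'c :: ab_group_add" by (simp add: algebra_simps)
    note r = this
    show ?thesis unfolding \<eta>0(2) \<xi>_def lsh_diff by (rule r)
  qed
  then have \<xi>': "\<xi> - lsh x \<xi> \<in> cdiv m L' e'" using near\<theta> by (simp only:)
  have free: "npow j x = 0" if "npow j x \<in> L'" for j
  proof (rule ccontr)
    assume "npow j x \<noteq> 0"
    then have "npow j x \<in> E" unfolding E_def X_def by blast
    then show False using that L'(4) by blast
  qed
  obtain \<beta> where \<beta>: "\<beta> \<in> fs m" "lsh x \<beta> = \<beta>" "\<xi> - \<beta> \<in> cdiv m L' e'"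
    using invariant_lift[OF n L'(1,2) free \<xi> \<xi>'] by blast
  have "\<eta> + (\<xi> - \<beta>) \<in> cdiv m L e" using cdiv_add[OF \<eta>L] \<beta>(3) D_sub by blast
  moreover have "\<psi> = (\<eta> + (\<xi> - \<beta>)) + lsh q \<phi> - lsh x (\<eta> + (\<xi> - \<beta>))"
  proof -
    have "p = (e + ((a - e) - b)) + c - (xe + ((xa - xe) - b))" if "p - c = a - xa" for p c a e b xa xe :: "'c :: ab_group_add"
      using that by (simp add: algebra_simps)
    note r = this
    show ?thesis unfolding \<xi>_def lsh_add lsh_diff \<beta>(2)
      by (rule r[of \<psi> "lsh q \<phi>" \<eta>0 "lsh x \<eta>0"]) (use \<eta>0(2) \<theta>_def in \<open>simp only:\<close>)
  qed
  ultimately show ?thesis using q(2,3) by blast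
qed

section \<open>The wreath product over a type and its pro-2 topology\<close>

definition wr :: "nat \<Rightarrow> (('g :: group_add \<Rightarrow> nat \<Rightarrow> int) \<times> 'g) monoid" where
  "wr m = \<lparr>carrier = fs m \<times> UNIV,
     monoid.mult = (\<lambda>(\<phi>, x) (\<psi>, y). (\<phi> + lsh x \<psi>, x + y)), one = (0, 0)\<rparr>"

lemma wr_carrier: "carrier (wr m) = fs m \<times> UNIV"
  and wr_mult: "(\<phi>, x) \<otimes>\<^bsub>wr m\<^esub> (\<psi>, y) = (\<phi> + lsh x \<psi>, x + y)"
  and wr_one: "\<one>\<^bsub>wr m\<^esub> = (0, 0)"
  by (simp_all add: wr_def)

lemma group_wr: "group (wr m :: (('g :: group_add \<Rightarrow> nat \<Rightarrow> int) \<times> 'g) monoid)"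
proof (rule groupI)
  fix p q r :: "('g \<Rightarrow> nat \<Rightarrow> int) \<times> 'g"
  assume "p \<in> carrier (wr m)" "q \<in> carrier (wr m)" "r \<in> carrier (wr m)"
  show "p \<otimes>\<^bsub>wr m\<^esub> q \<otimes>\<^bsub>wr m\<^esub> r = p \<otimes>\<^bsub>wr m\<^esub> (q \<otimes>\<^bsub>wr m\<^esub> r)"
    by (cases p; cases q; cases r) (simp only: wr_mult lsh_add lsh_lsh add.assoc)
next
  fix p q :: "('g \<Rightarrow> nat \<Rightarrow> int) \<times> 'g"
  assume "p \<in> carrier (wr m)" "q \<in> carrier (wr m)"
  then show "p \<otimes>\<^bsub>wr m\<^esub> q \<in> carrier (wr m)"
    by (cases p; cases q) (simp only: wr_mult wr_carrier mem_Times_iff fst_conv snd_conv UNIV_I fs_add fs_lsh)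
next
  show "\<one>\<^bsub>wr m\<^esub> \<in> carrier (wr m)" by (simp only: wr_one wr_carrier mem_Times_iff fst_conv snd_conv UNIV_I fs_zero)
next
  fix p :: "('g \<Rightarrow> nat \<Rightarrow> int) \<times> 'g"
  assume p: "p \<in> carrier (wr m)"
  then show "\<one>\<^bsub>wr m\<^esub> \<otimes>\<^bsub>wr m\<^esub> p = p" by (cases p) (simp only: wr_one wr_mult lsh_0 add_0_left)
  obtain \<phi> x where px: "p = (\<phi>, x)" by (cases p)
  have "(- lsh (- x) \<phi>, - x) \<in> carrier (wr m)" using p unfolding px wr_carrier by (auto intro: fs_uminus fs_lsh)
  moreover have "(- lsh (- x) \<phi>, - x) \<otimes>\<^bsub>wr m\<^esub> p = \<one>\<^bsub>wr m\<^esub>"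
    unfolding px by (simp only: wr_mult wr_one left_minus)
  ultimately show "\<exists>q\<in>carrier (wr m). q \<otimes>\<^bsub>wr m\<^esub> p = \<one>\<^bsub>wr m\<^esub>" by blast
qed

lemma wr_inv:
  assumes "\<phi> \<in> fs m" shows "inv\<^bsub>wr m\<^esub> (\<phi>, x) = (- lsh (- x) \<phi>, - x)"
proof (rule group.inv_equality[OF group_wr])
  show "(- lsh (- x) \<phi>, - x) \<otimes>\<^bsub>wr m\<^esub> (\<phi>, x) = \<one>\<^bsub>wr m\<^esub>"
    by (simp only: wr_mult wr_one left_minus)
qed (use assms in \<open>auto simp: wr_carrier intro: fs_uminus fs_lsh\<close>)

lemma wr_conj:
  assumes "\<eta> \<in> fs m"
  shows "(\<eta>, z) \<otimes>\<^bsub>wr m\<^esub> (\<phi>, x) \<otimes>\<^bsub>wr m\<^esub> inv\<^bsub>wr m\<^esub> (\<eta>, z)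
    = (\<eta> + lsh z \<phi> - lsh (z + x - z) \<eta>, z + x - z)"
  unfolding wr_inv[OF assms] wr_mult lsh_uminus lsh_lsh by simp

lemma wr_div:
  assumes "\<psi> \<in> fs m"
  shows "(\<phi>, x) \<otimes>\<^bsub>wr m\<^esub> inv\<^bsub>wr m\<^esub> (\<psi>, y) = (\<phi> - lsh (x - y) \<psi>, x - y)"
  unfolding wr_inv[OF assms] wr_mult lsh_uminus lsh_lsh by simp

lemma npow_Suc2: "npow n x + x = npow (Suc n) (x :: 'a :: monoid_add)"
  using npow_add[of n 1 x] by simp

lemma wr_pow:
  assumes "\<phi> \<in> fs m" shows "\<exists>\<psi>\<in>fs m. (\<phi>, x) [^]\<^bsub>wr m\<^esub> (n :: nat) = (\<psi>, npow n x)"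
proof (induction n)
  case 0
  have "(\<phi>, x) [^]\<^bsub>wr m\<^esub> (0 :: nat) = (0, npow 0 x)" by (simp add: wr_one nat_pow_def)
  then show ?case using fs_zero by blast
next
  case (Suc n)
  then obtain \<psi> where \<psi>: "\<psi> \<in> fs m" "(\<phi>, x) [^]\<^bsub>wr m\<^esub> n = (\<psi>, npow n x)" by blast
  have "(\<phi>, x) [^]\<^bsub>wr m\<^esub> Suc n = (\<psi> + lsh (npow n x) \<phi>, npow (Suc n) x)"
    unfolding nat_pow_Suc \<psi>(2) wr_mult npow_Suc2 ..
  then show ?case using fs_add[OF \<psi>(1) fs_lsh[OF assms]] by blast
qed

lemma wr_pow_base: "(\<phi>, 0) [^]\<^bsub>wr m\<^esub> (n :: nat) = (npow n \<phi>, 0)"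
proof (induction n)
  case 0 show ?case by (simp only: npow.simps nat_pow_0 wr_one)
next
  case (Suc n) show ?case
    unfolding nat_pow_Suc Suc wr_mult lsh_0 npow_Suc2 add_0_left ..
qed

lemma npow_apply: "npow n \<phi> y i = int n * \<phi> y i"
  by (induction n) (simp_all add: algebra_simps)

text \<open>For normal \<open>L\<close>, the kernel of the map to the wreath product of the integer
  vectors modulo \<open>2 ^ e\<close> with the quotient by \<open>L\<close>. For a torsion 2-group
  and \<open>L\<close> of finite index these form a base of open normal subgroups.\<close>

definition wrN :: "nat \<Rightarrow> 'g :: group_add set \<Rightarrow> nat \<Rightarrow> (('g \<Rightarrow> nat \<Rightarrow> int) \<times> 'g) set" where
  "wrN m L e = cdiv m L e \<times> L"

text \<open>Conjugation by \<eta> adds \<eta> minus its shift by an element of \<open>L\<close>, and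
  such differences have vanishing coset sums.\<close>

lemma normal_wrN:
  assumes L: "nsub L" shows "wrN m L e \<lhd> wr m"
proof -
  interpret W: group "wr m" by (rule group_wr)
  have "subgroup (wrN m L e) (wr m)"
  proof
    show "wrN m L e \<subseteq> carrier (wr m)" unfolding wrN_def wr_carrier using cdiv_fs by blast
    show "\<one>\<^bsub>wr m\<^esub> \<in> wrN m L e" unfolding wrN_def wr_one using cdiv_zero nsub_zero[OF L] by blast
  next
    fix p q assume pq: "p \<in> wrN m L e" "q \<in> wrN m L e"
    obtain \<phi> x \<psi> y where *: "p = (\<phi>, x)" "q = (\<psi>, y)" by (cases p, cases q)
    then show "p \<otimes>\<^bsub>wr m\<^esub> q \<in> wrN m L e"
      using pq cdiv_add[OF _ cdiv_lsh] nsub_plus[OF L] unfolding wrN_def * wr_mult by blast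
  next
    fix p assume p: "p \<in> wrN m L e"
    obtain \<phi> x where px: "p = (\<phi>, x)" by (cases p)
    have \<phi>: "\<phi> \<in> cdiv m L e" "x \<in> L" using p unfolding px wrN_def by auto
    show "inv\<^bsub>wr m\<^esub> p \<in> wrN m L e"
      unfolding px wr_inv[OF cdiv_fs[OF \<phi>(1)]] wrN_def
      using cdiv_uminus[OF cdiv_lsh[OF \<phi>(1)]] nsub_uminus[OF L \<phi>(2)] by blast
  qed
  moreover have "p \<otimes>\<^bsub>wr m\<^esub> q \<otimes>\<^bsub>wr m\<^esub> inv\<^bsub>wr m\<^esub> p \<in> wrN m L e"
    if p: "p \<in> carrier (wr m)" and q: "q \<in> wrN m L e" for p q
  proof -
    obtain \<eta> z \<phi> x where pq: "p = (\<eta>, z)" "q = (\<phi>, x)" by (cases p, cases q)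
    have \<eta>: "\<eta> \<in> fs m" and \<phi>: "\<phi> \<in> cdiv m L e" "x \<in> L"
      using p q unfolding pq wrN_def wr_carrier by auto
    have zx: "z + x - z \<in> L" by (rule nsub_conj[OF L \<phi>(2)])
    have "lsh 0 \<eta> - lsh (z + x - z) \<eta> \<in> cdiv m L e"
      by (rule lsh_cong_cdiv[OF L _ \<eta>]) (use zx in simp)
    then have "lsh z \<phi> + (\<eta> - lsh (z + x - z) \<eta>) \<in> cdiv m L e"
      unfolding lsh_0 by (rule cdiv_add[OF cdiv_lsh[OF \<phi>(1)]])
    moreover have "lsh z \<phi> + (\<eta> - lsh (z + x - z) \<eta>) = \<eta> + lsh z \<phi> - lsh (z + x - z) \<eta>"
      by (simp only: add_diff_eq add.commute[of \<eta>])
    ultimately show ?thesis unfolding pq wr_conj[OF \<eta>] wrN_def using zx by (simp only: mem_Times_iff fst_conv snd_conv)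
  qed
  ultimately show ?thesis unfolding W.normal_inv_iff by blast
qed

lemma csum_zvec: "\<phi> \<in> fs m \<Longrightarrow> csum S \<phi> \<in> zvec m"
  by (rule csum_mem[OF fs_finite zvec_closed(1,2) fs_zvec])

text \<open>A coset is determined by the group component modulo \<open>L\<close> and by the finitely
  many coset sums modulo \<open>2 ^ e\<close> in coordinates below \<open>m\<close>. A power
  \<open>2 ^ k\<close> removes the group component, after which the power \<open>2 ^ e\<close> makes
  the function divisible by \<open>2 ^ e\<close>.\<close>

lemma p_open_wrN:
  fixes L :: "'g :: group_add set"
  assumes tors: "\<And>x :: 'g. \<exists>k. npow (2 ^ k) x = 0" and L: "nsub L" "fin_index L"
  shows "p_open 2 (wr m) (wrN m L e)"
proof -
  interpret W: group "wr m :: (('g \<Rightarrow> nat \<Rightarrow> int) \<times> 'g) monoid" by (rule group_wr)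
  let ?I = "range (coset_rep L) \<times> {..<m}"
  define f where "f = (\<lambda>(\<phi> :: 'g \<Rightarrow> nat \<Rightarrow> int, x). (coset_rep L x,
    restrict (\<lambda>(r, i). csum (coset L r) \<phi> i mod 2 ^ e) ?I))"
  show ?thesis
  proof (rule p_openI[OF group_wr two_is_prime_nat normal_wrN[OF L(1)], where f = f])
    have fin: "finite (range (coset_rep L))" by (rule finite_range_coset_rep[OF L])
    have "f ` carrier (wr m) \<subseteq> range (coset_rep L) \<times> (?I \<rightarrow>\<^sub>E {0..<2 ^ e})"
    proof (rule image_subsetI)
      fix p :: "('g \<Rightarrow> nat \<Rightarrow> int) \<times> 'g"
      show "f p \<in> range (coset_rep L) \<times> (?I \<rightarrow>\<^sub>E {0..<2 ^ e})"
        by (cases p) (simp add: f_def split_beta)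
    qed
    moreover have "finite (range (coset_rep L) \<times> (?I \<rightarrow>\<^sub>E {0..<2 ^ e :: int}))"
      using fin by (intro finite_cartesian_product finite_PiE) auto
    ultimately show "finite (f ` carrier (wr m))" by (rule finite_subset)
  next
    fix p q assume "p \<in> carrier (wr m)" "q \<in> carrier (wr m)" and eq: "f p = f q"
    then obtain \<phi> x \<psi> y where pq: "p = (\<phi>, x)" "q = (\<psi>, y)" and \<phi>: "\<phi> \<in> fs m" and \<psi>: "\<psi> \<in> fs m"
      unfolding wr_carrier by blast
    have "- y + x \<in> L" using eq coset_rep_eqD[OF L(1)] unfolding pq f_def by simp
    then have xy: "x - y \<in> L" using nsub_commute[OF L(1), of "- y" x] by simp
    have "csum (coset L g) (\<phi> - \<psi>) \<in> dyadic e" for g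
      unfolding dyadic_def
    proof (rule CollectI, rule allI)
      fix i
      define r where "r = coset_rep L g"
      have cg: "coset L g = coset L r"
        unfolding r_def by (rule coset_eq[OF L(1) nsub_cong_sym[OF L(1) coset_rep_mem[OF L(1)]]])
      show "2 ^ e dvd csum (coset L g) (\<phi> - \<psi>) i"
      proof (cases "i < m")
        case True
        then have ri: "(r, i) \<in> ?I" unfolding r_def by simp
        have "snd (f p) (r, i) = snd (f q) (r, i)" using eq by simp
        then have "csum (coset L r) \<phi> i mod 2 ^ e = csum (coset L r) \<psi> i mod 2 ^ e"
          unfolding pq f_def using ri by simp
        then show ?thesis
          unfolding cg csum_diff[OF fs_finite[OF \<phi>] fs_finite[OF \<psi>]] by (simp add: mod_eq_dvd_iff)
      next
        case False
        then show ?thesis using csum_zvec[OF fs_diff[OF \<phi> \<psi>], of "coset L g"] unfolding zvec_def by simp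
      qed
    qed
    then have "\<phi> - \<psi> \<in> cdiv m L e" unfolding cdiv_def using fs_diff[OF \<phi> \<psi>] by blast
    moreover have "lsh 0 \<psi> - lsh (x - y) \<psi> \<in> cdiv m L e"
      by (rule lsh_cong_cdiv[OF L(1) _ \<psi>]) (use xy in simp)
    ultimately have "(\<phi> - \<psi>) + (\<psi> - lsh (x - y) \<psi>) \<in> cdiv m L e" unfolding lsh_0 by (rule cdiv_add)
    then have "\<phi> - lsh (x - y) \<psi> \<in> cdiv m L e" by (simp only: add_diff_eq diff_add_cancel)
    then show "p \<otimes>\<^bsub>wr m\<^esub> inv\<^bsub>wr m\<^esub> q \<in> wrN m L e"
      unfolding pq wr_div[OF \<psi>] wrN_def using xy by blast
  next
    fix p :: "('g \<Rightarrow> nat \<Rightarrow> int) \<times> 'g" assume "p \<in> carrier (wr m)"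
    then obtain \<phi> x where p: "p = (\<phi>, x)" and \<phi>: "\<phi> \<in> fs m" unfolding wr_carrier by blast
    obtain k where k: "npow (2 ^ k) x = 0" using tors by blast
    obtain \<psi> where \<psi>: "\<psi> \<in> fs m" "(\<phi>, x) [^]\<^bsub>wr m\<^esub> (2 ^ k :: nat) = (\<psi>, npow (2 ^ k) x)" using wr_pow[OF \<phi>] by blast
    have "p [^]\<^bsub>wr m\<^esub> (2 ^ (k + e) :: nat) = (p [^]\<^bsub>wr m\<^esub> (2 ^ k :: nat)) [^]\<^bsub>wr m\<^esub> (2 ^ e :: nat)"
      using p \<phi> by (simp add: W.nat_pow_pow wr_carrier power_add)
    also have "\<dots> = (npow (2 ^ e) \<psi>, 0)" unfolding p \<psi>(2) k wr_pow_base ..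
    finally have pw: "p [^]\<^bsub>wr m\<^esub> (2 ^ (k + e) :: nat) = (npow (2 ^ e) \<psi>, 0)" .
    have fsn: "npow n \<psi> \<in> fs m" for n
      by (induction n) (simp_all only: npow.simps fs_zero fs_add[OF \<psi>(1)])
    have "csum S (npow (2 ^ e) \<psi>) \<in> dyadic e" for S
    proof (rule csum_mem[OF fs_finite[OF fsn] dyadic_closed(1,2)])
      show "npow (2 ^ e) \<psi> y \<in> dyadic e" for y unfolding dyadic_def npow_apply by simp
    qed
    then have "npow (2 ^ e) \<psi> \<in> cdiv m L e" unfolding cdiv_def using fsn by blast
    then have "p [^]\<^bsub>wr m\<^esub> (2 ^ (k + e) :: nat) \<in> wrN m L e" unfolding pw wrN_def using nsub_zero[OF L(1)] by blast
    then show "\<exists>k. p [^]\<^bsub>wr m\<^esub> (2 ^ k :: nat) \<in> wrN m L e" by blast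
  qed
qed

text \<open>\<open>L\<close> is the intersection of \<open>N\<close> with the group factor and
  \<open>2 ^ e\<close> an exponent of the quotient. Modulo \<open>N\<close>, the values of a
  function may be moved within cosets of \<open>L\<close>; collected at representatives, a function
  in \<open>cdiv m L e\<close> becomes a \<open>2 ^ e\<close>-fold multiple and so lies in
  \<open>N\<close>.\<close>

lemma p_open_contains_wrN:
  fixes N :: "(('g :: group_add \<Rightarrow> nat \<Rightarrow> int) \<times> 'g) set"
  assumes N: "p_open 2 (wr m) N"
  shows "\<exists>L e. nsub L \<and> fin_index L \<and> wrN m L e \<subseteq> N"
proof -
  interpret W: group "wr m :: (('g \<Rightarrow> nat \<Rightarrow> int) \<times> 'g) monoid" by (rule group_wr)
  note N' = p_openD[OF group_wr N]
  have N_conj: "p \<otimes>\<^bsub>wr m\<^esub> q \<otimes>\<^bsub>wr m\<^esub> inv\<^bsub>wr m\<^esub> p \<in> N" if "p \<in> carrier (wr m)" "q \<in> N" for p q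
    using N'(1) that unfolding W.normal_inv_iff by blast
  have N_mult: "p \<otimes>\<^bsub>wr m\<^esub> q \<in> N" if "p \<in> N" "q \<in> N" for p q
    using that subgroup.m_closed[OF N'(2)] by blast
  have N_inv: "inv\<^bsub>wr m\<^esub> p \<in> N" if "p \<in> N" for p
    using that subgroup.m_inv_closed[OF N'(2)] by blast
  have car: "(0, x) \<in> carrier (wr m)" for x :: 'g unfolding wr_carrier using fs_zero by blast
  define L where "L = {x. (0, x) \<in> N}"
  have L: "nsub L"
    unfolding nsub_def
  proof (intro conjI ballI allI)
    show "0 \<in> L" unfolding L_def using subgroup.one_closed[OF N'(2)] unfolding wr_one by blast
  next
    fix x y assume "x \<in> L" "y \<in> L"
    then have "(0, x) \<otimes>\<^bsub>wr m\<^esub> (0, y) \<in> N" unfolding L_def using N_mult by blast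
    then show "x + y \<in> L" unfolding L_def wr_mult lsh_zero add_0_left by blast
  next
    fix x assume "x \<in> L"
    then have "inv\<^bsub>wr m\<^esub> (0, x) \<in> N" unfolding L_def using N_inv by blast
    then show "- x \<in> L" unfolding L_def wr_inv[OF fs_zero] lsh_zero minus_zero by blast
  next
    fix g x assume "x \<in> L"
    then have "(0, g) \<otimes>\<^bsub>wr m\<^esub> (0, x) \<otimes>\<^bsub>wr m\<^esub> inv\<^bsub>wr m\<^esub> (0, g) \<in> N" unfolding L_def using N_conj[OF car] by blast
    then show "g + x - g \<in> L" unfolding L_def wr_conj[OF fs_zero] lsh_zero add_0_left diff_self by blast
  qed
  have fL: "fin_index L"
  proof (rule fin_indexI)
    show "finite (range (\<lambda>x. N #>\<^bsub>wr m\<^esub> (0, x)))"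
      by (rule finite_subset[OF _ N'(3)]) (use car in blast)
    fix x y :: 'g assume "N #>\<^bsub>wr m\<^esub> (0, x) = N #>\<^bsub>wr m\<^esub> (0, y)"
    then have "(0, x) \<otimes>\<^bsub>wr m\<^esub> inv\<^bsub>wr m\<^esub> (0, y) \<in> N" using W.rcos_eq_iff[OF N'(2) car car] by blast
    then have "x - y \<in> L" unfolding L_def wr_div[OF fs_zero] lsh_zero diff_self by blast
    then show "- y + x \<in> L" using nsub_commute[OF L, of "- y" x] by simp
  qed
  obtain e where e: "\<forall>p\<in>carrier (wr m). p [^]\<^bsub>wr m\<^esub> (2 ^ e :: nat) \<in> N" using N'(4) by blast
  define B where "B = {\<phi> \<in> fs m. (\<phi>, 0) \<in> N}"
  have B0: "0 \<in> B" unfolding B_def using subgroup.one_closed[OF N'(2)] fs_zero unfolding wr_one by blast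
  have B_add: "\<alpha> + \<beta> \<in> B" if "\<alpha> \<in> B" "\<beta> \<in> B" for \<alpha> \<beta>
  proof -
    have "(\<alpha>, 0) \<otimes>\<^bsub>wr m\<^esub> (\<beta>, 0) \<in> N" using that N_mult unfolding B_def by blast
    then show ?thesis using that fs_add unfolding B_def wr_mult lsh_0 add_0_left by blast
  qed
  \<comment> \<open>This is the commutator of \<open>(\<phi>, 0)\<close> with \<open>(0, u)\<close>,
    and \<open>(0, u)\<close> lies in the normal subgroup \<open>N\<close>.\<close>
  have B_shift: "\<phi> - lsh u \<phi> \<in> B" if \<phi>: "\<phi> \<in> fs m" and u: "u \<in> L" for \<phi> u
  proof -
    have c: "(\<phi>, 0) \<in> carrier (wr m)" using \<phi> unfolding wr_carrier by blast
    have "(\<phi>, 0) \<otimes>\<^bsub>wr m\<^esub> (0, u) \<otimes>\<^bsub>wr m\<^esub> inv\<^bsub>wr m\<^esub> (\<phi>, 0) \<in> N"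
      using N_conj[OF c] u unfolding L_def by blast
    then have "(\<phi> + lsh 0 0 - lsh (0 + u - 0) \<phi>, 0 + u - 0) \<in> N" unfolding wr_conj[OF \<phi>] .
    then have 1: "(\<phi> - lsh u \<phi>, u) \<in> N" by (simp only: lsh_0 add_0_left add_0_right diff_0_right)
    have "(\<phi> - lsh u \<phi>, u) \<otimes>\<^bsub>wr m\<^esub> inv\<^bsub>wr m\<^esub> (0, u) \<in> N"
      using N_mult[OF 1 N_inv] u unfolding L_def by blast
    then show ?thesis
      unfolding wr_div[OF fs_zero] lsh_zero diff_0_right diff_self B_def using fs_diff[OF \<phi> fs_lsh[OF \<phi>]] by blast
  qed
  have "cdiv m L e \<subseteq> B"
  proof
    fix \<phi> assume \<phi>: "\<phi> \<in> cdiv m L e"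
    have \<phi>f: "\<phi> \<in> fs m" by (rule cdiv_fs[OF \<phi>])
    define \<tau> where "\<tau> = coset_rep L"
    define \<pi> where "\<pi> = (\<lambda>r. csum {y. \<tau> y = r} \<phi>)"
    have 1: "\<phi> - \<pi> \<in> B"
      unfolding \<pi>_def
    proof (rule push_forward_mem)
      show "finite {y. \<phi> y \<noteq> 0}" by (rule fs_finite[OF \<phi>f])
      show "0 \<in> B" by (rule B0)
      show "\<alpha> + \<beta> \<in> B" if "\<alpha> \<in> B" "\<beta> \<in> B" for \<alpha> \<beta> using that by (rule B_add)
      fix y
      have "y - \<tau> y \<in> L" using coset_rep_mem[OF L, of y] nsub_commute[OF L, of "- \<tau> y" y] unfolding \<tau>_def by simp
      then have u: "\<tau> y - y \<in> L" using nsub_uminus[OF L, of "y - \<tau> y"] by simp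
      have "lsh (\<tau> y - y) (single y (\<phi> y)) = single (\<tau> y) (\<phi> y)" unfolding lsh_single by simp
      then show "single y (\<phi> y) - single (\<tau> y) (\<phi> y) \<in> B"
        using B_shift[OF fs_single[OF fs_zvec[OF \<phi>f]] u, of y y] by (simp only:)
    qed
    have "\<pi> r \<in> dyadic e" for r
    proof (cases "\<exists>y0. \<tau> y0 = r")
      case True
      then obtain y0 where y0: "\<tau> y0 = r" by blast
      have "{y. \<tau> y = r} = coset L y0"
      proof (rule Set.set_eqI)
        show "y \<in> {y. \<tau> y = r} \<longleftrightarrow> y \<in> coset L y0" for y
          using coset_rep_eqD[OF L, of y y0] coset_rep_cong[OF L, of y0 y] y0 unfolding coset_def \<tau>_def by auto
      qed
      then show ?thesis using \<phi> unfolding \<pi>_def cdiv_def by auto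
    next
      case False
      then have "{y. \<tau> y = r} = {}" by auto
      then have "\<pi> r = 0" unfolding \<pi>_def csum_def by (simp only: empty_iff simp_thms Collect_empty_eq sum.empty) simp
      then show ?thesis by (simp only: dyadic_closed(1))
    qed
    then have dy: "2 ^ e dvd \<pi> r i" for r i unfolding dyadic_def by blast
    \<comment> \<open>The division is exact, so \<open>(\<pi>, 0)\<close> is the power of
      \<open>(\<psi>, 0)\<close> with exponent \<open>2 ^ e\<close>.\<close>
    define \<psi> where "\<psi> = (\<lambda>r i. \<pi> r i div 2 ^ e)"
    have \<pi>: "\<pi> \<in> fs m" unfolding \<pi>_def by (rule fs_push[OF \<phi>f])
    have "\<psi> \<in> fs m"
    proof -
      have "\<psi> y = 0" if "\<pi> y = 0" for y by (rule ext) (simp add: \<psi>_def that)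
      then have "{y. \<psi> y \<noteq> 0} \<subseteq> {y. \<pi> y \<noteq> 0}" by blast
      then have "finite {y. \<psi> y \<noteq> 0}" using fs_finite[OF \<pi>] by (rule finite_subset)
      moreover have "\<psi> y \<in> zvec m" for y using fs_zvec[OF \<pi>, of y] unfolding \<psi>_def zvec_def by simp
      ultimately show ?thesis unfolding fs_def by blast
    qed
    then have "(\<psi>, 0) [^]\<^bsub>wr m\<^esub> (2 ^ e :: nat) \<in> N" using e unfolding wr_carrier by blast
    moreover have "npow (2 ^ e) \<psi> = \<pi>"
    proof (intro ext)
      show "npow (2 ^ e) \<psi> r i = \<pi> r i" for r i unfolding npow_apply unfolding \<psi>_def using dy[of r i] by simp
    qed
    ultimately have "\<pi> \<in> B" unfolding wr_pow_base B_def using \<pi> by simp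
    then have "(\<phi> - \<pi>) + \<pi> \<in> B" by (rule B_add[OF 1])
    then show "\<phi> \<in> B" by (simp only: diff_add_cancel)
  qed
  then have "wrN m L e \<subseteq> N"
  proof -
    assume sub: "cdiv m L e \<subseteq> B"
    show ?thesis
    proof
      fix p assume p: "p \<in> wrN m L e"
      obtain \<phi> x where px: "p = (\<phi>, x)" by (cases p)
      have "(\<phi>, 0) \<in> N" "(0, x) \<in> N" using p sub unfolding px wrN_def B_def L_def by auto
      then have "(\<phi>, 0) \<otimes>\<^bsub>wr m\<^esub> (0, x) \<in> N" by (rule N_mult)
      then show "p \<in> N" unfolding px wr_mult lsh_zero add_0_left add_0_right .
    qed
  qed
  then show ?thesis using L fL by blast
qed

text \<open>The hypothesis \<open>conj\<close> supplies closed classes in the group factor and is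
  used once, to make the group components of both elements equal; the rest is
  \<open>wreath_conj_core\<close>.\<close>

theorem p_conj_closed_wr:
  assumes tors: "\<And>x :: 'g :: group_add. \<exists>k. npow (2 ^ k) x = 0"
    and resid: "\<And>y :: 'g. y \<noteq> 0 \<Longrightarrow> \<exists>M. nsub M \<and> fin_index M \<and> y \<notin> M"
    and conj: "\<And>L (x :: 'g) y. nsub L \<Longrightarrow> fin_index L \<Longrightarrow>
      (\<And>M. nsub M \<Longrightarrow> fin_index M \<Longrightarrow> \<exists>z\<in>L. (z + x - z) - y \<in> M) \<Longrightarrow> \<exists>z\<in>L. z + x - z = y"
  shows "p_conj_closed 2 (wr m :: (('g \<Rightarrow> nat \<Rightarrow> int) \<times> 'g) monoid)"
  unfolding p_conj_closed_def
proof (intro allI impI)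
  fix N :: "(('g \<Rightarrow> nat \<Rightarrow> int) \<times> 'g) set" assume "p_open 2 (wr m) N"
  then obtain L e where L: "nsub L" "fin_index L" and LN: "wrN m L e \<subseteq> N" using p_open_contains_wrN by blast
  have "p_conj_closed_by 2 (wr m) (wrN m L e)"
    unfolding p_conj_closed_by_def
  proof (intro allI impI)
    fix f g :: "('g \<Rightarrow> nat \<Rightarrow> int) \<times> 'g"
    assume fg: "f \<in> carrier (wr m)" "g \<in> carrier (wr m)"
      and appr: "\<forall>M. p_open 2 (wr m) M \<longrightarrow>
        (\<exists>h\<in>wrN m L e. \<exists>u\<in>M. g = h \<otimes>\<^bsub>wr m\<^esub> f \<otimes>\<^bsub>wr m\<^esub> inv\<^bsub>wr m\<^esub> h \<otimes>\<^bsub>wr m\<^esub> u)"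
    obtain \<phi> x where f: "f = (\<phi>, x)" and \<phi>: "\<phi> \<in> fs m" using fg unfolding wr_carrier by blast
    obtain \<psi> y where g: "g = (\<psi>, y)" and \<psi>: "\<psi> \<in> fs m" using fg unfolding wr_carrier by blast
    have A: "\<exists>\<eta>\<in>cdiv m L e. \<exists>z\<in>L. \<exists>\<zeta>\<in>cdiv m L' e'. \<exists>w\<in>L'. y = (z + x - z) + w \<and>
        \<psi> = \<eta> + lsh z \<phi> - lsh (z + x - z) \<eta> + lsh (z + x - z) \<zeta>"
      if L': "nsub L'" "fin_index L'" for L' e'
    proof -
      obtain h u where hu: "h \<in> wrN m L e" "u \<in> wrN m L' e'"
        "g = h \<otimes>\<^bsub>wr m\<^esub> f \<otimes>\<^bsub>wr m\<^esub> inv\<^bsub>wr m\<^esub> h \<otimes>\<^bsub>wr m\<^esub> u"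
        using appr p_open_wrN[OF tors L'] by blast
      obtain \<eta> z \<zeta> w where h: "h = (\<eta>, z)" "\<eta> \<in> cdiv m L e" "z \<in> L"
        and u: "u = (\<zeta>, w)" "\<zeta> \<in> cdiv m L' e'" "w \<in> L'" using hu(1,2) unfolding wrN_def by blast
      have "(\<psi>, y) = (\<eta> + lsh z \<phi> - lsh (z + x - z) \<eta> + lsh (z + x - z) \<zeta>, (z + x - z) + w)"
        using hu(3) unfolding f g h(1) u(1) unfolding wr_conj[OF cdiv_fs[OF h(2)]] unfolding wr_mult .
      then show ?thesis using h(2,3) u(2,3) unfolding prod.inject by blast
    qed
    have "\<exists>z\<in>L. (z + x - z) - y \<in> L'" if L': "nsub L'" "fin_index L'" for L'
    proof -
      obtain z w where z: "z \<in> L" "w \<in> L'" "y = (z + x - z) + w" using A[OF L'] by blast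
      define x' where "x' = z + x - z"
      have "x' - y = x' + - w - x'" unfolding z(3)[folded x'_def] by (simp only: group_add_simps)
      then have "x' - y \<in> L'" using nsub_conj[OF L'(1) nsub_uminus[OF L'(1) z(2)]] by metis
      then show ?thesis using z(1) unfolding x'_def by blast
    qed
    then obtain z0 where z0: "z0 \<in> L" "z0 + x - z0 = y" using conj[OF L] by blast
    obtain k where k: "npow (2 ^ k) y = 0" using tors by blast
    \<comment> \<open>Conjugating \<open>f\<close> by \<open>(0, z0)\<close> gives
      \<open>(lsh z0 \<phi>, y)\<close>. Approximate conjugators \<open>z\<close> of
      \<open>f\<close> turn into \<open>z - z0\<close>, which remain in \<open>L\<close>.\<close>
    have "\<exists>\<eta>\<in>cdiv m L e. \<exists>z\<in>L. z + y - z = y \<and> \<psi> = \<eta> + lsh z (lsh z0 \<phi>) - lsh y \<eta>"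
    proof (rule wreath_conj_core[OF resid _ k L fs_lsh[OF \<phi>] \<psi>])
      show "(0 :: nat) < 2 ^ k" by simp
      fix L' :: "'g set" and e' assume L': "nsub L'" "fin_index L'"
      obtain \<eta> z \<zeta> w where a: "\<eta> \<in> cdiv m L e" "z \<in> L" "\<zeta> \<in> cdiv m L' e'" "w \<in> L'"
        "y = (z + x - z) + w" "\<psi> = \<eta> + lsh z \<phi> - lsh (z + x - z) \<eta> + lsh (z + x - z) \<zeta>"
        using A[OF L', of e'] by blast
      have zz: "z - z0 \<in> L" by (rule nsub_minus[OF L(1) a(2) z0(1)])
      have e1: "(z - z0) + y - (z - z0) = z + x - z"
        unfolding z0(2)[symmetric] by (simp only: group_add_simps)
      have e2: "lsh (z - z0) (lsh z0 \<phi>) = lsh z \<phi>" unfolding lsh_lsh by simp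
      show "\<exists>\<eta>\<in>cdiv m L e. \<exists>z\<in>L. \<exists>\<zeta>\<in>cdiv m L' e'. \<exists>w\<in>L'. y = (z + y - z) + w \<and>
        \<psi> = \<eta> + lsh z (lsh z0 \<phi>) - lsh (z + y - z) \<eta> + lsh (z + y - z) \<zeta>"
        by (intro bexI[OF _ a(1)] bexI[OF _ zz] bexI[OF _ a(3)] bexI[OF _ a(4)] conjI; unfold e1 e2; fact a(5) a(6))
    qed (assumption | rule resid)+
    then obtain \<eta> z where a: "\<eta> \<in> cdiv m L e" "z \<in> L" "z + y - z = y" "\<psi> = \<eta> + lsh z (lsh z0 \<phi>) - lsh y \<eta>" by blast
    have zz: "(z + z0) + x - (z + z0) = y" using a(3) unfolding z0(2)[symmetric] conj_conj .
    have "g = (\<eta>, z + z0) \<otimes>\<^bsub>wr m\<^esub> f \<otimes>\<^bsub>wr m\<^esub> inv\<^bsub>wr m\<^esub> (\<eta>, z + z0)"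
      unfolding f g wr_conj[OF cdiv_fs[OF a(1)]] zz using a(4) unfolding lsh_lsh by blast
    moreover have "(\<eta>, z + z0) \<in> wrN m L e" unfolding wrN_def using a(1) nsub_plus[OF L(1) a(2) z0(1)] by blast
    ultimately show "\<exists>h\<in>wrN m L e. g = h \<otimes>\<^bsub>wr m\<^esub> f \<otimes>\<^bsub>wr m\<^esub> inv\<^bsub>wr m\<^esub> h" by blast
  qed
  then show "\<exists>N'\<subseteq>N. p_open 2 (wr m) N' \<and> p_conj_closed_by 2 (wr m) N'"
    using p_open_wrN[OF tors L] LN by blast
qed

section \<open>Identification with the restricted wreath product\<close>

lemma Rep_grig_plus_fun: "Rep_grig (x + y) = Rep_grig x \<circ> Rep_grig y"
  by (rule ext) simp

lemma Rep_grig_uminus: "Rep_grig (- x) = inv\<^bsub>grigorchuk_group\<^esub> Rep_grig x"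
  unfolding uminus_grig_def
  by (rule Abs_grig_inverse) (rule group.inv_closed[OF group_grigorchuk_group Rep_grig])

abbreviation (input) "zpow m \<equiv> product_group {..<m} (\<lambda>_. integer_group)"

lemma group_zpow: "group (zpow m)"
  by simp

lemma carrier_wreath_base:
  "f \<in> carrier (sum_group (carrier grigorchuk_group) (\<lambda>_. zpow m)) \<longleftrightarrow>
    f \<in> carrier grigorchuk_group \<rightarrow>\<^sub>E ({..<m} \<rightarrow>\<^sub>E UNIV) \<and>
    finite {g \<in> carrier grigorchuk_group. f g \<noteq> (\<lambda>i\<in>{..<m}. 0)}"
  by (simp add: carrier_sum_group group_zpow)

text \<open>The product group uses functions that are \<open>undefined\<close> outside
  \<open>{..<m}\<close>, whereas \<open>zvec\<close> uses functions that vanish there; the case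
  distinction translates between the two conventions.\<close>

definition flatten :: "nat \<Rightarrow> ((bool list \<Rightarrow> bool list) \<Rightarrow> nat \<Rightarrow> int) \<times> (bool list \<Rightarrow> bool list)
    \<Rightarrow> (grig \<Rightarrow> nat \<Rightarrow> int) \<times> grig" where
  "flatten m = (\<lambda>(f, g). (\<lambda>y i. if i < m then f (Rep_grig y) i else 0, Abs_grig g))"

definition unflatten :: "nat \<Rightarrow> (grig \<Rightarrow> nat \<Rightarrow> int) \<times> grig
    \<Rightarrow> ((bool list \<Rightarrow> bool list) \<Rightarrow> nat \<Rightarrow> int) \<times> (bool list \<Rightarrow> bool list)" where
  "unflatten m = (\<lambda>(\<phi>, x). (\<lambda>g\<in>carrier grigorchuk_group. \<lambda>i\<in>{..<m}. \<phi> (Abs_grig g) i, Rep_grig x))"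

lemma flatten_iso: "flatten m \<in> iso (restricted_wreath (zpow m) grigorchuk_group) (wr m)"
proof -
  let ?G = "carrier grigorchuk_group"
  let ?H = "restricted_wreath (zpow m) grigorchuk_group"
  have H_carrier: "carrier ?H = carrier (sum_group ?G (\<lambda>_. zpow m)) \<times> ?G"
    by (simp add: restricted_wreath_def Let_def)
  have H_mult: "(f, g) \<otimes>\<^bsub>?H\<^esub> (f', g')
      = ((\<lambda>x\<in>?G. \<lambda>i\<in>{..<m}. f x i + left_shift grigorchuk_group g f' x i), g \<circ> g')" for f g f' g'
    by (simp add: restricted_wreath_def Let_def)
  have to_wr: "flatten m p \<in> carrier (wr m)" if "p \<in> carrier ?H" for p
  proof -
    obtain f g where p: "p = (f, g)" by (cases p)
    have f: "finite {g \<in> ?G. f g \<noteq> (\<lambda>i\<in>{..<m}. 0)}"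
      using that unfolding p H_carrier mem_Times_iff fst_conv carrier_wreath_base by blast
    define \<phi> where "\<phi> = (\<lambda>y i. if i < m then f (Rep_grig y) i else 0)"
    have "{y. \<phi> y \<noteq> 0} \<subseteq> Rep_grig -` {g \<in> ?G. f g \<noteq> (\<lambda>i\<in>{..<m}. 0)}"
    proof
      fix y assume y: "y \<in> {y. \<phi> y \<noteq> 0}"
      have "\<phi> y = 0" if "f (Rep_grig y) = (\<lambda>i\<in>{..<m}. 0)"
        by (rule ext) (simp add: \<phi>_def that)
      then show "y \<in> Rep_grig -` {g \<in> ?G. f g \<noteq> (\<lambda>i\<in>{..<m}. 0)}" using y Rep_grig by blast
    qed
    moreover have "finite (Rep_grig -` {g \<in> ?G. f g \<noteq> (\<lambda>i\<in>{..<m}. 0)})"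
      by (rule finite_vimageI[OF f]) (simp add: inj_def Rep_grig_inject)
    ultimately have "finite {y. \<phi> y \<noteq> 0}" by (rule finite_subset)
    moreover have "\<phi> y \<in> zvec m" for y unfolding \<phi>_def zvec_def by simp
    ultimately have "\<phi> \<in> fs m" unfolding fs_def by blast
    then show ?thesis unfolding p flatten_def \<phi>_def wr_carrier by simp
  qed
  have from_wr: "unflatten m q \<in> carrier ?H" if q': "q \<in> carrier (wr m)" for q
  proof -
    obtain \<phi> x where q: "q = (\<phi>, x)" and \<phi>: "\<phi> \<in> fs m" using q' unfolding wr_carrier by blast
    define f where "f = (\<lambda>g\<in>?G. \<lambda>i\<in>{..<m}. \<phi> (Abs_grig g) i)"
    have "{g \<in> ?G. f g \<noteq> (\<lambda>i\<in>{..<m}. 0)} \<subseteq> Rep_grig ` {y. \<phi> y \<noteq> 0}"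
    proof
      fix g assume g: "g \<in> {g \<in> ?G. f g \<noteq> (\<lambda>i\<in>{..<m}. 0)}"
      have "f g = (\<lambda>i\<in>{..<m}. 0)" if "\<phi> (Abs_grig g) = 0" 
        by (rule ext) (use g that in \<open>simp add: f_def\<close>)
      then have "Abs_grig g \<in> {y. \<phi> y \<noteq> 0}" using g by blast
      then have "Rep_grig (Abs_grig g) \<in> Rep_grig ` {y. \<phi> y \<noteq> 0}" by (rule imageI)
      then show "g \<in> Rep_grig ` {y. \<phi> y \<noteq> 0}" using g by (simp add: Abs_grig_inverse)
    qed
    then have "finite {g \<in> ?G. f g \<noteq> (\<lambda>i\<in>{..<m}. 0)}"
      by (rule finite_subset) (rule finite_imageI[OF fs_finite[OF \<phi>]])
    moreover have "f \<in> ?G \<rightarrow>\<^sub>E ({..<m} \<rightarrow>\<^sub>E UNIV)" unfolding f_def by simp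
    ultimately show ?thesis
      unfolding q unflatten_def H_carrier mem_Times_iff carrier_wreath_base split fst_conv snd_conv f_def[symmetric]
      using Rep_grig by blast
  qed
  have "flatten m \<in> hom ?H (wr m)"
  proof (rule homI)
    show "flatten m p \<in> carrier (wr m)" if "p \<in> carrier ?H" for p using that by (rule to_wr)
    fix p q assume pq: "p \<in> carrier ?H" "q \<in> carrier ?H"
    obtain f g f' g' where p: "p = (f, g)" and q: "q = (f', g')" by (cases p, cases q)
    have g: "g \<in> ?G" "g' \<in> ?G" using pq unfolding p q H_carrier by auto
    define x where "x = Abs_grig g"
    have gx: "g = Rep_grig x" unfolding x_def using g(1) by (simp add: Abs_grig_inverse)
    define x' where "x' = Abs_grig g'"
    have gx': "g' = Rep_grig x'" unfolding x'_def using g(2) by (simp add: Abs_grig_inverse)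
    have ls: "left_shift grigorchuk_group g f' (Rep_grig y) = f' (Rep_grig (- x + y))" for y
      unfolding left_shift_def gx Rep_grig_plus_fun Rep_grig_uminus using Rep_grig by simp
    have "(\<lambda>y i. if i < m then (\<lambda>x\<in>?G. \<lambda>i\<in>{..<m}. f x i + left_shift grigorchuk_group g f' x i) (Rep_grig y) i else 0)
      = (\<lambda>y i. if i < m then f (Rep_grig y) i else 0) + lsh x (\<lambda>y i. if i < m then f' (Rep_grig y) i else 0)"
      (is "?l = ?r")
    proof (intro ext)
      fix y i
      show "?l y i = ?r y i" using Rep_grig[of y] by (simp add: lsh_def ls)
    qed
    moreover have "Abs_grig (g \<circ> g') = x + x'" unfolding gx gx' plus_grig_def ..
    ultimately show "flatten m (p \<otimes>\<^bsub>?H\<^esub> q) = flatten m p \<otimes>\<^bsub>wr m\<^esub> flatten m q"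
      unfolding p q H_mult flatten_def split wr_mult x_def x'_def by (simp only:)
  qed
  moreover have "bij_betw (flatten m) (carrier ?H) (carrier (wr m))"
  proof (rule bij_betwI[where g = "unflatten m"])
    show "flatten m \<in> carrier ?H \<rightarrow> carrier (wr m)" using to_wr by blast
    show "unflatten m \<in> carrier (wr m) \<rightarrow> carrier ?H" using from_wr by blast
  next
    fix p assume p': "p \<in> carrier ?H"
    obtain f g where p: "p = (f, g)" by (cases p)
    have f: "f \<in> ?G \<rightarrow>\<^sub>E ({..<m} \<rightarrow>\<^sub>E UNIV)" "g \<in> ?G"
      using p' unfolding p H_carrier mem_Times_iff fst_conv snd_conv carrier_wreath_base by blast+
    have "(\<lambda>g\<in>?G. \<lambda>i\<in>{..<m}. if i < m then f (Rep_grig (Abs_grig g)) i else 0) = f"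
    proof (rule extensionalityI[of _ ?G])
      show "(\<lambda>g\<in>?G. \<lambda>i\<in>{..<m}. if i < m then f (Rep_grig (Abs_grig g)) i else 0) \<in> extensional ?G" by simp
      show "f \<in> extensional ?G" using f(1) by (simp add: PiE_def)
      fix h assume h: "h \<in> ?G"
      then have fh: "f h \<in> {..<m} \<rightarrow>\<^sub>E UNIV" using f(1) by (rule PiE_mem[rotated])
      have "(\<lambda>g\<in>?G. \<lambda>i\<in>{..<m}. if i < m then f (Rep_grig (Abs_grig g)) i else 0) h
        = (\<lambda>i\<in>{..<m}. if i < m then f h i else 0)"
        using h by (simp add: Abs_grig_inverse cong: if_cong)
      also have "\<dots> = f h"
        by (rule extensionalityI[of _ "{..<m}"]) (use fh in \<open>simp_all add: PiE_def\<close>)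
      finally show "(\<lambda>g\<in>?G. \<lambda>i\<in>{..<m}. if i < m then f (Rep_grig (Abs_grig g)) i else 0) h = f h" .
    qed
    then show "unflatten m (flatten m p) = p"
      unfolding p flatten_def unflatten_def by (simp only: split Abs_grig_inverse[OF f(2)])
  next
    fix q :: "(grig \<Rightarrow> nat \<Rightarrow> int) \<times> grig" assume "q \<in> carrier (wr m)"
    then obtain \<phi> x where q: "q = (\<phi>, x)" and \<phi>: "\<phi> \<in> fs m" unfolding wr_carrier by blast
    have "(if i < m then (\<lambda>g\<in>?G. \<lambda>i\<in>{..<m}. \<phi> (Abs_grig g) i) (Rep_grig y) i else 0) = \<phi> y i" for y i
      using fs_zvec[OF \<phi>, of y] Rep_grig[of y] by (simp add: Rep_grig_inverse zvec_def)
    then show "flatten m (unflatten m q) = q"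
      unfolding q flatten_def unflatten_def by (simp add: Rep_grig_inverse)
  qed
  ultimately show ?thesis by (simp add: iso_def)
qed

lemma p_conj_closed_grig: "p_conj_closed 2 (wr m :: ((grig \<Rightarrow> nat \<Rightarrow> int) \<times> grig) monoid)"
proof (rule p_conj_closed_wr)
  show "\<exists>k. npow (2 ^ k) x = 0" for x :: grig by (rule grig_torsion)
  show "\<exists>M. nsub M \<and> fin_index M \<and> y \<notin> M" if y: "y \<noteq> 0" for y :: grig
  proof -
    obtain n where "\<not> cong n y 0" using cong_all_eq[of y 0] y by auto
    then have "y \<notin> {g. cong n g 0}" by simp
    then show ?thesis using level_stabiliser[of n] by blast
  qed
  fix L :: "grig set" and x y
  assume L: "nsub L" "fin_index L"
    and appr: "\<And>M. nsub M \<Longrightarrow> fin_index M \<Longrightarrow> \<exists>z\<in>L. (z + x - z) - y \<in> M"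
  have "near_conj L x y"
    unfolding near_conj_def
  proof
    fix n
    obtain z where "z \<in> L" "(z + x - z) - y \<in> {g. cong n g 0}" using appr[OF level_stabiliser] by blast
    then show "\<exists>z\<in>L. cong n (z + x - z) y" using cong_diff_zero by blast
  qed
  then show "\<exists>z\<in>L. z + x - z = y"
    using fin_index_conj_separates[OF L] unfolding conj_separates_def conj_by_def by blast
qed

theorem corollary1p4:
  fixes m :: nat
  shows "p_hereditarily_conj_separable 2
           (restricted_wreath (product_group {..<m} (\<lambda>_. integer_group)) grigorchuk_group)"
proof -
  have H: "group (restricted_wreath (zpow m) grigorchuk_group)"
    by (rule group_restricted_wreath[OF group_zpow group_grigorchuk_group])
  show ?thesis
    by (rule p_hereditarily_conj_separable_of_closed[OF H two_is_prime_nat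
          p_conj_closed_iso[OF H group_wr two_is_prime_nat flatten_iso p_conj_closed_grig]])
qed

end
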